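(* Let $T$ be a triangulation of the sphere with more than four vertices, with vertex set $V$ and edge set $E$, and let $W$ be the set of functions $\Theta:E\to(0,\pi)$ satisfying conditions (c1)–(c4) of the context. Let $\{\mathcal P_n\}$ be a sequence of irreducible circle patterns on $\hat{\mathbb C}$, each of which has contact graph isomorphic to the $1$-skeleton of $T$. If the corresponding sequence $\{\Theta_n\}$ of overlap angle functions stays in a compact subset of $W$, then $\{\mathcal P_n\}$ (modulo linear and anti-linear fractional maps) contains a subsequence convergent to an irreducible circle pattern with the same contact graph.
   Context: A triangulation $T$ of the sphere has vertices $V$, edges $E$ and triangles (faces); the edge joining $u,w$ is $[u,w]$. A simple closed curve formed by edges separates the vertices of $T$ if both components of its complement contain vertices of $T$. The set $W\subset(0,\pi)^{E}$ (with the subspace topology) consists of the functions $\Theta:E\to(0,\pi)$ such that: (c1) if $e_1,e_2$ form a simple arc with non-adjacent endpoints, then $\Theta(e_1)+\Theta(e_2)\le\pi$, and at least one of these inequalities is strict when $T$ is the boundary of a double tetrahedron (triangular bipyramid); (c2) if $e_1,e_2,e_3$ form the boundary of a triangle of $T$, then $\sum_{\mu=1}^3\Theta(e_\mu)>\pi$, and $\Theta(e_1)+\Theta(e_2)<\Theta(e_3)+\pi$, $\Theta(e_2)+\Theta(e_3)<\Theta(e_1)+\pi$, $\Theta(e_3)+\Theta(e_1)<\Theta(e_2)+\pi$; (c3) if $e_1,e_2,e_3$ form a simple closed curve separating the vertices of $T$, then $\sum_{\mu=1}^3\Theta(e_\mu)<\pi$; (c4) if $e_1,e_2,e_3,e_4$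 form a simple closed curve separating the vertices of $T$, then $\sum_{\mu=1}^4\Theta(e_\mu)<2\pi$. A circle pattern $\mathcal P=\{D(v)\}_{v\in V}$ on the Riemann sphere $\hat{\mathbb C}$ is a collection of closed round disks. Contact graph isomorphic to the $1$-skeleton of $T$ means: for distinct $u,w\in V$, $D(u)\cap D(w)\neq\emptyset$ if and only if $[u,w]\in E$. Identify $\hat{\mathbb C}$ with the unit sphere via $ds=\frac{2|dz|}{1+|z|^2}$, with distance $d$. The overlap angle $\Theta([u,w])\in[0,\pi)$ of $D(u),D(w)$, with spherical centers $z_u,z_w$ and spherical radii $r_u,r_w\in(0,\pi)$, is given by $\cos\Theta=\frac{\cos r_u\cos r_w-\cos d(z_u,z_w)}{\sin r_u\sin r_w}$; this defines the overlap angle function $E\to[0,\pi)$ of the pattern. The pattern is irreducible if $\bigcup_{v\in A}D(v)\subsetneq\hat{\mathbb C}$ for every strict subset $A\subsetneq V$. Linear and anti-linear fractional maps are $z\mapsto\frac{az+b}{cz+d}$ and $z\mapsto\frac{a\bar z+b}{c\bar z+d}$, $ad-bc\ne0$. Convergence modulo these maps means that after applying such a map $\phi_n$ to each $\mathcal P_n$, for each $v\in V$ the spherical center and radius of $\phi_n(D_n(v))$ converge (along the subsequence) to those of the disk $D_\infty(v)$ of the limit pattern. *)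

theory Defs
  imports "HOL-Analysis.Analysis"
begin

section \<open>Triangulations of the sphere\<close>

text \<open>
  A triangulation is given by its set \<open>T\<close> of triangles, each a three-element set of vertices;
  the vertex set is the whole (finite) type \<open>'v\<close>. Its geometric realization lives in the
  standard simplex of \<open>real ^ 'v\<close>, the vertex \<open>v\<close> being the unit vector \<open>axis v 1\<close>. As these
  vectors are affinely independent, two simplices meet exactly in their common face.
\<close>

definition std_simplex :: "'v::finite set \<Rightarrow> (real ^ 'v) set" where
  "std_simplex s = convex hull ((\<lambda>v. axis v 1) ` s)"

definition realization :: "'v::finite set set \<Rightarrow> (real ^ 'v) set" where
  "realization S = (\<Union>s\<in>S. std_simplex s)"

definition sphere_triangulation :: "'v::finite set set \<Rightarrow> bool" where
  "sphere_triangulation T \<longleftrightarrow>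
     (\<forall>t\<in>T. card t = 3) \<and> \<Union>T = UNIV \<and> realization T homeomorphic sphere (0 :: real ^ 3) 1"

text \<open>The edge \<open>[u,w]\<close> is the two-element set \<open>{u,w}\<close>.\<close>

definition edges :: "'v set set \<Rightarrow> 'v set set" where
  "edges T = {e. card e = 2 \<and> (\<exists>t\<in>T. e \<subseteq> t)}"

text \<open>
  For a simple closed curve formed by a set \<open>C\<close> of edges: every (that is, each of the two)
  component of its complement contains a vertex.
\<close>

definition separates_vertices :: "'v::finite set set \<Rightarrow> 'v set set \<Rightarrow> bool" where
  "separates_vertices T C \<longleftrightarrow>
     (\<forall>U\<in>components (realization T - realization C). \<exists>v. axis v 1 \<in> U)"

text \<open>The boundary of a double tetrahedron with apexes \<open>a\<close>, \<open>b\<close> glued along \<open>x\<close>, \<open>y\<close>, \<open>z\<close>.\<close>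

definition double_tetrahedron :: "'v set set \<Rightarrow> bool" where
  "double_tetrahedron T \<longleftrightarrow>
     (\<exists>a b x y z. distinct [a, b, x, y, z] \<and>
        T = {{a,x,y}, {a,y,z}, {a,z,x}, {b,x,y}, {b,y,z}, {b,z,x}})"

definition nonadjacent_arc :: "'v set set \<Rightarrow> 'v \<Rightarrow> 'v \<Rightarrow> 'v \<Rightarrow> bool" where
  "nonadjacent_arc T u v w \<longleftrightarrow>
     {u,v} \<in> edges T \<and> {v,w} \<in> edges T \<and> u \<noteq> w \<and> {u,w} \<notin> edges T"

section \<open>The angle space\<close>

definition cond1 :: "'v::finite set set \<Rightarrow> ('v set \<Rightarrow> real) \<Rightarrow> bool" where
  "cond1 T \<Theta> \<longleftrightarrow>
     (\<forall>u v w. nonadjacent_arc T u v w \<longrightarrow> \<Theta> {u,v} + \<Theta> {v,w} \<le> pi) \<and>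
     (double_tetrahedron T \<longrightarrow>
        (\<exists>u v w. nonadjacent_arc T u v w \<and> \<Theta> {u,v} + \<Theta> {v,w} < pi))"

definition cond2 :: "'v::finite set set \<Rightarrow> ('v set \<Rightarrow> real) \<Rightarrow> bool" where
  "cond2 T \<Theta> \<longleftrightarrow>
     (\<forall>u v w. {u,v,w} \<in> T \<longrightarrow>
        \<Theta> {u,v} + \<Theta> {v,w} + \<Theta> {w,u} > pi \<and>
        \<Theta> {u,v} + \<Theta> {v,w} < \<Theta> {w,u} + pi \<and>
        \<Theta> {v,w} + \<Theta> {w,u} < \<Theta> {u,v} + pi \<and>
        \<Theta> {w,u} + \<Theta> {u,v} < \<Theta> {v,w} + pi)"

definition cond3 :: "'v::finite set set \<Rightarrow> ('v set \<Rightarrow> real) \<Rightarrow> bool" where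
  "cond3 T \<Theta> \<longleftrightarrow>
     (\<forall>a b c. distinct [a, b, c] \<and> {{a,b}, {b,c}, {c,a}} \<subseteq> edges T \<and>
        separates_vertices T {{a,b}, {b,c}, {c,a}} \<longrightarrow>
        \<Theta> {a,b} + \<Theta> {b,c} + \<Theta> {c,a} < pi)"

definition cond4 :: "'v::finite set set \<Rightarrow> ('v set \<Rightarrow> real) \<Rightarrow> bool" where
  "cond4 T \<Theta> \<longleftrightarrow>
     (\<forall>a b c d. distinct [a, b, c, d] \<and> {{a,b}, {b,c}, {c,d}, {d,a}} \<subseteq> edges T \<and>
        separates_vertices T {{a,b}, {b,c}, {c,d}, {d,a}} \<longrightarrow>
        \<Theta> {a,b} + \<Theta> {b,c} + \<Theta> {c,d} + \<Theta> {d,a} < 2 * pi)"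

text \<open>Functions on the edge set are represented by extensional functions.\<close>

definition angle_space :: "'v::finite set set \<Rightarrow> ('v set \<Rightarrow> real) set" where
  "angle_space T =
     {\<Theta> \<in> edges T \<rightarrow>\<^sub>E {0<..<pi}. cond1 T \<Theta> \<and> cond2 T \<Theta> \<and> cond3 T \<Theta> \<and> cond4 T \<Theta>}"

definition angle_topology :: "'v::finite set set \<Rightarrow> ('v set \<Rightarrow> real) topology" where
  "angle_topology T = subtopology (powertop_real (edges T)) (angle_space T)"

section \<open>The Riemann sphere\<close>

datatype riemann_sphere = Finite complex | Infinity

text \<open>
  Stereographic projection onto the unit sphere; it pulls the round metric back to
  \<open>2 |dz| / (1 + |z|^2)\<close>, so the distance of that metric is the great-circle distance.
\<close>

fun stereo :: "riemann_sphere \<Rightarrow> real ^ 3" where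
  "stereo (Finite z) =
     vector [2 * Re z, 2 * Im z, (cmod z)\<^sup>2 - 1] /\<^sub>R (1 + (cmod z)\<^sup>2)"
| "stereo Infinity = vector [0, 0, 1]"

definition sph_dist :: "riemann_sphere \<Rightarrow> riemann_sphere \<Rightarrow> real" where
  "sph_dist p q = arccos (stereo p \<bullet> stereo q)"

fun linear_fractional :: "complex \<Rightarrow> complex \<Rightarrow> complex \<Rightarrow> complex \<Rightarrow> riemann_sphere \<Rightarrow> riemann_sphere"
where
  "linear_fractional a b c d (Finite z) =
     (if c * z + d = 0 then Infinity else Finite ((a * z + b) / (c * z + d)))"
| "linear_fractional a b c d Infinity = (if c = 0 then Infinity else Finite (a / c))"

fun conjugation :: "riemann_sphere \<Rightarrow> riemann_sphere" where
  "conjugation (Finite z) = Finite (cnj z)"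
| "conjugation Infinity = Infinity"

definition fractional_map :: "(riemann_sphere \<Rightarrow> riemann_sphere) \<Rightarrow> bool" where
  "fractional_map \<phi> \<longleftrightarrow>
     (\<exists>a b c d. a * d - b * c \<noteq> 0 \<and>
        (\<phi> = linear_fractional a b c d \<or> \<phi> = linear_fractional a b c d \<circ> conjugation))"

section \<open>Circle patterns\<close>

text \<open>
  \<open>D\<close> is the closed disk with spherical center \<open>z\<close> and spherical radius \<open>r\<close>. For \<open>0 < r < pi\<close>
  the set \<open>D\<close> determines both \<open>z\<close> and \<open>r\<close>.
\<close>

definition round_disk :: "riemann_sphere set \<Rightarrow> riemann_sphere \<Rightarrow> real \<Rightarrow> bool" where
  "round_disk D z r \<longleftrightarrow> 0 < r \<and> r < pi \<and> D = {x. sph_dist z x \<le> r}"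

definition circle_pattern :: "('v \<Rightarrow> riemann_sphere set) \<Rightarrow> bool" where
  "circle_pattern P \<longleftrightarrow> (\<forall>v. \<exists>z r. round_disk (P v) z r)"

definition irreducible_pattern :: "('v \<Rightarrow> riemann_sphere set) \<Rightarrow> bool" where
  "irreducible_pattern P \<longleftrightarrow> (\<forall>A. A \<subset> UNIV \<longrightarrow> (\<Union>v\<in>A. P v) \<subset> UNIV)"

definition has_contact_graph :: "('v \<Rightarrow> riemann_sphere set) \<Rightarrow> 'v set set \<Rightarrow> bool" where
  "has_contact_graph P T \<longleftrightarrow>
     (\<forall>u w. u \<noteq> w \<longrightarrow> (P u \<inter> P w \<noteq> {} \<longleftrightarrow> {u,w} \<in> edges T))"

definition overlap_angle :: "riemann_sphere set \<Rightarrow> riemann_sphere set \<Rightarrow> real \<Rightarrow> bool" where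
  "overlap_angle D D' \<theta> \<longleftrightarrow> 0 \<le> \<theta> \<and> \<theta> < pi \<and>
     (\<exists>z r z' r'. round_disk D z r \<and> round_disk D' z' r' \<and>
        cos \<theta> = (cos r * cos r' - cos (sph_dist z z')) / (sin r * sin r'))"

definition overlap_angle_function ::
  "'v set set \<Rightarrow> ('v \<Rightarrow> riemann_sphere set) \<Rightarrow> ('v set \<Rightarrow> real) \<Rightarrow> bool" where
  "overlap_angle_function T P \<Theta> \<longleftrightarrow> \<Theta> \<in> extensional (edges T) \<and>
     (\<forall>u w. {u,w} \<in> edges T \<longrightarrow> overlap_angle (P u) (P w) (\<Theta> {u,w}))"

text \<open>Convergence of the spherical centers and radii of all disks.\<close>

definition patterns_converge ::
  "(nat \<Rightarrow> 'v \<Rightarrow> riemann_sphere set) \<Rightarrow> ('v \<Rightarrow> riemann_sphere set) \<Rightarrow> bool" where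
  "patterns_converge Q Q' \<longleftrightarrow>
     (\<forall>v. \<exists>z r z' r'. (\<forall>k. round_disk (Q k v) (z k) (r k)) \<and> round_disk (Q' v) z' r' \<and>
        (\<lambda>k. sph_dist (z k) z') \<longlonglongrightarrow> 0 \<and> r \<longlonglongrightarrow> r')"

end

theory Submission
  imports Defs
begin

text \<open>
  A disk of the Riemann sphere is represented by a unit spacelike vector of Minkowski space
  \<open>real ^ 3 \<times> real\<close> (\<open>mink\<close>, \<open>cap\<close>), fractional maps acting by Lorentz transformations. Products of the
  vectors are \<open>- cos \<Theta>\<close> for adjacent vertices and less than \<open>- 1\<close> for nonadjacent ones. At a face the
  second angle condition makes the Gram matrix positive definite, so an affine map moves the timelike
  vector orthogonal to the three disks of one chosen face to the time axis (\<open>normalizing_boost\<close>). Along a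
  subsequence all angles, centers and radii converge, and the angles converge to a point of the
  angle space. It remains to show that no disk degenerates, that nonadjacent disks do not become tangent,
  and that the limit is irreducible.

  The global input is that the disks of every pattern cover the sphere (\<open>caps_cover_sphere\<close>). If they
  missed a point, they would be convex disks in the plane whose triple intersections are exactly the faces;
  an extremal argument with Helly's theorem then finds four disks all of whose triples are faces. That
  is impossible, since the boundary of a tetrahedron is itself a sphere and cannot be a proper
  part of \<open>T\<close>. The only other topological fact needed is that every edge lies in two faces.

  Let \<open>p\<close> be a point that is interior to no limit disk. The limit circles through \<open>p\<close> correspond to
  vectors orthogonal to the null vector \<open>(p, 1)\<close>, that is, to unit vectors of a Euclidean plane,
  with nonadjacent vertices giving opposite vectors. The second and third angle conditions exclude
  three mutually adjacent ones, and the fourth excludes two opposite pairs, so there are at most three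
  circles through \<open>p\<close>. Moving \<open>p\<close> along one of them gives a point with a neighborhood that the
  patterns cannot cover, because nonadjacent disks are disjoint (\<open>interior_covered\<close>).
  A point to which a disk degenerates, or at which two nonadjacent disks become tangent without being
  complementary, would be such a \<open>p\<close>; for the latter the first angle condition is used. If the disks of two
  nonadjacent vertices become complementary, equalities of angles make them the apexes of a suspension, and the
  covering property, irreducibility and the strict inequality in the first condition rule this out
  (\<open>not_opposite\<close>). Irreducibility of the limit follows by the same description of circles
  through a point (\<open>exterior_point\<close>).
\<close>

section \<open>Disks as spacelike vectors of Minkowski space\<close>

text \<open>The Lorentz form on \<open>real ^ 3 \<times> real\<close>; the second component is the time coordinate.\<close>

definition mink :: "(real ^ 3) \<times> real \<Rightarrow> (real ^ 3) \<times> real \<Rightarrow> real" where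
  "mink x y = fst x \<bullet> fst y - snd x * snd y"

text \<open>
  The closed spherical disk of a vector \<open>x\<close>: the points \<open>q\<close> of the unit sphere whose null vector
  \<open>(q, 1)\<close> has nonnegative product with \<open>x\<close>. The disk with center \<open>z\<close> and radius \<open>r\<close> is the cap of
  \<open>(z, cos r) / sin r\<close>, a vector with \<open>mink x x = 1\<close>. For two such unit vectors the number
  \<open>- mink x y\<close> is the cosine of the overlap angle.
\<close>

definition cap :: "(real ^ 3) \<times> real \<Rightarrow> (real ^ 3) set" where
  "cap x = {q \<in> sphere 0 1. mink x (q, 1) \<ge> 0}"

lemma mink_commute: "mink x y = mink y x"
  by (simp add: mink_def inner_commute mult.commute)

lemma mink_add_left: "mink (x + y) z = mink x z + mink y z"
  and mink_add_right: "mink z (x + y) = mink z x + mink z y"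
  and mink_diff_left: "mink (x - y) z = mink x z - mink y z"
  and mink_diff_right: "mink z (x - y) = mink z x - mink z y"
  and mink_scaleR_left: "mink (a *\<^sub>R x) z = a * mink x z"
  and mink_scaleR_right: "mink z (a *\<^sub>R x) = a * mink z x"
  and mink_minus_left: "mink (- x) z = - mink x z"
  and mink_minus_right: "mink z (- x) = - mink z x"
  and mink_zero_left: "mink 0 z = 0"
  and mink_zero_right: "mink z 0 = 0"
  by (simp_all add: mink_def inner_add_left inner_add_right inner_diff_left inner_diff_right
      algebra_simps)

lemmas mink_linear = mink_add_left mink_add_right mink_diff_left mink_diff_right
  mink_scaleR_left mink_scaleR_right mink_minus_left mink_minus_right mink_zero_left mink_zero_right

lemma mink_nondegenerate:
  assumes "\<And>y. mink x y = 0"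
  shows "x = 0"
proof -
  have "mink x (fst x, - snd x) = 0" by (rule assms)
  then have "fst x \<bullet> fst x + snd x * snd x = 0" by (simp add: mink_def)
  moreover have "fst x \<bullet> fst x \<ge> 0" "snd x * snd x \<ge> 0" by auto
  ultimately have "fst x \<bullet> fst x = 0" "snd x * snd x = 0" by linarith+
  then show ?thesis by (simp add: prod_eq_iff)
qed

lemma mem_cap: "q \<in> cap x \<longleftrightarrow> norm q = 1 \<and> mink x (q, 1) \<ge> 0"
  by (simp add: cap_def)

text \<open>The sign of a timelike vector on the light cone is constant, and opposite to its time direction.\<close>

lemma timelike_not_orthogonal_sphere:
  assumes "mink m m < 0" "norm q = 1"
  shows "snd m > 0 \<Longrightarrow> mink m (q, 1) < 0" "snd m < 0 \<Longrightarrow> mink m (q, 1) > 0" "snd m \<noteq> 0"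
    "mink m (q, 1) \<noteq> 0"
proof -
  have "(norm (fst m))\<^sup>2 < (snd m)\<^sup>2"
    using assms(1) unfolding mink_def power2_norm_eq_inner by (simp add: power2_eq_square)
  then have *: "norm (fst m) < \<bar>snd m\<bar>"
    by (metis abs_norm_cancel power2_less_imp_less abs_ge_zero power2_abs)
  have "\<bar>fst m \<bullet> q\<bar> \<le> norm (fst m)"
    using Cauchy_Schwarz_ineq2[of "fst m" q] assms(2) by simp
  with * show "snd m > 0 \<Longrightarrow> mink m (q, 1) < 0" "snd m < 0 \<Longrightarrow> mink m (q, 1) > 0"
    "snd m \<noteq> 0" "mink m (q, 1) \<noteq> 0"
    by (auto simp: mink_def)
qed

lemma lightlike_mink_self: "norm p = 1 \<Longrightarrow> mink (p, 1) (p, 1) = 0"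
  by (simp add: mink_def flip: power2_norm_eq_inner)

lemma null_orthogonal_to_lightlike:
  assumes "norm p = 1" "mink u (p, 1) = 0" "mink u u \<le> 0"
  shows "u = snd u *\<^sub>R (p, 1)"
proof -
  have 1: "fst u \<bullet> p = snd u" using assms(2) by (simp add: mink_def)
  have 2: "fst u \<bullet> fst u \<le> snd u * snd u" using assms(3) by (simp add: mink_def)
  have "(norm (fst u - snd u *\<^sub>R p))\<^sup>2 = fst u \<bullet> fst u - 2 * snd u * (fst u \<bullet> p) + snd u * snd u * (p \<bullet> p)"
    by (simp add: power2_norm_eq_inner algebra_simps inner_commute)
  also have "\<dots> \<le> 0" using 1 2 assms(1) by (simp flip: power2_norm_eq_inner)
  finally have "fst u = snd u *\<^sub>R p" by simp
  then show ?thesis by (simp add: prod_eq_iff)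
qed

section \<open>Three mutually overlapping disks\<close>

text \<open>
  The angle conditions at a face say that \<open>A\<close>, \<open>B\<close>, \<open>C\<close> are the angles of a spherical triangle,
  and hence that the Gram matrix with off-diagonal entries \<open>- cos A\<close>, \<open>- cos B\<close>, \<open>- cos C\<close> is
  positive definite.
\<close>

lemma cosine_gram_posdef:
  fixes A B C :: real
  assumes "0 < A" "A < pi" "0 < B" "B < pi" "0 < C" "C < pi"
    and "A + B + C > pi" "A + B < C + pi" "B + C < A + pi" "C + A < B + pi"
    and "s \<noteq> 0 \<or> t \<noteq> 0 \<or> r \<noteq> 0"
  shows "s\<^sup>2 + t\<^sup>2 + r\<^sup>2 - 2 * s * t * cos A - 2 * s * r * cos B - 2 * t * r * cos C > 0"
proof -
  have sp: "sin A > 0" "sin B > 0" using assms sin_gt_zero by auto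
  have up: "cos C + cos A * cos B < sin A * sin B"
  proof -
    have "cos C < cos \<bar>pi - (A + B)\<bar>"
      using assms by (intro cos_monotone_0_pi) auto
    also have "\<dots> = - cos (A + B)" by (simp add: cos_diff)
    finally show ?thesis by (simp add: cos_add)
  qed
  have lo: "- (sin A * sin B) < cos C + cos A * cos B"
  proof -
    have "cos (pi - \<bar>A - B\<bar>) < cos C"
      using assms by (intro cos_monotone_0_pi) auto
    then have "- cos (A - B) < cos C" by (simp add: cos_diff)
    then show ?thesis by (simp add: cos_diff)
  qed
  let ?k = "cos C + cos A * cos B"
  have k: "\<bar>?k\<bar> < sin A * sin B" using up lo by linarith
  have "s\<^sup>2 + t\<^sup>2 + r\<^sup>2 - 2 * s * t * cos A - 2 * s * r * cos B - 2 * t * r * cos C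
    = (s - t * cos A - r * cos B)\<^sup>2 + t\<^sup>2 * (1 - (cos A)\<^sup>2) + r\<^sup>2 * (1 - (cos B)\<^sup>2) - 2 * t * r * ?k"
    by (simp add: power2_eq_square algebra_simps)
  also have "\<dots> = (s - t * cos A - r * cos B)\<^sup>2 + (t * sin A)\<^sup>2 + (r * sin B)\<^sup>2 - 2 * t * r * ?k"
    by (simp add: sin_squared_eq power_mult_distrib)
  finally have eq: "s\<^sup>2 + t\<^sup>2 + r\<^sup>2 - 2 * s * t * cos A - 2 * s * r * cos B - 2 * t * r * cos C = \<dots>" .
  show ?thesis
  proof (cases "t = 0 \<or> r = 0")
    case True
    then show ?thesis
    proof
      assume t: "t = 0"
      show ?thesis
      proof (cases "r = 0")
        case True
        then show ?thesis using t assms(11) unfolding eq by simp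
      next
        case False
        then show ?thesis using t sp unfolding eq by (simp add: add_nonneg_pos)
      qed
    next
      assume r: "r = 0"
      show ?thesis
      proof (cases "t = 0")
        case True
        then show ?thesis using r assms(11) unfolding eq by simp
      next
        case False
        then show ?thesis using r sp unfolding eq by (simp add: add_nonneg_pos)
      qed
    qed
  next
    case False
    then have "\<bar>t * r\<bar> > 0" by simp
    then have "\<bar>t * r\<bar> * \<bar>?k\<bar> < \<bar>t * r\<bar> * (sin A * sin B)" using k by (intro mult_strict_left_mono)
    moreover have "t * r * ?k \<le> \<bar>t * r\<bar> * \<bar>?k\<bar>" by (metis abs_ge_self abs_mult)
    ultimately have "2 * (t * r * ?k) < 2 * (\<bar>t * r\<bar> * (sin A * sin B))" by linarith
    then have "2 * t * r * ?k < 2 * \<bar>t * r\<bar> * (sin A * sin B)" by (simp add: mult.assoc)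
    also have "\<dots> \<le> (t * sin A)\<^sup>2 + (r * sin B)\<^sup>2"
      using zero_le_power2[of "\<bar>t\<bar> * sin A - \<bar>r\<bar> * sin B"]
      by (simp add: power2_diff power_mult_distrib abs_mult algebra_simps)
    finally show ?thesis unfolding eq using zero_le_power2[of "s - t * cos A - r * cos B"] by linarith
  qed
qed

text \<open>The vectors are linearly independent and the form is positive definite on their span.\<close>

definition posdef3 :: "(real ^ 3) \<times> real \<Rightarrow> (real ^ 3) \<times> real \<Rightarrow> (real ^ 3) \<times> real \<Rightarrow> bool" where
  "posdef3 x y z \<longleftrightarrow> (\<forall>s t r. s \<noteq> 0 \<or> t \<noteq> 0 \<or> r \<noteq> 0 \<longrightarrow>
     mink (s *\<^sub>R x + t *\<^sub>R y + r *\<^sub>R z) (s *\<^sub>R x + t *\<^sub>R y + r *\<^sub>R z) > 0)"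

lemma posdef3_cosine_gram:
  assumes "mink x x = 1" "mink y y = 1" "mink z z = 1"
    and "mink x y = - cos A" "mink y z = - cos C" "mink z x = - cos B"
    and "0 < A" "A < pi" "0 < B" "B < pi" "0 < C" "C < pi"
    and "A + B + C > pi" "A + B < C + pi" "B + C < A + pi" "C + A < B + pi"
  shows "posdef3 x y z"
  unfolding posdef3_def
proof (intro allI impI)
  fix s t r :: real
  assume *: "s \<noteq> 0 \<or> t \<noteq> 0 \<or> r \<noteq> 0"
  have c: "mink y x = - cos A" "mink z y = - cos C" "mink x z = - cos B"
    using assms(4-6) by (simp_all add: mink_commute)
  have "mink (s *\<^sub>R x + t *\<^sub>R y + r *\<^sub>R z) (s *\<^sub>R x + t *\<^sub>R y + r *\<^sub>R z)
      = s\<^sup>2 + t\<^sup>2 + r\<^sup>2 - 2 * s * t * cos A - 2 * s * r * cos B - 2 * t * r * cos C"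
    by (simp add: mink_linear assms(1-6) c power2_eq_square algebra_simps)
  also have "\<dots> > 0" using assms * by (intro cosine_gram_posdef) auto
  finally show "0 < mink (s *\<^sub>R x + t *\<^sub>R y + r *\<^sub>R z) (s *\<^sub>R x + t *\<^sub>R y + r *\<^sub>R z)" .
qed

text \<open>
  A nonzero vector \<open>e\<close> orthogonal to a positive definite triple completes it to a basis. If \<open>e\<close> were
  not timelike, the form would be nonnegative on the whole space.
\<close>

lemma posdef3_orthogonal_basis:
  assumes pd: "posdef3 x y z" and orth: "mink x e = 0" "mink y e = 0" "mink z e = 0"
    and "e \<noteq> 0"
  shows "mink e e < 0"
    and "\<exists>s t r l. v = s *\<^sub>R x + t *\<^sub>R y + r *\<^sub>R z + l *\<^sub>R e"
proof -
  define w where "w = (\<lambda>p::real^3. (p $ 1) *\<^sub>R x + (p $ 2) *\<^sub>R y + (p $ 3) *\<^sub>R z)"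
  define f where "f = (\<lambda>p::(real^3)\<times>real. w (fst p) + snd p *\<^sub>R e)"
  have lin: "linear f"
    by (rule linearI) (simp_all add: f_def w_def algebra_simps)
  have we: "mink (w p) e = 0" for p using orth by (simp add: w_def mink_linear)
  have ew: "mink e (w p) = 0" for p using we by (subst mink_commute)
  have ww: "mink (w p) (w p) > 0" if "p \<noteq> 0" for p
  proof -
    have "p $ 1 \<noteq> 0 \<or> p $ 2 \<noteq> 0 \<or> p $ 3 \<noteq> 0"
      using that by (auto simp: vec_eq_iff forall_3)
    then show ?thesis using pd by (simp add: posdef3_def w_def)
  qed
  have w0: "w 0 = 0" by (simp add: w_def)
  have ff: "mink (f p) (f p) = mink (w (fst p)) (w (fst p)) + (snd p)\<^sup>2 * mink e e" for p
    using we ew by (simp add: f_def mink_linear power2_eq_square)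
  have inj: "inj f"
  proof (subst linear_injective_0[OF lin], intro allI impI)
    fix p assume 0: "f p = 0"
    have "mink (f p) (w (fst p)) = mink (w (fst p)) (w (fst p))"
      using we ew by (simp add: f_def mink_linear)
    then have "mink (w (fst p)) (w (fst p)) = 0" using 0 by (simp add: mink_zero_left)
    then have p: "fst p = 0" using ww by force
    then have "snd p *\<^sub>R e = 0" using 0 by (simp add: f_def w0)
    then show "p = 0" using p \<open>e \<noteq> 0\<close> by (auto simp: prod_eq_iff)
  qed
  have surj: "surj f" using linear_injective_imp_surjective[OF lin inj] by simp
  obtain p where p: "f p = (0, 1)" using surj by (metis surj_def)
  show "mink e e < 0"
  proof (rule ccontr)
    assume "\<not> mink e e < 0"
    then have "(snd p)\<^sup>2 * mink e e \<ge> 0" by simp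
    moreover have "mink (w (fst p)) (w (fst p)) \<ge> 0"
      using ww[of "fst p"] by (cases "fst p = 0") (auto simp: w0 mink_zero_left)
    ultimately have "mink (f p) (f p) \<ge> 0" by (simp add: ff)
    then show False unfolding p by (simp add: mink_def)
  qed
  obtain q where "v = f q" using surj by (metis surj_def)
  then show "\<exists>s t r l. v = s *\<^sub>R x + t *\<^sub>R y + r *\<^sub>R z + l *\<^sub>R e"
    unfolding f_def w_def by blast
qed

lemma exists_mink_orthogonal:
  obtains e where "e \<noteq> 0" "mink x e = 0" "mink y e = 0" "mink z e = 0"
proof -
  let ?J = "\<lambda>v::(real^3)\<times>real. (fst v, - snd v)"
  have "dim {?J x, ?J y, ?J z} \<le> card {?J x, ?J y, ?J z}" by (intro dim_le_card') auto
  also have "\<dots> \<le> 3" by (simp add: card_insert_if)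
  finally have "dim {?J x, ?J y, ?J z} < DIM((real^3)\<times>real)" by simp
  then obtain e where e: "e \<noteq> 0" "\<And>v. v \<in> span {?J x, ?J y, ?J z} \<Longrightarrow> orthogonal e v"
    by (rule orthogonal_to_subspace_exists) blast
  have "mink v e = 0" if "?J v \<in> {?J x, ?J y, ?J z}" for v
    using e(2)[OF span_base[OF that]]
    by (simp add: orthogonal_def mink_def inner_prod_def inner_commute mult.commute)
  then show thesis using e(1) that by blast
qed

text \<open>The disks of a face have a common point.\<close>

lemma posdef3_caps_meet:
  assumes pd: "posdef3 x y z"
  shows "cap x \<inter> cap y \<inter> cap z \<noteq> {}"
proof -
  obtain e where e: "e \<noteq> 0" "mink x e = 0" "mink y e = 0" "mink z e = 0"
    by (rule exists_mink_orthogonal)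
  have neg: "mink e e < 0" by (rule posdef3_orthogonal_basis(1)[OF pd e(2-4) e(1)])
  \<comment> \<open>in the span there is a vector \<open>v\<close> that has product 1 with all three vectors\<close>
  define g where "g = (\<lambda>v. (vector [mink v x, mink v y, mink v z] :: real^3, mink v e))"
  have lin: "linear g"
    by (rule linearI) (simp_all add: g_def mink_linear vec_eq_iff forall_3)
  have inj: "inj g"
  proof (subst linear_injective_0[OF lin], intro allI impI)
    fix v assume "g v = 0"
    then have v: "mink v x = 0" "mink v y = 0" "mink v z = 0" "mink v e = 0"
      by (simp_all add: g_def prod_eq_iff vec_eq_iff forall_3)
    show "v = 0"
    proof (rule mink_nondegenerate)
      fix u
      obtain s t r l where "u = s *\<^sub>R x + t *\<^sub>R y + r *\<^sub>R z + l *\<^sub>R e"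
        using posdef3_orthogonal_basis(2)[OF pd e(2-4) e(1)] by blast
      then show "mink v u = 0" using v by (simp add: mink_linear)
    qed
  qed
  have "surj g" using linear_injective_imp_surjective[OF lin inj] by simp
  then obtain v where gv: "g v = (vector [1, 1, 1], 0)" by (metis surj_def)
  then have v: "mink v x = 1" "mink v y = 1" "mink v z = 1" "mink v e = 0"
    by (simp_all add: g_def vec_eq_iff forall_3)
  have ev: "mink e v = 0" using v(4) by (simp add: mink_commute)
  obtain s t r l where vv: "v = s *\<^sub>R x + t *\<^sub>R y + r *\<^sub>R z + l *\<^sub>R e"
    using posdef3_orthogonal_basis(2)[OF pd e(2-4) e(1)] by blast
  have "mink v e = l * mink e e" using e by (simp add: vv mink_linear)
  then have l: "l = 0" using neg v by simp
  have "s \<noteq> 0 \<or> t \<noteq> 0 \<or> r \<noteq> 0" using v(1) unfolding vv l by (auto simp: mink_linear)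
  then have pos: "mink v v > 0" using pd unfolding posdef3_def vv l by simp
  define a where "a = sqrt (mink v v / - mink e e)"
  have a2: "a * a = mink v v / - mink e e"
    unfolding a_def using pos neg by (simp add: divide_nonneg_pos divide_nonneg_neg)
  have null: "mink (v + b *\<^sub>R e) (v + b *\<^sub>R e) = 0" if "b = a \<or> b = - a" for b
  proof -
    have "mink (v + b *\<^sub>R e) (v + b *\<^sub>R e) = mink v v + b * b * mink e e"
      using v ev by (simp add: mink_linear)
    also have "b * b = mink v v / - mink e e" using that a2 by auto
    finally show ?thesis using neg by simp
  qed
  \<comment> \<open>the two null vectors \<open>v + a e\<close> and \<open>v - a e\<close> have time components of opposite signs\<close>
  have "\<exists>b. (b = a \<or> b = - a) \<and> snd (v + b *\<^sub>R e) > 0"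
  proof (rule ccontr)
    assume "\<not> ?thesis"
    then have le: "snd (v + a *\<^sub>R e) \<le> 0" "snd (v - a *\<^sub>R e) \<le> 0" by force+
    let ?u = "v + a *\<^sub>R e" and ?w = "v - a *\<^sub>R e"
    have nm: "norm (fst q) = \<bar>snd q\<bar>" if "mink q q = 0" for q
    proof -
      have "(norm (fst q))\<^sup>2 = (snd q)\<^sup>2"
        using that unfolding mink_def power2_norm_eq_inner by (simp add: power2_eq_square)
      then show ?thesis by (metis abs_norm_cancel power2_eq_iff_nonneg abs_ge_zero power2_abs)
    qed
    have "mink ?u ?u = 0" "mink ?w ?w = 0" using null[of a] null[of "-a"] by auto
    note n = nm[OF this(1)] nm[OF this(2)]
    have "fst ?u \<bullet> fst ?w \<le> norm (fst ?u) * norm (fst ?w)" by (rule norm_cauchy_schwarz)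
    also have "\<dots> = snd ?u * snd ?w" unfolding n using le by (simp add: abs_of_nonpos algebra_simps)
    finally have "mink ?u ?w \<le> 0" by (simp add: mink_def)
    moreover have "mink ?u ?w = mink v v - a * a * mink e e"
      using v ev by (simp add: mink_linear)
    moreover have "\<dots> = 2 * mink v v" unfolding a2 using neg by simp
    ultimately show False using pos by simp
  qed
  then obtain b where b: "b = a \<or> b = - a" "snd (v + b *\<^sub>R e) > 0" by blast
  define u where "u = v + b *\<^sub>R e"
  define q where "q = fst u /\<^sub>R snd u"
  have su: "snd u > 0" using b by (simp add: u_def)
  have "mink u u = 0" using null b by (simp add: u_def)
  then have "(norm (fst u))\<^sup>2 = (snd u)\<^sup>2"
    unfolding mink_def power2_norm_eq_inner by (simp add: power2_eq_square)
  then have "norm (fst u) = snd u" using su by (simp add: power2_eq_iff_nonneg)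
  then have nq: "norm q = 1" using su by (simp add: q_def)
  have uq: "u = snd u *\<^sub>R (q, 1)" using su by (simp add: q_def prod_eq_iff)
  have "q \<in> cap w" if "mink w v = 1" "mink w e = 0" for w
  proof -
    have "mink w u = 1" using that by (simp add: u_def mink_linear)
    then have "snd u * mink w (q, 1) = 1" by (metis mink_scaleR_right uq)
    then have "mink w (q, 1) > 0" using su by (metis zero_less_mult_pos zero_less_one)
    then show ?thesis using nq by (simp add: mem_cap)
  qed
  then have "q \<in> cap x" "q \<in> cap y" "q \<in> cap z" using v e mink_commute[of v] by auto
  then show ?thesis by blast
qed

text \<open>
  For angle sum below \<open>pi\<close> the span has signature (2, 1), as for the side lines of a hyperbolic
  triangle. A vertex of that triangle, scaled so that the coefficient of \<open>z\<close> is 1, is a timelike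
  vector and has nonnegative coefficients.
\<close>

lemma timelike_combination:
  assumes "mink x x = 1" "mink y y = 1" "mink z z = 1"
    and xy: "mink x y = - cos A" and yz: "mink y z = - cos C" and zx: "mink z x = - cos B"
    and "0 < A" "0 < B" "0 < C" and sum: "A + B + C < pi"
  obtains s t where "s \<ge> 0" "t \<ge> 0" "mink (z + s *\<^sub>R x + t *\<^sub>R y) (z + s *\<^sub>R x + t *\<^sub>R y) < 0"
proof -
  have c: "mink y x = - cos A" "mink z y = - cos C" "mink x z = - cos B"
    using assms by (simp_all add: mink_commute)
  have sA: "sin A > 0" and sB: "sin B > 0" and sC: "sin C > 0"
    using assms sin_gt_zero by auto
  have B: "cos B + cos A * cos C > sin A * sin C"
  proof -
    have "cos (pi - (A + C)) < cos B" using assms by (intro cos_monotone_0_pi) auto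
    then show ?thesis by (simp add: cos_diff cos_add)
  qed
  have C: "cos C + cos A * cos B > sin A * sin B"
  proof -
    have "cos (pi - (A + B)) < cos C" using assms by (intro cos_monotone_0_pi) auto
    then show ?thesis by (simp add: cos_diff cos_add)
  qed
  define d where "d = (sin A)\<^sup>2"
  have d: "d > 0" "d = 1 - (cos A)\<^sup>2" using sA by (simp_all add: d_def flip: sin_squared_eq)
  define s where "s = (cos B + cos A * cos C) / d"
  define t where "t = (cos C + cos A * cos B) / d"
  have nn: "sin A * sin C > 0" "sin A * sin B > 0" using sA sB sC by auto
  have st: "s \<ge> 0" "t \<ge> 0" using B C nn d unfolding s_def t_def by (auto intro!: divide_nonneg_pos)
  let ?m = "z + s *\<^sub>R x + t *\<^sub>R y"
  have ds: "d * s = cos B + cos A * cos C" and dt: "d * t = cos C + cos A * cos B"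
    using d by (simp_all add: s_def t_def)
  have mx: "mink ?m x = 0"
  proof -
    have *: "mink ?m x = - cos B + s - t * cos A" using assms c by (simp add: mink_linear)
    have "d * mink ?m x = - d * cos B + d * s - (d * t) * cos A"
      unfolding * by (simp add: algebra_simps)
    also have "\<dots> = 0" unfolding ds dt unfolding d(2) by (simp add: power2_eq_square algebra_simps)
    finally show ?thesis using d by simp
  qed
  have my: "mink ?m y = 0"
  proof -
    have *: "mink ?m y = - cos C - s * cos A + t" using assms c by (simp add: mink_linear)
    have "d * mink ?m y = - d * cos C - (d * s) * cos A + d * t"
      unfolding * by (simp add: algebra_simps)
    also have "\<dots> = 0" unfolding ds dt unfolding d(2) by (simp add: power2_eq_square algebra_simps)
    finally show ?thesis using d by simp
  qed
  have "mink ?m ?m = mink ?m z"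
    using mx my by (simp add: mink_add_right[of "?m"] mink_scaleR_right)
  also have "\<dots> = 1 - s * cos B - t * cos C" using assms c by (simp add: mink_linear)
  finally have mm: "mink ?m ?m = 1 - s * cos B - t * cos C" .
  have "d * mink ?m ?m = d - (d * s) * cos B - (d * t) * cos C"
    unfolding mm by (simp add: algebra_simps)
  also have "\<dots> = (sin A * sin C)\<^sup>2 - (cos B + cos A * cos C)\<^sup>2"
    unfolding ds dt unfolding d(2) power_mult_distrib sin_squared_eq by (simp add: power2_eq_square algebra_simps)
  also have "\<dots> < 0" using B nn power_strict_mono[of "sin A * sin C" "cos B + cos A * cos C" 2] by auto
  finally have "mink ?m ?m < 0" using d by (simp add: mult_less_0_iff)
  then show thesis using that st by blast
qed

text \<open>
  The sign of that timelike vector on the light cone is constant: if it is negative, no point lies in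
  all three disks, and if it is positive, every point lies in one of them.
\<close>

lemma caps_triple_disjoint_or_cover:
  assumes "mink x x = 1" "mink y y = 1" "mink z z = 1"
    and xy: "mink x y = - cos A" and yz: "mink y z = - cos C" and zx: "mink z x = - cos B"
    and "0 < A" "0 < B" "0 < C" and sum: "A + B + C < pi"
  shows "cap x \<inter> cap y \<inter> cap z = {} \<or> cap x \<union> cap y \<union> cap z = sphere 0 1"
proof -
  obtain s t where st: "s \<ge> 0" "t \<ge> 0"
    and m: "mink (z + s *\<^sub>R x + t *\<^sub>R y) (z + s *\<^sub>R x + t *\<^sub>R y) < 0"
    using timelike_combination[OF assms] .
  let ?m = "z + s *\<^sub>R x + t *\<^sub>R y"
  have mq: "mink ?m (q, 1) = mink z (q, 1) + s * mink x (q, 1) + t * mink y (q, 1)" for q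
    by (simp add: mink_linear)
  show ?thesis
  proof (cases "snd ?m > 0")
    case True
    have "cap x \<inter> cap y \<inter> cap z = {}"
    proof (rule ccontr)
      assume "cap x \<inter> cap y \<inter> cap z \<noteq> {}"
      then obtain q where q: "q \<in> cap x" "q \<in> cap y" "q \<in> cap z" by blast
      then have "mink ?m (q, 1) \<ge> 0" unfolding mq using st by (auto simp: mem_cap)
      moreover have "mink ?m (q, 1) < 0"
        using timelike_not_orthogonal_sphere(1)[OF m _ True] q by (simp add: mem_cap)
      ultimately show False by simp
    qed
    then show ?thesis ..
  next
    case False
    have *: "q \<in> cap x \<union> cap y \<union> cap z" if "q \<in> sphere 0 1" for q
    proof (rule ccontr)
      assume "q \<notin> cap x \<union> cap y \<union> cap z"
      then have neg: "mink x (q, 1) < 0" "mink y (q, 1) < 0" "mink z (q, 1) < 0"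
        using that by (auto simp: mem_cap)
      then have "s * mink x (q, 1) \<le> 0" "t * mink y (q, 1) \<le> 0"
        using st by (auto intro: mult_nonneg_nonpos)
      then have "mink ?m (q, 1) < 0" unfolding mq using neg by linarith
      moreover have nq: "norm q = 1" using that by simp
      moreover have "mink ?m (q, 1) > 0"
        using timelike_not_orthogonal_sphere(2,3)[OF m nq] False by linarith
      ultimately show False by simp
    qed
    have "cap x \<union> cap y \<union> cap z \<subseteq> sphere 0 1" by (auto simp: cap_def)
    with * show ?thesis by blast
  qed
qed

section \<open>Combinatorics and topology of triangulated spheres\<close>

lemma std_simplex_explicit:
  fixes s :: "'v::finite set"
  shows "std_simplex s = {x. (\<forall>i. 0 \<le> x $ i) \<and> (\<forall>i. i \<notin> s \<longrightarrow> x $ i = 0) \<and> (\<Sum>i\<in>UNIV. x $ i) = 1}"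
    (is "_ = ?S")
proof
  have "convex ?S"
    by (auto simp: convex_def sum.distrib simp flip: sum_distrib_left)
  moreover have "(\<lambda>v. axis v 1) ` s \<subseteq> ?S"
  proof
    fix x :: "real ^ 'v" assume "x \<in> (\<lambda>v. axis v 1) ` s"
    then obtain v where v: "v \<in> s" "x = axis v 1" by blast
    have "(\<Sum>i\<in>UNIV. x $ i) = (\<Sum>i\<in>UNIV. if i = v then 1 else 0)"
      by (rule sum.cong) (auto simp: v axis_def)
    also have "\<dots> = (1 :: real)" by simp
    finally show "x \<in> ?S" using v by (auto simp: axis_def)
  qed
  ultimately show "std_simplex s \<subseteq> ?S"
    unfolding std_simplex_def by (rule hull_minimal[rotated])
next
  show "?S \<subseteq> std_simplex s"
  proof
    fix x assume x: "x \<in> ?S"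
    have sm: "(\<Sum>i\<in>s. x $ i) = 1"
    proof -
      have "(\<Sum>i\<in>s. x $ i) = (\<Sum>i\<in>UNIV. x $ i)"
        using x by (intro sum.mono_neutral_left) auto
      then show ?thesis using x by simp
    qed
    have "x = (\<Sum>i\<in>UNIV. (x $ i) *\<^sub>R axis i 1)"
      by (simp add: vec_eq_iff axis_def if_distrib cong: if_cong)
    also have "\<dots> = (\<Sum>i\<in>s. (x $ i) *\<^sub>R axis i 1)"
      using x by (intro sum.mono_neutral_right) auto
    also have "\<dots> \<in> convex hull ((\<lambda>v. axis v 1) ` s)"
      using x sm by (intro convex_sum) (auto intro: hull_inc)
    finally show "x \<in> std_simplex s" by (simp add: std_simplex_def)
  qed
qed

lemma axis_mem_std_simplex: "v \<in> s \<Longrightarrow> axis v 1 \<in> std_simplex s"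
  unfolding std_simplex_def by (intro hull_inc) auto

lemma convex_std_simplex: "convex (std_simplex s)"
  by (simp add: std_simplex_def)

lemma edges_iff: "{u, w} \<in> edges T \<longleftrightarrow> u \<noteq> w \<and> (\<exists>t\<in>T. u \<in> t \<and> w \<in> t)"
  by (auto simp: edges_def card_insert_if)

text \<open>
  If no face has all its vertices among those of the curve, then every point of the complement is
  joined, inside a face containing it, by a segment to a vertex off the curve. The Jordan curve
  theorem is not needed.
\<close>

lemma separates_vertices_no_face_inside:
  fixes T :: "'v::finite set set"
  assumes "\<Union>C \<subseteq> N" and no: "\<And>t. t \<in> T \<Longrightarrow> \<not> t \<subseteq> N"
  shows "separates_vertices T C"
  unfolding separates_vertices_def
proof
  fix U assume U: "U \<in> components (realization T - realization C)"
  then obtain x where x: "x \<in> U" using in_components_nonempty by blast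
  then have xT: "x \<in> realization T - realization C" using U in_components_subset by blast
  then obtain t where t: "t \<in> T" "x \<in> std_simplex t" by (auto simp: realization_def)
  obtain v where v: "v \<in> t" "v \<notin> N" using no t by blast
  have outC: "y $ v = 0" if "y \<in> realization C" for y
    using that v assms(1) by (auto simp: realization_def std_simplex_explicit)
  let ?S = "closed_segment x (axis v 1)"
  have "?S \<subseteq> std_simplex t"
    using t v axis_mem_std_simplex closed_segment_subset convex_std_simplex by metis
  then have "?S \<subseteq> realization T" using t by (auto simp: realization_def)
  moreover have "y \<notin> realization C" if y: "y \<in> ?S" for y
  proof
    assume yC: "y \<in> realization C"
    obtain l where l: "0 \<le> l" "l \<le> 1" "y = (1 - l) *\<^sub>R x + l *\<^sub>R axis v 1"
      using y by (auto simp: in_segment)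
    have xv: "x $ v \<ge> 0" using t by (simp add: std_simplex_explicit)
    have "(1 - l) * x $ v + l = 0" using outC[OF yC] l by (simp add: axis_def)
    then have "l = 0" using xv l by (smt (verit) mult_nonneg_nonneg)
    then show False using l yC xT by simp
  qed
  ultimately have "?S \<subseteq> U"
    using x by (intro components_maximal[OF U]) auto
  then show "\<exists>v. axis v 1 \<in> U" by auto
qed

lemma separates_vertices_nonface_triangle:
  assumes "sphere_triangulation T" "distinct [a, b, c]" "{a, b, c} \<notin> T"
  shows "separates_vertices T {{a,b}, {b,c}, {c,a}}"
proof (rule separates_vertices_no_face_inside[of _ "{a,b,c}"])
  fix t assume t: "t \<in> T"
  have "card t = 3" using assms(1) t by (auto simp: sphere_triangulation_def)
  moreover have "card {a,b,c} = 3" using assms(2) by simp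
  ultimately show "\<not> t \<subseteq> {a,b,c}" using t assms(3) by (metis card_subset_eq finite.intros)
qed auto

lemma separates_vertices_chordless_square:
  assumes "sphere_triangulation T" "distinct [a, b, c, d]" "{a, c} \<notin> edges T" "{b, d} \<notin> edges T"
  shows "separates_vertices T {{a,b}, {b,c}, {c,d}, {d,a}}"
proof (rule separates_vertices_no_face_inside[of _ "{a,b,c,d}"])
  fix t assume t: "t \<in> T"
  then have ct: "card t = 3" using assms(1) by (auto simp: sphere_triangulation_def)
  show "\<not> t \<subseteq> {a,b,c,d}"
  proof
    assume sub: "t \<subseteq> {a,b,c,d}"
    have 1: "\<not> (a \<in> t \<and> c \<in> t)" and 2: "\<not> (b \<in> t \<and> d \<in> t)"
      using assms t by (auto simp: edges_iff)
    have "\<exists>x y. t \<subseteq> {x, y}" using 1 2 sub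
      by (cases "a \<in> t"; cases "b \<in> t") blast+
    then obtain x y where "t \<subseteq> {x, y}" by blast
    then have "card t \<le> card {x, y}" by (intro card_mono) auto
    also have "\<dots> \<le> 2" by (simp add: card_insert_if)
    finally show False using ct by simp
  qed
qed auto

lemma realization_homeomorphic_sphere:
  assumes "sphere_triangulation T"
  obtains h g where "homeomorphism (realization T) (sphere (0 :: real ^ 3) 1) h g"
  using assms by (auto simp: sphere_triangulation_def homeomorphic_def)

lemma punctured_realization_homeomorphic_plane:
  fixes T :: "'v::finite set set"
  assumes T: "sphere_triangulation T" and m: "m \<in> realization T"
  shows "(realization T - {m}) homeomorphic (UNIV :: complex set)"
proof -
  obtain h g where hg: "homeomorphism (realization T) (sphere (0 :: real ^ 3) 1) h g"
    using realization_homeomorphic_sphere[OF T] by blast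
  have inj: "inj_on h (realization T)" using hg by (auto simp: homeomorphism_def inj_on_def) metis
  have im: "h ` realization T = sphere 0 1" using hg by (simp add: homeomorphism_def)
  have hm: "h m \<in> sphere 0 1" using m im by blast
  have "h ` (realization T - {m}) = sphere 0 1 - {h m}"
    using inj m im by (auto simp: inj_on_def)
  then have "(realization T - {m}) homeomorphic (sphere (0 :: real ^ 3) 1 - {h m})"
    using homeomorphism_of_subsets[OF hg, of "realization T - {m}"] by (force simp: homeomorphic_def)
  also have "(sphere (0 :: real ^ 3) 1 - {h m}) homeomorphic {x :: real ^ 3. axis 1 1 \<bullet> x = 0}"
    using hm by (intro homeomorphic_punctured_sphere_hyperplane) auto
  also have "{x :: real ^ 3. axis 1 1 \<bullet> x = 0} homeomorphic (UNIV :: complex set)"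
    by (intro homeomorphic_affine_sets) (auto simp: affine_hyperplane)
  finally show ?thesis .
qed

text \<open>
  If an edge lay in only one face, that face could be pushed in from the edge. This would deform the
  identity of the sphere into a map that is not surjective, and the sphere would be contractible.
\<close>

lemma edge_in_two_faces:
  fixes T :: "'v::finite set set"
  assumes T: "sphere_triangulation T" and t: "t \<in> T" and ab: "a \<in> t" "b \<in> t" "a \<noteq> b"
  shows "\<exists>t'\<in>T. t' \<noteq> t \<and> a \<in> t' \<and> b \<in> t'"
proof (rule ccontr)
  assume "\<not> ?thesis"
  then have uniq: "t' = t" if "t' \<in> T" "a \<in> t'" "b \<in> t'" for t' using that by blast
  have "card t = 3" using T t by (auto simp: sphere_triangulation_def)
  then have "card (t - {a, b}) = 1" using ab by simp
  then obtain c where "t - {a, b} = {c}" by (auto simp: card_1_singleton_iff)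
  then have c: "c \<in> t" "c \<noteq> a" "c \<noteq> b" by auto
  define e :: "real ^ 'v" where "e = 2 *\<^sub>R axis c 1 - axis a 1 - axis b 1"
  have e: "e $ a = - 1" "e $ b = - 1" "e $ c = 2" "i \<noteq> a \<Longrightarrow> i \<noteq> b \<Longrightarrow> i \<noteq> c \<Longrightarrow> e $ i = 0" for i
    using ab c by (auto simp: e_def axis_def)
  have es: "(\<Sum>i\<in>UNIV. e $ i) = 0"
  proof -
    have "(\<Sum>i\<in>UNIV. e $ i) = (\<Sum>i\<in>{a, b, c}. e $ i)"
      using e by (intro sum.mono_neutral_right) auto
    also have "\<dots> = 0" using ab c e by simp
    finally show ?thesis .
  qed
  \<comment> \<open>the deformation, at time \<open>l\<close>; at time 1 one of the coordinates of \<open>a\<close> and \<open>b\<close> vanishes\<close>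
  define F where "F = (\<lambda>(l :: real, x :: real ^ 'v). x + (l * min (x $ a) (x $ b)) *\<^sub>R e)"
  define m :: "real ^ 'v" where "m = (1/2) *\<^sub>R axis a 1 + (1/2) *\<^sub>R axis b 1"
  have F_in: "F (l, x) \<in> realization T" if x: "x \<in> realization T" and l: "0 \<le> l" "l \<le> 1" for l x
  proof -
    obtain s where s: "s \<in> T" "x \<in> std_simplex s" using x by (auto simp: realization_def)
    have xs: "\<And>i. 0 \<le> x $ i" "\<And>i. i \<notin> s \<Longrightarrow> x $ i = 0" "(\<Sum>i\<in>UNIV. x $ i) = 1"
      using s by (auto simp: std_simplex_explicit)
    show ?thesis
    proof (cases "a \<in> s \<and> b \<in> s")
      case True
      then have st: "s = t" using uniq s by blast
      let ?k = "l * min (x $ a) (x $ b)"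
      have k: "0 \<le> ?k" "?k \<le> x $ a" "?k \<le> x $ b"
        using xs(1) l by (auto intro: order_trans[OF mult_right_mono[of l 1]])
      have "F (l, x) \<in> std_simplex s"
        unfolding std_simplex_explicit
      proof (intro CollectI conjI allI impI)
        fix i
        show "0 \<le> F (l, x) $ i" using k xs(1)[of i] e
          by (cases "i = a"; cases "i = b"; cases "i = c") (auto simp: F_def)
        show "F (l, x) $ i = 0" if "i \<notin> s" 
          using that xs(2)[OF that] e(4)[of i] ab c st by (auto simp: F_def)
        show "(\<Sum>i\<in>UNIV. F (l, x) $ i) = 1"
          using xs(3) es by (simp add: F_def sum.distrib flip: sum_distrib_left)
      qed
      then show ?thesis using s by (auto simp: realization_def)
    next
      case False
      then have "min (x $ a) (x $ b) = 0" using xs(1)[of a] xs(1)[of b] xs(2) by auto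
      then show ?thesis using x by (simp add: F_def)
    qed
  qed
  have m: "m \<in> realization T"
  proof -
    have "m \<in> std_simplex t"
      using convexD[OF convex_std_simplex axis_mem_std_simplex[OF ab(1)] axis_mem_std_simplex[OF ab(2)], of "1/2" "1/2"]
      by (simp add: m_def)
    then show ?thesis using t by (auto simp: realization_def)
  qed
  have F_m: "F (1, x) \<noteq> m" for x
  proof
    assume "F (1, x) = m"
    then have "F (1, x) $ a = 1/2" "F (1, x) $ b = 1/2" using ab by (auto simp: m_def axis_def)
    then show False using e by (auto simp: F_def min_def split: if_splits)
  qed
  have hom: "homotopic_with_canon (\<lambda>_. True) (realization T) (realization T) id (\<lambda>x. F (1, x))"
  proof (rule homotopic_with_linear)
    show "continuous_on (realization T) (\<lambda>x. F (1, x))"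
      unfolding F_def by (auto intro!: continuous_intros)
    fix x assume x: "x \<in> realization T"
    show "closed_segment (id x) (F (1, x)) \<subseteq> realization T"
    proof
      fix y assume "y \<in> closed_segment (id x) (F (1, x))"
      then obtain l where "0 \<le> l" "l \<le> 1" "y = (1 - l) *\<^sub>R x + l *\<^sub>R F (1, x)"
        by (auto simp: in_segment)
      moreover from this have "y = F (l, x)" by (simp add: F_def algebra_simps)
      ultimately show "y \<in> realization T" using F_in[OF x, of l] by metis
    qed
  qed simp
  have "contractible (realization T - {m})"
    using punctured_realization_homeomorphic_plane[OF T m] homeomorphic_contractible_eq
      contractible_UNIV by blast
  moreover have "continuous_on (realization T) (\<lambda>x. F (1, x))"
    unfolding F_def by (auto intro!: continuous_intros)
  moreover have "(\<lambda>x. F (1, x)) \<in> realization T \<rightarrow> realization T - {m}"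
    using F_in[of _ 1] F_m by auto
  ultimately obtain p where
    "homotopic_with_canon (\<lambda>_. True) (realization T) (realization T - {m}) (\<lambda>x. F (1, x)) (\<lambda>_. p)"
    using nullhomotopic_into_contractible by metis
  then have "homotopic_with_canon (\<lambda>_. True) (realization T) (realization T) (\<lambda>x. F (1, x)) (\<lambda>_. p)"
    by (rule homotopic_with_subset_right) auto
  then have "contractible (realization T)"
    unfolding contractible_def using homotopic_with_trans[OF hom] by blast
  moreover have "realization T homeomorphic sphere (0 :: real ^ 3) 1"
    using T by (simp add: sphere_triangulation_def)
  ultimately have "contractible (sphere (0 :: real ^ 3) 1)" using homeomorphic_contractible_eq by blast
  then show False by (simp add: contractible_sphere)
qed

text \<open>
  The boundary of a tetrahedron is a sphere, and a sphere does not embed into a punctured sphere.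
\<close>

lemma no_tetrahedron_in_triangulation:
  fixes T :: "'v::finite set set"
  assumes T: "sphere_triangulation T" and card: "CARD('v) > 4" and d: "distinct [a, b, c, d]"
    and faces: "{a, b, c} \<in> T" "{a, b, d} \<in> T" "{a, c, d} \<in> T" "{b, c, d} \<in> T"
  shows False
proof -
  let ?N = "{a, b, c, d}"
  let ?A = "(\<lambda>v. axis v 1 :: real ^ 'v) ` ?N"
  have "independent ?A"
    by (rule independent_mono[OF independent_Basis]) (auto simp: Basis_vec_def)
  then have ai: "\<not> affine_dependent ?A" using affine_dependent_imp_dependent by blast
  have inj: "inj_on (\<lambda>v. axis v 1 :: real ^ 'v) X" for X
    by (auto simp: inj_on_def axis_eq_axis)
  have "card ?A = card ?N" by (rule card_image[OF inj])
  then have "card ?A = 4" using d by simp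
  then have dim: "aff_dim (std_simplex ?N) = 3"
    using aff_dim_affine_independent[OF ai] by (simp add: std_simplex_def aff_dim_convex_hull)
  have "bounded (std_simplex ?N)"
    unfolding std_simplex_def by (intro bounded_convex_hull finite_imp_bounded) auto
  moreover have "aff_dim (cball (0 :: real ^ 3) 1) = 3" by (simp add: aff_dim_cball)
  ultimately have "rel_frontier (cball (0 :: real ^ 3) 1) homeomorphic rel_frontier (std_simplex ?N)"
    using dim convex_std_simplex convex_cball bounded_cball
    by (metis homeomorphic_rel_frontiers_convex_bounded_sets)
  moreover have "rel_frontier (cball (0 :: real ^ 3) 1) = sphere 0 1" by simp
  ultimately have "sphere (0 :: real ^ 3) 1 homeomorphic rel_frontier (std_simplex ?N)"
    by metis
  then obtain f f' where f: "homeomorphism (sphere (0 :: real ^ 3) 1) (rel_frontier (std_simplex ?N)) f f'"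
    by (auto simp: homeomorphic_def)
  have sub: "rel_frontier (std_simplex ?N) \<subseteq> realization {{a,b,c}, {a,b,d}, {a,c,d}, {b,c,d}}"
  proof
    fix x assume "x \<in> rel_frontier (std_simplex ?N)"
    then obtain v where v: "v \<in> ?N" "x \<in> convex hull (?A - {axis v 1})"
      unfolding std_simplex_def rel_frontier_convex_hull_cases[OF ai] by blast
    have "?A - {axis v 1} = (\<lambda>v. axis v 1) ` (?N - {v})"
      by (auto simp: axis_eq_axis)
    then have "x \<in> std_simplex (?N - {v})" using v by (simp add: std_simplex_def)
    moreover have "?N - {v} \<in> {{a,b,c}, {a,b,d}, {a,c,d}, {b,c,d}}"
      using v d by auto
    ultimately show "x \<in> realization {{a,b,c}, {a,b,d}, {a,c,d}, {b,c,d}}"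
      unfolding realization_def by blast
  qed
  have "card ?N \<le> 4" by (simp add: card_insert_if)
  then have "?N \<noteq> UNIV" using card by auto
  then obtain e where e: "e \<notin> ?N" by blast
  let ?e = "axis e 1 :: real ^ 'v"
  have "\<Union>T = UNIV" using T by (simp add: sphere_triangulation_def)
  then obtain t where "t \<in> T" "e \<in> t" by (metis UNIV_I UnionE)
  then have eT: "?e \<in> realization T" using axis_mem_std_simplex unfolding realization_def by blast
  have "?e \<notin> realization {{a,b,c}, {a,b,d}, {a,c,d}, {b,c,d}}"
    using e by (auto simp: realization_def std_simplex_explicit axis_def)
  moreover have "realization {{a,b,c}, {a,b,d}, {a,c,d}, {b,c,d}} \<subseteq> realization T"
    using faces by (auto simp: realization_def)
  ultimately have sub': "rel_frontier (std_simplex ?N) \<subseteq> realization T - {?e}"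
    using sub by blast
  obtain h h' where h: "homeomorphism (realization T - {?e}) (UNIV :: complex set) h h'"
    using punctured_realization_homeomorphic_plane[OF T eT] by (auto simp: homeomorphic_def)
  have "continuous_on (sphere 0 1) (h \<circ> f)"
    using f h sub' by (intro continuous_on_compose) (auto simp: homeomorphism_def intro: continuous_on_subset)
  moreover have "inj_on (h \<circ> f) (sphere 0 1)"
  proof (rule comp_inj_on)
    show "inj_on f (sphere 0 1)" using f by (auto simp: homeomorphism_def intro: inj_on_inverseI)
    have "inj_on h (realization T - {?e})" using h by (auto simp: homeomorphism_def intro: inj_on_inverseI)
    then show "inj_on h (f ` sphere 0 1)"
      using f sub' by (auto simp: homeomorphism_def intro: inj_on_subset)
  qed
  ultimately have "DIM(real ^ 3) \<le> DIM(complex)"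
    using no_embedding_sphere_lowdim[of "0 :: real ^ 3" 1 "h \<circ> f"] by simp
  then show False by simp
qed

section \<open>The disks of a pattern cover the sphere\<close>

declare stereo.simps [simp del]

lemma inner_real3: "(p :: real ^ 3) \<bullet> q = p $ 1 * q $ 1 + p $ 2 * q $ 2 + p $ 3 * q $ 3"
  by (simp add: inner_vec_def sum_3)

lemma one_plus_cmod_pos: "1 + (cmod z)\<^sup>2 > 0"
  by (simp add: add_pos_nonneg)

lemma stereo_Finite_nth:
  "stereo (Finite z) $ 1 = 2 * Re z / (1 + (cmod z)\<^sup>2)"
  "stereo (Finite z) $ 2 = 2 * Im z / (1 + (cmod z)\<^sup>2)"
  "stereo (Finite z) $ 3 = ((cmod z)\<^sup>2 - 1) / (1 + (cmod z)\<^sup>2)"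
  by (simp_all add: stereo.simps divide_inverse mult.commute)

lemma stereo_Infinity_eq: "stereo Infinity = axis 3 1"
  by (simp add: stereo.simps vec_eq_iff forall_3 axis_def)

lemma norm_stereo [simp]: "norm (stereo p) = 1"
proof (cases p)
  case (Finite z)
  have "(norm (stereo p))\<^sup>2 = 1"
  proof -
    let ?d = "1 + (cmod z)\<^sup>2"
    have d: "?d \<noteq> 0" using one_plus_cmod_pos[of z] by simp
    have "(norm (stereo p))\<^sup>2 = ((2 * Re z)\<^sup>2 + (2 * Im z)\<^sup>2 + ((cmod z)\<^sup>2 - 1)\<^sup>2) / ?d\<^sup>2"
      unfolding power2_norm_eq_inner inner_real3 Finite stereo_Finite_nth
      by (simp add: power2_eq_square add_divide_distrib)
    also have "(2 * Re z)\<^sup>2 + (2 * Im z)\<^sup>2 + ((cmod z)\<^sup>2 - 1)\<^sup>2 = ?d\<^sup>2"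
      unfolding cmod_power2 by (simp add: power2_eq_square algebra_simps)
    finally show ?thesis using d by simp
  qed
  then show ?thesis by (metis norm_ge_zero power2_eq_1_iff neg_0_le_iff_le not_one_le_zero)
next
  case Infinity
  then show ?thesis by (simp add: stereo_Infinity_eq)
qed

lemma stereo_Finite_surj:
  assumes "norm q = 1" "q \<noteq> axis 3 1"
  shows "\<exists>z. q = stereo (Finite z)"
proof -
  have q: "q $ 1 * q $ 1 + q $ 2 * q $ 2 + q $ 3 * q $ 3 = 1"
    using assms(1) by (metis inner_real3 norm_eq_1)
  have "q $ 3 \<noteq> 1"
  proof
    assume 3: "q $ 3 = 1"
    then have "(q $ 1)\<^sup>2 + (q $ 2)\<^sup>2 = 0" using q by (simp add: power2_eq_square)
    then have "q $ 1 = 0" "q $ 2 = 0" by (simp_all add: sum_power2_eq_zero_iff)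
    then show False using 3 assms(2) by (simp add: vec_eq_iff forall_3 axis_def)
  qed
  then have k: "1 - q $ 3 \<noteq> 0" by simp
  define z where "z = Complex (q $ 1 / (1 - q $ 3)) (q $ 2 / (1 - q $ 3))"
  let ?k = "1 - q $ 3"
  have "(cmod z)\<^sup>2 = (q $ 1 * q $ 1 + q $ 2 * q $ 2) / (?k * ?k)"
    unfolding cmod_power2 z_def by (simp add: power2_eq_square add_divide_distrib)
  also have "q $ 1 * q $ 1 + q $ 2 * q $ 2 = ?k * (1 + q $ 3)" using q by (simp add: algebra_simps)
  finally have c: "(cmod z)\<^sup>2 = (1 + q $ 3) / ?k" using k by simp
  have d: "1 + (cmod z)\<^sup>2 = 2 / ?k" using k by (simp add: c field_simps)
  have z: "Re z = q $ 1 / ?k" "Im z = q $ 2 / ?k" by (simp_all add: z_def)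
  have "stereo (Finite z) $ 1 = q $ 1" "stereo (Finite z) $ 2 = q $ 2" "stereo (Finite z) $ 3 = q $ 3"
    unfolding stereo_Finite_nth d z c using k by (simp_all add: field_simps)
  then have "q = stereo (Finite z)" by (simp add: vec_eq_iff forall_3)
  then show ?thesis ..
qed

lemma stereo_surj: "norm q = 1 \<Longrightarrow> \<exists>p. q = stereo p"
  using stereo_Finite_surj stereo_Infinity_eq by metis

lemma mink_stereo_Finite:
  "(1 + (cmod z)\<^sup>2) * mink x (stereo (Finite z), 1) =
     2 * (fst x $ 1 * Re z + fst x $ 2 * Im z) - (snd x - fst x $ 3) * (cmod z)\<^sup>2 - (snd x + fst x $ 3)"
proof -
  let ?d = "1 + (cmod z)\<^sup>2"
  have d: "?d \<noteq> 0" using one_plus_cmod_pos[of z] by simp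
  have "?d * mink x (stereo (Finite z), 1)
    = fst x $ 1 * (?d * stereo (Finite z) $ 1) + fst x $ 2 * (?d * stereo (Finite z) $ 2)
      + fst x $ 3 * (?d * stereo (Finite z) $ 3) - snd x * ?d"
    unfolding mink_def inner_real3 fst_conv snd_conv by (simp only: algebra_simps)
  also have "\<dots> = fst x $ 1 * (2 * Re z) + fst x $ 2 * (2 * Im z) + fst x $ 3 * ((cmod z)\<^sup>2 - 1) - snd x * ?d"
    unfolding stereo_Finite_nth using d by simp
  finally show ?thesis by (simp add: algebra_simps)
qed

text \<open>A cap that misses the north pole is a round disk in the stereographic chart.\<close>

lemma cap_chart:
  assumes "mink x x = 1" and k: "mink x (axis 3 1, 1) < 0"
  defines "k \<equiv> snd x - fst x $ 3"
  shows "k > 0"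
    and "stereo (Finite z) \<in> cap x \<longleftrightarrow> z \<in> cball (Complex (fst x $ 1 / k) (fst x $ 2 / k)) (1 / k)"
proof -
  show k: "k > 0" using k by (simp add: mink_def k_def inner_axis)
  let ?a = "fst x $ 1" and ?b = "fst x $ 2" and ?c = "fst x $ 3" and ?s = "snd x"
  have one: "?a * ?a + ?b * ?b - 1 = k * (?s + ?c)"
    using assms(1) by (simp add: mink_def inner_real3 k_def algebra_simps)
  let ?w = "Complex (?a / k) (?b / k)"
  have "(k * dist ?w z)\<^sup>2 = (k * Re z - ?a)\<^sup>2 + (k * Im z - ?b)\<^sup>2"
  proof -
    have "(k * dist ?w z)\<^sup>2 = (k * (?a / k - Re z))\<^sup>2 + (k * (?b / k - Im z))\<^sup>2"
      by (simp add: dist_norm cmod_power2 power_mult_distrib distrib_left)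
    also have "\<dots> = (?a - k * Re z)\<^sup>2 + (?b - k * Im z)\<^sup>2"
      using k by (simp add: right_diff_distrib)
    finally show ?thesis by (simp add: power2_commute)
  qed
  also have "\<dots> = k\<^sup>2 * (cmod z)\<^sup>2 - 2 * k * (?a * Re z + ?b * Im z) + (?a * ?a + ?b * ?b - 1) + 1"
    unfolding cmod_power2 by (simp add: power2_eq_square algebra_simps)
  also have "\<dots> = 1 - k * ((1 + (cmod z)\<^sup>2) * mink x (stereo (Finite z), 1))"
    unfolding one mink_stereo_Finite by (simp add: k_def power2_eq_square algebra_simps)
  finally have eq: "(k * dist ?w z)\<^sup>2 = 1 - k * ((1 + (cmod z)\<^sup>2) * mink x (stereo (Finite z), 1))" .
  have "z \<in> cball ?w (1 / k) \<longleftrightarrow> k * dist ?w z \<le> 1"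
    using k by (simp add: pos_le_divide_eq mult.commute)
  also have "\<dots> \<longleftrightarrow> (k * dist ?w z)\<^sup>2 \<le> 1"
    using k by (metis abs_square_le_1 abs_of_nonneg zero_le_dist mult_nonneg_nonneg less_imp_le)
  also have "\<dots> \<longleftrightarrow> mink x (stereo (Finite z), 1) \<ge> 0"
    unfolding eq using k one_plus_cmod_pos[of z] by (simp add: zero_le_mult_iff)
  also have "\<dots> \<longleftrightarrow> stereo (Finite z) \<in> cap x" unfolding mem_cap by simp
  finally show "stereo (Finite z) \<in> cap x \<longleftrightarrow> z \<in> cball ?w (1 / k)" by simp
qed

text \<open>Helly's theorem for four convex sets of the plane that need not be distinct\<close>

lemma helly_plane:
  fixes A B C D :: "complex set"
  assumes c: "convex A" "convex B" "convex C" "convex D"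
    and "A \<inter> B \<inter> C \<noteq> {}" "A \<inter> B \<inter> D \<noteq> {}" "A \<inter> C \<inter> D \<noteq> {}" "B \<inter> C \<inter> D \<noteq> {}"
  shows "A \<inter> B \<inter> C \<inter> D \<noteq> {}"
proof (cases "distinct [A, B, C, D]")
  case True
  have "\<Inter>{A, B, C, D} \<noteq> {}"
  proof (rule Helly)
    show "DIM(complex) + 1 \<le> card {A, B, C, D}" using True by simp
    show "\<forall>s\<in>{A, B, C, D}. convex s" using c by auto
    show "\<Inter>t \<noteq> {}" if t: "t \<subseteq> {A, B, C, D}" "card t = DIM(complex) + 1" for t
    proof -
      define F where "F = {A, B, C, D}"
      have tF: "t \<subseteq> F" "finite F" "card F = 4" using t(1) True by (simp_all add: F_def)
      then have "card (F - t) = card F - card t"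
        by (intro card_Diff_subset) (auto intro: finite_subset)
      then have "card (F - t) = 1" using tF t(2) by simp
      then obtain X where X: "F - t = {X}" by (auto simp: card_1_singleton_iff)
      then have "t = F - {X}" "X \<in> F" using tF by blast+
      then have tt: "t = {A, B, C, D} - {X}" and "X \<in> {A, B, C, D}" by (simp_all only: F_def)
      then consider "X = A" | "X = B" | "X = C" | "X = D" by blast
      then show ?thesis
      proof cases
        case 1
        then have "t = {B, C, D}" using tt True by auto
        then show ?thesis using assms by (simp add: Int_assoc)
      next
        case 2
        then have "t = {A, C, D}" using tt True by auto
        then show ?thesis using assms by (simp add: Int_assoc)
      next
        case 3
        then have "t = {A, B, D}" using tt True by auto
        then show ?thesis using assms by (simp add: Int_assoc)
      next
        case 4
        then have "t = {A, B, C}" using tt True by auto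
        then show ?thesis using assms by (simp add: Int_assoc)
      qed
    qed
  qed
  then show ?thesis by (simp add: Int_assoc)
next
  case False
  then have "A = B \<or> A = C \<or> A = D \<or> B = C \<or> B = D \<or> C = D" by auto
  then show ?thesis using assms(5-8) by (elim disjE) (simp_all add: Int_ac)
qed

text \<open>
  The unit vectors \<open>x v\<close> represent a circle pattern with contact graph \<open>T\<close> and overlap angles \<open>\<Theta>\<close>.
\<close>

definition realizes :: "'v::finite set set \<Rightarrow> ('v set \<Rightarrow> real) \<Rightarrow> ('v \<Rightarrow> (real ^ 3) \<times> real) \<Rightarrow> bool" where
  "realizes T \<Theta> x \<longleftrightarrow> (\<forall>v. mink (x v) (x v) = 1) \<and>
     (\<forall>u w. {u, w} \<in> edges T \<longrightarrow> mink (x u) (x w) = - cos (\<Theta> {u, w})) \<and>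
     (\<forall>u w. u \<noteq> w \<longrightarrow> (cap (x u) \<inter> cap (x w) \<noteq> {} \<longleftrightarrow> {u, w} \<in> edges T))"

lemma angle_space_range: "\<Theta> \<in> angle_space T \<Longrightarrow> {u, w} \<in> edges T \<Longrightarrow> 0 < \<Theta> {u, w} \<and> \<Theta> {u, w} < pi"
  unfolding angle_space_def by auto

lemma triangle_edges:
  assumes "sphere_triangulation T" "{a, b, c} \<in> T"
  shows "distinct [a, b, c]" "{a, b} \<in> edges T" "{b, c} \<in> edges T" "{c, a} \<in> edges T"
proof -
  have "card {a, b, c} = 3" using assms by (auto simp: sphere_triangulation_def)
  then show d: "distinct [a, b, c]" by (auto simp: card_insert_if split: if_splits)
  show "{a, b} \<in> edges T" "{b, c} \<in> edges T" "{c, a} \<in> edges T"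
    using d unfolding edges_iff by (auto intro!: bexI[OF _ assms(2)])
qed

lemma face_posdef3:
  assumes T: "sphere_triangulation T" and \<Theta>: "\<Theta> \<in> angle_space T" and f: "{a, b, c} \<in> T"
    and "mink x x = 1" "mink y y = 1" "mink z z = 1"
    and "mink x y = - cos (\<Theta> {a, b})" "mink y z = - cos (\<Theta> {b, c})" "mink z x = - cos (\<Theta> {c, a})"
  shows "posdef3 x y z"
proof -
  note e = triangle_edges[OF T f]
  have "cond2 T \<Theta>" using \<Theta> by (simp add: angle_space_def)
  then have c2: "\<Theta> {a,b} + \<Theta> {b,c} + \<Theta> {c,a} > pi" "\<Theta> {a,b} + \<Theta> {b,c} < \<Theta> {c,a} + pi"
    "\<Theta> {b,c} + \<Theta> {c,a} < \<Theta> {a,b} + pi" "\<Theta> {c,a} + \<Theta> {a,b} < \<Theta> {b,c} + pi"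
    using f unfolding cond2_def by blast+
  show ?thesis
    using c2 assms angle_space_range[OF \<Theta> e(2)] angle_space_range[OF \<Theta> e(3)] angle_space_range[OF \<Theta> e(4)]
    by (intro posdef3_cosine_gram[of x y z "\<Theta> {a,b}" "\<Theta> {b,c}" "\<Theta> {c,a}"]) auto
qed

lemma nonface_angle_sum:
  assumes T: "sphere_triangulation T" and \<Theta>: "\<Theta> \<in> angle_space T" and f: "{a, b, c} \<notin> T"
    and e: "{a, b} \<in> edges T" "{b, c} \<in> edges T" "{c, a} \<in> edges T"
  shows "\<Theta> {a,b} + \<Theta> {b,c} + \<Theta> {c,a} < pi"
proof -
  have d: "distinct [a, b, c]" using e by (auto simp: edges_iff)
  have "cond3 T \<Theta>" using \<Theta> by (simp add: angle_space_def)
  then show ?thesis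
    using d e separates_vertices_nonface_triangle[OF T d f] unfolding cond3_def by blast
qed

lemma chordless_square_angle_sum:
  assumes T: "sphere_triangulation T" and \<Theta>: "\<Theta> \<in> angle_space T"
    and e: "{a, b} \<in> edges T" "{b, c} \<in> edges T" "{c, d} \<in> edges T" "{d, a} \<in> edges T"
    and n: "a \<noteq> c" "{a, c} \<notin> edges T" "b \<noteq> d" "{b, d} \<notin> edges T"
  shows "\<Theta> {a,b} + \<Theta> {b,c} + \<Theta> {c,d} + \<Theta> {d,a} < 2 * pi"
proof -
  have d: "distinct [a, b, c, d]" using e n by (auto simp: edges_iff)
  have "cond4 T \<Theta>" using \<Theta> by (simp add: angle_space_def)
  then show ?thesis
    using d e separates_vertices_chordless_square[OF T d n(2,4)] unfolding cond4_def by blast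
qed

text \<open>
  Three disks that share a point and leave another point uncovered form a face; any other
  triangle of edges separates the vertices and has angle sum below \<open>pi\<close>.
\<close>

lemma common_point_imp_face:
  assumes T: "sphere_triangulation T" and \<Theta>: "\<Theta> \<in> angle_space T" and x: "realizes T \<Theta> x"
    and d: "distinct [a, b, c]" and q: "q \<in> cap (x a)" "q \<in> cap (x b)" "q \<in> cap (x c)"
    and p: "norm p = 1" "p \<notin> cap (x a)" "p \<notin> cap (x b)" "p \<notin> cap (x c)"
  shows "{a, b, c} \<in> T"
proof (rule ccontr)
  assume f: "{a, b, c} \<notin> T"
  have e: "{a, b} \<in> edges T" "{b, c} \<in> edges T" "{c, a} \<in> edges T"
    using x d q unfolding realizes_def by (metis IntI distinct_length_2_or_more empty_iff)+
  have "\<Theta> {a,b} + \<Theta> {b,c} + \<Theta> {c,a} < pi" by (rule nonface_angle_sum[OF T \<Theta> f e])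
  then have "cap (x a) \<inter> cap (x b) \<inter> cap (x c) = {} \<or> cap (x a) \<union> cap (x b) \<union> cap (x c) = sphere 0 1"
    using x e angle_space_range[OF \<Theta> e(1)] angle_space_range[OF \<Theta> e(2)] angle_space_range[OF \<Theta> e(3)]
    unfolding realizes_def
    by (intro caps_triple_disjoint_or_cover[of _ _ _ "\<Theta> {a,b}" "\<Theta> {b,c}" "\<Theta> {c,a}"]) auto
  moreover have "p \<in> sphere 0 1" using p by simp
  ultimately show False using p q by blast
qed

text \<open>
  Let \<open>S\<close> be a nonempty set of faces such that every edge of a face in \<open>S\<close> lies in a second face in
  \<open>S\<close>. If the disks of \<open>S\<close> missed the north pole, they would be convex disks in the stereographic
  chart. Choose the face \<open>t\<close> in \<open>S\<close> whose triple intersection is farthest from the origin. By Helly's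
  theorem two of its disks already stay outside the open ball of that radius, so that the second face
  at the corresponding edge has the same closest point. The four disks concerned then share a point
  and all their triples are faces, which is impossible.
\<close>

lemma caps_cover_north_pole:
  fixes T :: "'v::finite set set"
  assumes T: "sphere_triangulation T" and card: "CARD('v) > 4"
    and \<Theta>: "\<Theta> \<in> angle_space T" and x: "realizes T \<Theta> x"
    and S: "S \<subseteq> T" "S \<noteq> {}"
    and closed: "\<And>t u w. t \<in> S \<Longrightarrow> u \<in> t \<Longrightarrow> w \<in> t \<Longrightarrow> u \<noteq> w \<Longrightarrow> \<exists>t'\<in>S. t' \<noteq> t \<and> u \<in> t' \<and> w \<in> t'"
    and out: "\<And>v. v \<in> \<Union>S \<Longrightarrow> axis 3 1 \<notin> cap (x v)"
  shows False
proof -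
  have N: "norm (axis 3 1 :: real ^ 3) = 1" by simp
  define D where "D = (\<lambda>v. {z. stereo (Finite z) \<in> cap (x v)})"
  define I where "I = (\<lambda>t. \<Inter>v\<in>t. D v)"
  define m where "m = (\<lambda>t. norm (closest_point (I t) 0))"
  have unit: "mink (x v) (x v) = 1" for v using x by (simp add: realizes_def)
  have ball: "\<exists>c r. D v = cball c r" if "v \<in> \<Union>S" for v
  proof -
    have "mink (x v) (axis 3 1, 1) < 0" using out[OF that] N by (simp add: mem_cap)
    from cap_chart(2)[OF unit this] show ?thesis unfolding D_def by blast
  qed
  have conv: "convex (D v)" "closed (D v)" if "v \<in> \<Union>S" for v
    using ball[OF that] convex_cball closed_cball by metis+
  have S3: "card t = 3" if "t \<in> S" for t using that S T by (auto simp: sphere_triangulation_def)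
  have I: "convex (I t)" "closed (I t)" "I t \<noteq> {}" if t: "t \<in> S" for t
  proof -
    show "convex (I t)" "closed (I t)"
      unfolding I_def using conv t by (auto intro!: convex_INT closed_INT)
    obtain a b c where abc: "t = {a, b, c}" using S3[OF t] by (auto simp: card_3_iff)
    then have f: "{a, b, c} \<in> T" using t S by blast
    note e = triangle_edges[OF T f]
    have "posdef3 (x a) (x b) (x c)"
      using x e by (intro face_posdef3[OF T \<Theta> f]) (auto simp: realizes_def)
    then obtain q where q: "q \<in> cap (x a)" "q \<in> cap (x b)" "q \<in> cap (x c)"
      using posdef3_caps_meet by blast
    then have "q \<noteq> axis 3 1" "norm q = 1" using out[of a] t abc by (auto simp: mem_cap)
    then obtain z where "q = stereo (Finite z)" using stereo_Finite_surj by blast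
    then show "I t \<noteq> {}" using q unfolding I_def abc D_def by blast
  qed
  have "finite S" by simp
  then have "Max (m ` S) \<in> m ` S" using S by (intro Max_in) auto
  then obtain t where t: "t \<in> S" and mt: "m t = Max (m ` S)" by auto
  have max: "m t' \<le> m t" if "t' \<in> S" for t' unfolding mt using that \<open>finite S\<close> by simp
  define y where "y = closest_point (I t) 0"
  have y: "y \<in> I t" "norm y = m t"
    using closest_point_in_set[OF I(2,3)[OF t]] by (simp_all add: y_def m_def)
  have ymin: "m t \<le> norm z" if "z \<in> I t" for z
    using closest_point_le[OF I(2)[OF t] that, of 0] by (simp add: m_def)
  let ?B = "ball (0 :: complex) (m t)"
  \<comment> \<open>by maximality, an edge already realizing the distance shares the closest point with
    both of its faces\<close>
  have key: False if abc: "t = {a, b, c}" and d: "distinct [a, b, c]" and edge: "D a \<inter> D b \<inter> ?B = {}" for a b c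
  proof -
    obtain t' where t': "t' \<in> S" "t' \<noteq> t" "a \<in> t'" "b \<in> t'"
      using closed[OF t, of a b] abc d by auto
    have "card (t' - {a, b}) = 1" using S3[OF t'(1)] t' d by (subst card_Diff_subset) auto
    then obtain c' where "t' - {a, b} = {c'}" by (auto simp: card_1_singleton_iff)
    then have c': "t' = {a, b, c'}" "c' \<noteq> a" "c' \<noteq> b" using t' by auto
    then have "c' \<noteq> c" using t' abc by auto
    define y' where "y' = closest_point (I t') 0"
    have y': "y' \<in> I t'" "norm y' = m t'"
      using closest_point_in_set[OF I(2,3)[OF t'(1)]] by (simp_all add: y'_def m_def)
    have lower: "m t \<le> norm z" if "z \<in> D a \<inter> D b" for z using that edge by (auto simp: not_less)
    have yab: "y \<in> D a \<inter> D b" using y by (simp add: I_def abc)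
    have y'ab: "y' \<in> D a \<inter> D b" using y' by (simp add: I_def c')
    have ny': "norm y' = m t" using lower[OF y'ab] max[OF t'(1)] y' by simp
    have in_S: "a \<in> \<Union>S" "b \<in> \<Union>S" using t abc by auto
    have ab: "convex (D a \<inter> D b)" "closed (D a \<inter> D b)"
      using conv[OF in_S(1)] conv[OF in_S(2)] by (auto intro: convex_Int closed_Int)
    have "y = closest_point (D a \<inter> D b) 0" "y' = closest_point (D a \<inter> D b) 0"
      using lower y(2) ny' by (auto intro!: closest_point_unique[OF ab yab] closest_point_unique[OF ab y'ab])
    then have "y \<in> D c'" using y' by (simp add: I_def c')
    moreover have "y \<in> D a" "y \<in> D b" "y \<in> D c" using y by (simp_all add: I_def abc)
    ultimately have q: "stereo (Finite y) \<in> cap (x a)" "stereo (Finite y) \<in> cap (x b)"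
      "stereo (Finite y) \<in> cap (x c)" "stereo (Finite y) \<in> cap (x c')" by (simp_all add: D_def)
    have in_S': "c \<in> \<Union>S" "c' \<in> \<Union>S" using t t' abc c'(1) by (metis UnionI insertI1 insertI2)+
    have o: "axis 3 1 \<notin> cap (x a)" "axis 3 1 \<notin> cap (x b)" "axis 3 1 \<notin> cap (x c)" "axis 3 1 \<notin> cap (x c')"
      using out in_S in_S' by simp_all
    have "{a, c, c'} \<in> T" "{b, c, c'} \<in> T"
      using d c' \<open>c' \<noteq> c\<close> by (auto intro!: common_point_imp_face[OF T \<Theta> x _ q(1,3,4) N o(1,3,4)]
          common_point_imp_face[OF T \<Theta> x _ q(2,3,4) N o(2,3,4)])
    moreover have "{a, b, c} \<in> T" "{a, b, c'} \<in> T" using t t' abc c' S by auto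
    ultimately show False
      using no_tetrahedron_in_triangulation[OF T card, of a b c c'] d c' \<open>c' \<noteq> c\<close> by auto
  qed
  obtain a b c where abc: "t = {a, b, c}" and d: "a \<noteq> b" "a \<noteq> c" "b \<noteq> c"
    using S3[OF t] by (auto simp: card_3_iff)
  have cv: "convex (D a)" "convex (D b)" "convex (D c)"
    by (rule conv(1), use t abc in auto)+
  have "D a \<inter> D b \<inter> D c \<noteq> {}" using y(1) by (auto simp: I_def abc)
  moreover have "D a \<inter> D b \<inter> D c \<inter> ?B = {}"
    using ymin by (force simp: I_def abc not_less)
  ultimately have "D a \<inter> D b \<inter> ?B = {} \<or> D a \<inter> D c \<inter> ?B = {} \<or> D b \<inter> D c \<inter> ?B = {}"
    using helly_plane[OF cv convex_ball[of 0 "m t"]] by blast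
  moreover have "t = {a, c, b}" "t = {b, c, a}" using abc by auto
  ultimately show False using key[OF abc] key[of a c b] key[of b c a] d by auto
qed

lemma realizes_orthogonal_transformation:
  assumes f: "orthogonal_transformation f"
  defines "h \<equiv> \<lambda>x :: (real ^ 3) \<times> real. (f (fst x), snd x)"
  shows "f p \<in> cap (h y) \<longleftrightarrow> p \<in> cap y" and "realizes T \<Theta> x \<Longrightarrow> realizes T \<Theta> (\<lambda>v. h (x v))"
proof -
  have inn: "f u \<bullet> f w = u \<bullet> w" for u w using f by (simp add: orthogonal_transformation_def)
  have m: "mink (h u) (h w) = mink u w" for u w by (simp add: mink_def h_def inn)
  have mem: "f p \<in> cap (h y) \<longleftrightarrow> p \<in> cap y" for p y
    using f by (simp add: mem_cap mink_def h_def inn orthogonal_transformation_norm)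
  show "f p \<in> cap (h y) \<longleftrightarrow> p \<in> cap y" by (rule mem)
  have surj: "\<exists>p. q = f p" for q using orthogonal_transformation_surj[OF f] by (metis surj_def)
  have "cap (h u) \<inter> cap (h w) = {} \<longleftrightarrow> cap u \<inter> cap w = {}" for u w
  proof -
    have "(\<exists>q. q \<in> cap (h u) \<and> q \<in> cap (h w)) \<longleftrightarrow> (\<exists>p. p \<in> cap u \<and> p \<in> cap w)"
      by (metis mem surj)
    then show ?thesis by blast
  qed
  then show "realizes T \<Theta> x \<Longrightarrow> realizes T \<Theta> (\<lambda>v. h (x v))" unfolding realizes_def m by simp
qed

text \<open>An arbitrary uncovered point is rotated to the north pole.\<close>

lemma caps_cover_sphere:
  fixes T :: "'v::finite set set"
  assumes T: "sphere_triangulation T" and card: "CARD('v) > 4"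
    and \<Theta>: "\<Theta> \<in> angle_space T" and x: "realizes T \<Theta> x"
    and S: "S \<subseteq> T" "S \<noteq> {}"
    and closed: "\<And>t u w. t \<in> S \<Longrightarrow> u \<in> t \<Longrightarrow> w \<in> t \<Longrightarrow> u \<noteq> w \<Longrightarrow> \<exists>t'\<in>S. t' \<noteq> t \<and> u \<in> t' \<and> w \<in> t'"
    and p: "norm p = 1"
  shows "\<exists>v\<in>\<Union>S. p \<in> cap (x v)"
proof (rule ccontr)
  assume no: "\<not> ?thesis"
  have N: "norm (axis 3 1 :: real ^ 3) = 1" by simp
  obtain f :: "real ^ 3 \<Rightarrow> real ^ 3" where f: "orthogonal_transformation f" "f p = axis 3 1"
    by (rule orthogonal_transformation_exists_1[OF p N])
  define x' where "x' = (\<lambda>v. (f (fst (x v)), snd (x v)))"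
  have x': "realizes T \<Theta> x'"
    unfolding x'_def by (rule realizes_orthogonal_transformation(2)[OF f(1) x])
  have out: "axis 3 1 \<notin> cap (x' v)" if "v \<in> \<Union>S" for v
  proof -
    have "p \<notin> cap (x v)" using no that by blast
    then show ?thesis
      using realizes_orthogonal_transformation(1)[OF f(1), of p "x v"] f(2) by (simp add: x'_def)
  qed
  show False
    by (rule caps_cover_north_pole[OF T card \<Theta> x' S]) (fact closed, fact out)
qed

section \<open>Centers, heights and moving points along circles\<close>

text \<open>
  For a unit vector \<open>x\<close> these are the center of the disk and the cosine of its radius. They stay
  bounded when the vector itself diverges, and are what converges along subsequences.
\<close>

definition center :: "(real ^ 3) \<times> real \<Rightarrow> real ^ 3" where
  "center x = fst x /\<^sub>R norm (fst x)"

definition height :: "(real ^ 3) \<times> real \<Rightarrow> real" where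
  "height x = snd x / norm (fst x)"

lemma unit_center_height:
  assumes "mink x x = 1"
  shows "norm (center x) = 1" "\<bar>height x\<bar> < 1" "sqrt (1 - (height x)\<^sup>2) = 1 / norm (fst x)"
    "x = (1 / sqrt (1 - (height x)\<^sup>2)) *\<^sub>R (center x, height x)"
proof -
  have n: "(norm (fst x))\<^sup>2 = 1 + (snd x)\<^sup>2"
    using assms by (simp add: mink_def power2_norm_eq_inner power2_eq_square[of "snd x"])
  then have n0: "norm (fst x) > 0"
    by (metis add_pos_nonneg norm_ge_zero order_le_less power_zero_numeral zero_le_power2 zero_less_one less_irrefl)
  then show "norm (center x) = 1" by (simp add: center_def)
  have h: "1 - (height x)\<^sup>2 = 1 / (norm (fst x))\<^sup>2"
  proof -
    have "1 - (height x)\<^sup>2 = ((norm (fst x))\<^sup>2 - (snd x)\<^sup>2) / (norm (fst x))\<^sup>2"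
      using n0 by (simp add: height_def power_divide diff_divide_distrib)
    also have "(norm (fst x))\<^sup>2 - (snd x)\<^sup>2 = 1" using n by simp
    finally show ?thesis .
  qed
  then have "(height x)\<^sup>2 < 1" using n0 by (smt (verit) zero_less_divide_1_iff zero_less_power)
  then show "\<bar>height x\<bar> < 1" by (simp add: abs_square_less_1)
  show s: "sqrt (1 - (height x)\<^sup>2) = 1 / norm (fst x)"
    unfolding h using n0 by (simp add: real_sqrt_divide)
  show "x = (1 / sqrt (1 - (height x)\<^sup>2)) *\<^sub>R (center x, height x)"
    unfolding s using n0 by (simp add: center_def height_def prod_eq_iff)
qed

lemma mem_cap_center:
  assumes "mink x x = 1"
  shows "q \<in> cap x \<longleftrightarrow> norm q = 1 \<and> height x \<le> center x \<bullet> q"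
proof -
  have "fst x \<noteq> 0"
  proof
    assume "fst x = 0"
    then have "- (snd x * snd x) = 1" using assms by (simp add: mink_def)
    then show False using zero_le_square[of "snd x"] by linarith
  qed
  then have "norm (fst x) > 0" by simp
  then show ?thesis
    by (simp add: mem_cap mink_def center_def height_def field_simps)
qed

text \<open>The great circle through \<open>c\<close> and \<open>d\<close>, also for \<open>d = c\<close> and \<open>d = - c\<close>.\<close>

lemma orthonormal_companion:
  fixes c d :: "real ^ 3"
  assumes "norm c = 1" "norm d = 1"
  obtains e where "norm e = 1" "c \<bullet> e = 0"
    "d = cos (arccos (c \<bullet> d)) *\<^sub>R c + sin (arccos (c \<bullet> d)) *\<^sub>R e"
proof -
  have cc: "c \<bullet> c = 1" and dd: "d \<bullet> d = 1" using assms by (simp_all add: norm_eq_1)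
  have le: "\<bar>c \<bullet> d\<bar> \<le> 1" using Cauchy_Schwarz_ineq2[of c d] assms by simp
  then have c1: "cos (arccos (c \<bullet> d)) = c \<bullet> d" by (simp add: cos_arccos_abs)
  have s1: "sin (arccos (c \<bullet> d)) = sqrt (1 - (c \<bullet> d)\<^sup>2)" using le by (simp add: sin_arccos_abs)
  define u where "u = d - (c \<bullet> d) *\<^sub>R c"
  have cu: "c \<bullet> u = 0" by (simp add: u_def inner_diff_right cc)
  have "(norm u)\<^sup>2 = 1 - (c \<bullet> d)\<^sup>2"
    unfolding power2_norm_eq_inner u_def
    by (simp add: inner_diff_left inner_diff_right cc dd inner_commute power2_eq_square)
  then have nu: "norm u = sqrt (1 - (c \<bullet> d)\<^sup>2)" by (metis norm_ge_zero real_sqrt_unique)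
  show thesis
  proof (cases "u = 0")
    case True
    obtain y where y: "y \<noteq> 0" "orthogonal c y"
      by (rule orthogonal_to_vector_exists[of c]) auto
    show ?thesis
    proof (rule that[of "y /\<^sub>R norm y"])
      show "norm (y /\<^sub>R norm y) = 1" using y by simp
      show "c \<bullet> (y /\<^sub>R norm y) = 0" using y by (simp add: orthogonal_def)
      have "sqrt (1 - (c \<bullet> d)\<^sup>2) = 0" using nu True by simp
      moreover have "d = (c \<bullet> d) *\<^sub>R c" using True by (simp add: u_def)
      ultimately show "d = cos (arccos (c \<bullet> d)) *\<^sub>R c + sin (arccos (c \<bullet> d)) *\<^sub>R (y /\<^sub>R norm y)"
        unfolding c1 s1 by simp
    qed
  next
    case False
    show ?thesis
    proof (rule that[of "u /\<^sub>R norm u"])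
      show "norm (u /\<^sub>R norm u) = 1" using False by simp
      show "c \<bullet> (u /\<^sub>R norm u) = 0" using cu by simp
      show "d = cos (arccos (c \<bullet> d)) *\<^sub>R c + sin (arccos (c \<bullet> d)) *\<^sub>R (u /\<^sub>R norm u)"
        unfolding c1 s1 nu[symmetric] using False by (simp add: u_def)
    qed
  qed
qed

text \<open>
  If \<open>r\<close>, \<open>s\<close> are the radii and \<open>a\<close> is the distance of the centers, disjointness means \<open>r + s < a\<close>;
  the two claims are \<open>cos a < cos (r + s)\<close> and \<open>sin (r + s) > 0\<close>.
\<close>

lemma round_caps_disjoint:
  fixes c d :: "real ^ 3"
  assumes "norm c = 1" "norm d = 1" "\<bar>k\<bar> < 1" "\<bar>l\<bar> < 1"
    and disj: "\<And>q. norm q = 1 \<Longrightarrow> k \<le> c \<bullet> q \<Longrightarrow> l \<le> d \<bullet> q \<Longrightarrow> False"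
  shows "c \<bullet> d < k * l - sqrt (1 - k\<^sup>2) * sqrt (1 - l\<^sup>2)"
    and "k * sqrt (1 - l\<^sup>2) + l * sqrt (1 - k\<^sup>2) > 0"
proof -
  obtain e where e: "norm e = 1" "c \<bullet> e = 0"
    and d: "d = cos (arccos (c \<bullet> d)) *\<^sub>R c + sin (arccos (c \<bullet> d)) *\<^sub>R e"
    using orthonormal_companion[OF assms(1,2)] .
  define a where "a = arccos (c \<bullet> d)"
  define r where "r = arccos k"
  define s where "s = arccos l"
  have le: "\<bar>c \<bullet> d\<bar> \<le> 1" using Cauchy_Schwarz_ineq2[of c d] assms by simp
  have ca: "cos a = c \<bullet> d" using le by (simp add: a_def cos_arccos_abs)
  have a: "0 \<le> a" "a \<le> pi" using le by (auto simp: a_def arccos_bounded abs_le_iff)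
  have kr: "k = cos r" and ls: "l = cos s" using assms by (simp_all add: r_def s_def)
  have r: "0 < r" "r < pi" and s: "0 < s" "s < pi"
    using arccos_lt_bounded[of k] arccos_lt_bounded[of l] assms by (auto simp: r_def s_def)
  have sr: "sqrt (1 - k\<^sup>2) = sin r" and ss: "sqrt (1 - l\<^sup>2) = sin s"
    using assms by (simp_all add: r_def s_def sin_arccos_abs)
  have cc: "c \<bullet> c = 1" and ee: "e \<bullet> e = 1" and ec: "e \<bullet> c = 0"
    using assms(1) e by (simp_all add: norm_eq_1 inner_commute)
  have "\<not> a \<le> r"
  proof
    assume "a \<le> r"
    then have "cos r \<le> cos a" using a r by (intro cos_monotone_0_pi_le) auto
    then have "k \<le> c \<bullet> d" using ca kr by simp
    moreover have "l \<le> d \<bullet> d" using assms by (simp add: norm_eq_1)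
    ultimately show False using disj[OF assms(2)] by blast
  qed
  define q where "q = cos r *\<^sub>R c + sin r *\<^sub>R e"
  have "(norm q)\<^sup>2 = (cos r)\<^sup>2 + (sin r)\<^sup>2"
    unfolding power2_norm_eq_inner q_def
    by (simp add: inner_add_left inner_add_right cc ee ec e(2) power2_eq_square)
  then have nq: "norm q = 1" by (metis norm_ge_zero real_sqrt_unique real_sqrt_one sin_cos_squared_add2)
  have "c \<bullet> q = k" by (simp add: q_def inner_add_right cc e kr)
  moreover have "d \<bullet> q = cos a * cos r + sin a * sin r"
    by (subst d, fold a_def) (simp add: q_def inner_add_left inner_add_right cc ee ec e(2))
  then have "d \<bullet> q = cos (a - r)" by (simp add: cos_diff)
  ultimately have "cos (a - r) < cos s" using disj[OF nq] ls by fastforce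
  then have "s < a - r"
    using cos_monotone_0_pi_le[of "a - r" s] \<open>\<not> a \<le> r\<close> s by force
  then have ars: "r + s < a" by simp
  then have "cos a < cos (r + s)" using a r s by (intro cos_monotone_0_pi) auto
  then show "c \<bullet> d < k * l - sqrt (1 - k\<^sup>2) * sqrt (1 - l\<^sup>2)"
    unfolding sr ss by (simp add: ca kr ls cos_add)
  have "sin (r + s) > 0" using ars a r s by (intro sin_gt_zero) auto
  then show "k * sqrt (1 - l\<^sup>2) + l * sqrt (1 - k\<^sup>2) > 0"
    unfolding sr ss by (simp add: kr ls sin_add algebra_simps)
qed

lemma disjoint_capsI:
  assumes "mink x x = 1" "mink y y = 1" "mink x y < - 1" "snd x + snd y > 0"
  shows "cap x \<inter> cap y = {}"
proof (rule ccontr)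
  assume "cap x \<inter> cap y \<noteq> {}"
  then obtain q where q: "norm q = 1" "mink x (q, 1) \<ge> 0" "mink y (q, 1) \<ge> 0" by (auto simp: mem_cap)
  have "mink (x + y) (x + y) < 0" using assms by (simp add: mink_linear mink_commute[of y x])
  then have "mink (x + y) (q, 1) < 0"
    by (rule timelike_not_orthogonal_sphere(1)) (use assms q in auto)
  then show False using q by (simp add: mink_linear)
qed

text \<open>
  Moving from \<open>p\<close> in the direction \<open>f\<close> along the circle with center \<open>c\<close> leaves all disks that miss
  \<open>p\<close>, that have shrunk to \<open>p\<close>, or whose circles pass through \<open>p\<close> and are left in direction \<open>f\<close>.
\<close>

lemma leave_along_circle:
  fixes d :: "'i \<Rightarrow> real ^ 3"
  assumes "finite I" and p: "norm p = 1" and c: "norm c = 1" "c \<bullet> p = k" "\<bar>k\<bar> < 1"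
    and f: "f \<bullet> c = 0" "f \<bullet> p = 0" "norm f = 1"
    and I: "\<And>i. i \<in> I \<Longrightarrow> d i \<bullet> p < l i \<or> (d i = p \<and> l i = 1) \<or> (d i \<bullet> p = l i \<and> d i \<bullet> f < 0)"
  shows "\<exists>y. norm y = 1 \<and> c \<bullet> y = k \<and> (\<forall>i\<in>I. d i \<bullet> y < l i)"
proof -
  define r where "r = sqrt (1 - k\<^sup>2)"
  have k2: "k\<^sup>2 < 1" using c by (simp add: abs_square_less_1)
  then have r: "r > 0" "r\<^sup>2 = 1 - k\<^sup>2" by (simp_all add: r_def)
  have cc: "c \<bullet> c = 1" "p \<bullet> p = 1" "p \<bullet> c = k" "c \<bullet> f = 0" "p \<bullet> f = 0" "f \<bullet> f = 1"
    using p c f by (simp_all add: norm_eq_1 inner_commute)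
  define y where "y = (\<lambda>t. k *\<^sub>R c + cos t *\<^sub>R (p - k *\<^sub>R c) + (sin t * r) *\<^sub>R f)"
  have y0: "y 0 = p" by (simp add: y_def)
  have ny: "norm (y t) = 1" for t
  proof -
    have "y t \<bullet> y t = k\<^sup>2 + (cos t)\<^sup>2 * (1 - k\<^sup>2) + (sin t)\<^sup>2 * r\<^sup>2"
      by (simp add: y_def inner_add_left inner_add_right inner_diff_left inner_diff_right cc c f
          power2_eq_square algebra_simps)
    also have "\<dots> = k\<^sup>2 + ((cos t)\<^sup>2 + (sin t)\<^sup>2) * (1 - k\<^sup>2)" unfolding r by (simp only: distrib_right add.assoc)
    finally have "y t \<bullet> y t = 1" unfolding sin_cos_squared_add2 by simp
    then show ?thesis by (simp add: norm_eq_1)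
  qed
  have cy: "c \<bullet> y t = k" for t
    by (simp add: y_def inner_add_right inner_diff_right cc c f)
  have dy: "d i \<bullet> y t = k * (d i \<bullet> c) + cos t * (d i \<bullet> (p - k *\<^sub>R c)) + sin t * (r * (d i \<bullet> f))" for i t
    by (simp add: y_def inner_add_right)
  have ev: "\<forall>\<^sub>F t in at_right 0. d i \<bullet> y t < l i" if "i \<in> I" for i
    using I[OF that]
  proof (elim disjE conjE)
    assume lt: "d i \<bullet> p < l i"
    have "((\<lambda>t. d i \<bullet> y t) \<longlongrightarrow> d i \<bullet> y 0) (at_right 0)"
      unfolding dy by (intro tendsto_intros)
    then show ?thesis using lt unfolding y0 by (rule order_tendstoD(2))
  next
    assume i: "d i = p" "l i = 1"
    have "\<forall>\<^sub>F t in at_right (0::real). 0 < t \<and> t < pi"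
      using eventually_at_right_real[of 0 pi] by simp
    then show ?thesis
    proof eventually_elim
      case (elim t)
      then have "cos t < 1" using cos_monotone_0_pi[of 0 t] by simp
      then have "cos t * (1 - k\<^sup>2) < 1 - k\<^sup>2" using k2 by simp
      then show ?case unfolding dy unfolding i
        by (simp add: inner_diff_right cc power2_eq_square)
    qed
  next
    assume i: "d i \<bullet> p = l i" "d i \<bullet> f < 0"
    have "((\<lambda>t. d i \<bullet> y t) has_real_derivative r * (d i \<bullet> f)) (at 0)"
      unfolding dy by (auto intro!: derivative_eq_intros)
    moreover have "r * (d i \<bullet> f) < 0" using i r by (simp add: mult_pos_neg)
    ultimately obtain b where b: "b > 0" "\<And>h. h > 0 \<Longrightarrow> h < b \<Longrightarrow> d i \<bullet> y h < d i \<bullet> y 0"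
      using DERIV_neg_dec_right[of "\<lambda>t. d i \<bullet> y t" "r * (d i \<bullet> f)" 0] by auto
    have "\<forall>\<^sub>F t in at_right (0::real). 0 < t \<and> t < b"
      using eventually_at_right_real[OF b(1)] by simp
    then show ?thesis
      by eventually_elim (use b i y0 in auto)
  qed
  then have "\<forall>\<^sub>F t in at_right 0. \<forall>i\<in>I. d i \<bullet> y t < l i"
    using \<open>finite I\<close> by (intro eventually_ball_finite) auto
  then obtain t where "\<forall>i\<in>I. d i \<bullet> y t < l i"
    using eventually_happens'[OF trivial_limit_at_right_real] by blast
  then show ?thesis using ny cy by blast
qed

text \<open>
  The condition \<open>c \<bullet> q < k * norm q\<close> is the homogeneous form of lying outside the disk, so that the
  point need not be normalized.
\<close>

lemma exterior_point_near:
  fixes c y :: "real ^ 3"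
  assumes "norm c = 1" "norm y = 1" "c \<bullet> y \<le> k" "\<bar>k\<bar> < 1" "\<delta> > 0"
  obtains q where "dist y q < \<delta>" "c \<bullet> q < k * norm q"
proof (cases "c \<bullet> y < k")
  case True
  then show ?thesis using that[of y] assms by simp
next
  case False
  then have ck: "c \<bullet> y = k" using assms by simp
  define w where "w = c - k *\<^sub>R y"
  define s where "s = 1 - k\<^sup>2"
  have s: "0 < s" "s \<le> 1" using assms by (auto simp: s_def abs_square_less_1)
  have cc: "c \<bullet> c = 1" "y \<bullet> y = 1" "y \<bullet> c = k" using assms ck by (simp_all add: norm_eq_1 inner_commute)
  have cw: "c \<bullet> w = s" by (simp add: w_def s_def inner_diff_right cc ck power2_eq_square)
  have yw: "y \<bullet> w = 0" by (simp add: w_def inner_diff_right cc)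
  have ww: "w \<bullet> w = s"
    by (simp add: w_def s_def inner_diff_left inner_diff_right cc ck power2_eq_square)
  then have nw: "norm w \<le> 1" using s by (simp add: norm_eq_sqrt_inner)
  define a where "a = min (\<delta> / 2) 1"
  have a: "0 < a" "a \<le> 1" "a < \<delta>" using assms by (auto simp: a_def)
  define q where "q = y - a *\<^sub>R w"
  have "dist y q = a * norm w" using a by (simp add: q_def dist_norm)
  also have "\<dots> \<le> a * 1" using a nw by (intro mult_left_mono) auto
  finally have dist: "dist y q < \<delta>" using a by simp
  have cq: "c \<bullet> q = k - a * s" by (simp add: q_def inner_diff_right ck cw)
  have "q \<bullet> q = 1 + a\<^sup>2 * s"
    by (simp add: q_def inner_diff_left inner_diff_right cc yw ww inner_commute[of w y] power2_eq_square)
  then have nq: "(norm q)\<^sup>2 = 1 + a\<^sup>2 * s" by (simp add: power2_norm_eq_inner)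
  have as: "a\<^sup>2 * s \<ge> 0" using s by simp
  have n1: "norm q \<ge> 1" using nq as by (metis le_add_same_cancel1 norm_ge_zero one_le_power power2_le_imp_le power_one)
  have n2: "norm q \<le> 1 + a\<^sup>2 * s / 2"
  proof (rule power2_le_imp_le)
    show "(norm q)\<^sup>2 \<le> (1 + a\<^sup>2 * s / 2)\<^sup>2"
      unfolding nq using zero_le_power2[of "a\<^sup>2 * s / 2"] by (simp add: power2_sum)
  qed (use as in simp)
  have "a\<^sup>2 * s < 2 * (a * s)"
  proof -
    have "a * (a * s) \<le> 1 * (a * s)" using a s by (intro mult_right_mono) auto
    moreover have "a * s > 0" using a s by simp
    ultimately have "a * (a * s) < 2 * (a * s)" by linarith
    then show ?thesis by (simp add: power2_eq_square mult.assoc)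
  qed
  then have "norm q - 1 < a * s" using n2 by linarith
  moreover have "- k * (norm q - 1) \<le> 1 * (norm q - 1)" using assms n1 by (intro mult_right_mono) auto
  ultimately have "c \<bullet> q < k * norm q" unfolding cq by (simp add: algebra_simps)
  then show ?thesis using that dist by blast
qed

section \<open>Limits of normalized patterns\<close>

lemma cosine_strict_bounds:
  assumes "0 < A" "A < pi"
  shows "- 1 < cos A" "cos A < 1"
  using cos_monotone_0_pi[of 0 A] cos_monotone_0_pi[of A pi] assms by auto

lemma unit_inner_eq_1:
  fixes u v :: "'a::real_inner"
  assumes "norm u = 1" "norm v = 1" "u \<bullet> v = 1"
  shows "u = v"
proof -
  have "(norm (u - v))\<^sup>2 = u \<bullet> u - 2 * (u \<bullet> v) + v \<bullet> v"
    by (simp add: power2_norm_eq_inner algebra_simps inner_commute)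
  then have "(norm (u - v))\<^sup>2 = 0" using assms by (simp add: norm_eq_1)
  then show ?thesis by simp
qed

lemma exists_unit_normal:
  obtains f :: "real ^ 3" where "norm f = 1" "f \<bullet> u = 0" "f \<bullet> w = 0"
proof -
  have "dim {u, w} \<le> card {u, w}" by (intro dim_le_card') auto
  also have "\<dots> \<le> 2" by (simp add: card_insert_if)
  finally have "dim {u, w} < DIM(real ^ 3)" by simp
  then obtain g where g: "g \<noteq> 0" "\<And>y. y \<in> span {u, w} \<Longrightarrow> orthogonal g y"
    by (rule orthogonal_to_subspace_exists) blast
  have "g \<bullet> u = 0" "g \<bullet> w = 0" using g(2) span_base[of _ "{u, w}"] by (auto simp: orthogonal_def)
  then show thesis using that[of "g /\<^sub>R norm g"] g(1) by simp
qed

text \<open>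
  What survives in the limit of a convergent sequence of patterns: disks with centers \<open>c v\<close> and
  radii of cosine \<open>k v\<close>, which may be degenerate (\<open>k v = 1\<close> or \<open>k v = - 1\<close>) except for those of one
  face. The products of the vectors, multiplied by the sines of the radii, pass to the limit
  (\<open>edge\<close>, \<open>nonedge\<close>), and so does the fact that the sum of the radii of two nonadjacent disks has
  nonnegative sine (\<open>nonedge_time\<close>). Since the disks of each pattern cover the sphere and
  nonadjacent ones are disjoint, a point cannot be exterior to all limit disks except one nondegenerate one, or two
  nonadjacent ones, to whose interiors it does not belong either (\<open>covered\<close>). Since each pattern is
  irreducible, no proper subset of the vertices carries a set of faces of the kind whose disks cover the sphere
  (\<open>spanning\<close>).
\<close>

locale limit_caps =
  fixes T :: "'v::finite set set" and \<Theta> :: "'v set \<Rightarrow> real"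
    and c :: "'v \<Rightarrow> real ^ 3" and k :: "'v \<Rightarrow> real"
  assumes T: "sphere_triangulation T" and card: "CARD('v) > 4" and \<Theta>: "\<Theta> \<in> angle_space T"
    and norm_c: "norm (c v) = 1" and k_le: "\<bar>k v\<bar> \<le> 1"
    and edge: "{u, w} \<in> edges T \<Longrightarrow>
      c u \<bullet> c w - k u * k w = - cos (\<Theta> {u, w}) * (sqrt (1 - (k u)\<^sup>2) * sqrt (1 - (k w)\<^sup>2))"
    and nonedge: "u \<noteq> w \<Longrightarrow> {u, w} \<notin> edges T \<Longrightarrow>
      c u \<bullet> c w - k u * k w \<le> - (sqrt (1 - (k u)\<^sup>2) * sqrt (1 - (k w)\<^sup>2))"
    and nonedge_time: "u \<noteq> w \<Longrightarrow> {u, w} \<notin> edges T \<Longrightarrow>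
      0 \<le> k u * sqrt (1 - (k w)\<^sup>2) + k w * sqrt (1 - (k u)\<^sup>2)"
    and base: "\<exists>t\<in>T. \<forall>v\<in>t. \<bar>k v\<bar> < 1"
    and covered: "norm y = 1 \<Longrightarrow> u = w \<or> {u, w} \<notin> edges T \<Longrightarrow> \<bar>k u\<bar> < 1 \<Longrightarrow> \<bar>k w\<bar> < 1 \<Longrightarrow>
      c u \<bullet> y \<le> k u \<Longrightarrow> c w \<bullet> y \<le> k w \<Longrightarrow> (\<And>v. v \<noteq> u \<Longrightarrow> v \<noteq> w \<Longrightarrow> c v \<bullet> y < k v) \<Longrightarrow> False"
    and spanning: "S \<subseteq> T \<Longrightarrow> S \<noteq> {} \<Longrightarrow>
      (\<And>t u w. t \<in> S \<Longrightarrow> u \<in> t \<Longrightarrow> w \<in> t \<Longrightarrow> u \<noteq> w \<Longrightarrow> \<exists>t'\<in>S. t' \<noteq> t \<and> u \<in> t' \<and> w \<in> t') \<Longrightarrow> \<Union>S = UNIV"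
begin

text \<open>
  The sine of the radius, and the unit vector of a nondegenerate disk. For \<open>\<rho> v = 0\<close> the vector is
  \<open>0\<close> by the convention on division; only the vectors with \<open>\<rho> v > 0\<close> matter.
\<close>

definition \<rho> where "\<rho> v = sqrt (1 - (k v)\<^sup>2)"
definition X where "X v = (1 / \<rho> v) *\<^sub>R (c v, k v)"

lemma rho_pos: "\<bar>k v\<bar> < 1 \<Longrightarrow> \<rho> v > 0"
  by (simp add: \<rho>_def abs_square_less_1)

lemma rho_sq: "(\<rho> v)\<^sup>2 = 1 - (k v)\<^sup>2"
  using k_le[of v] by (simp add: \<rho>_def abs_square_le_1)

lemma cc: "c v \<bullet> c v = 1"
  using norm_c[of v] by (simp add: norm_eq_1)

lemma mink_X: "mink (X u) (X w) = (c u \<bullet> c w - k u * k w) / (\<rho> u * \<rho> w)"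
  by (simp add: X_def mink_linear) (simp add: mink_def diff_divide_distrib mult.commute)

lemma mink_X_point: "mink (X v) (q, 1) = (c v \<bullet> q - k v) / \<rho> v"
  by (simp add: X_def mink_linear) (simp add: mink_def diff_divide_distrib)

lemma X_unit:
  assumes "\<bar>k v\<bar> < 1"
  shows "mink (X v) (X v) = 1"
proof -
  have "\<rho> v * \<rho> v > 0" using rho_pos[OF assms] by simp
  then show ?thesis unfolding mink_X using rho_sq[of v] by (simp add: cc power2_eq_square)
qed

lemma X_edge:
  assumes "{u, w} \<in> edges T" "\<bar>k u\<bar> < 1" "\<bar>k w\<bar> < 1"
  shows "mink (X u) (X w) = - cos (\<Theta> {u, w})" "\<bar>mink (X u) (X w)\<bar> < 1"
proof -
  show *: "mink (X u) (X w) = - cos (\<Theta> {u, w})"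
    unfolding mink_X using edge[OF assms(1)] rho_pos[OF assms(2)] rho_pos[OF assms(3)]
    by (simp add: \<rho>_def)
  show "\<bar>mink (X u) (X w)\<bar> < 1"
    unfolding * using angle_space_range[OF \<Theta> assms(1)] cosine_strict_bounds[of "\<Theta> {u, w}"] by auto
qed

lemma X_nonedge:
  assumes "u \<noteq> w" "{u, w} \<notin> edges T" "\<bar>k u\<bar> < 1" "\<bar>k w\<bar> < 1"
  shows "mink (X u) (X w) \<le> - 1" "snd (X u) + snd (X w) \<ge> 0"
proof -
  note r = rho_pos[OF assms(3)] rho_pos[OF assms(4)]
  then have rr: "\<rho> u * \<rho> w > 0" by simp
  show "mink (X u) (X w) \<le> - 1"
    unfolding mink_X using nonedge[OF assms(1,2)] rr by (simp add: \<rho>_def pos_divide_le_eq)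
  have "snd (X u) + snd (X w) = (k u * \<rho> w + k w * \<rho> u) / (\<rho> u * \<rho> w)"
    using r by (simp add: X_def field_simps)
  then show "snd (X u) + snd (X w) \<ge> 0"
    using nonedge_time[OF assms(1,2)] rr by (simp add: \<rho>_def)
qed

lemma face_X_posdef3:
  assumes "{a, b, d} \<in> T" "\<bar>k a\<bar> < 1" "\<bar>k b\<bar> < 1" "\<bar>k d\<bar> < 1"
  shows "posdef3 (X a) (X b) (X d)"
  using triangle_edges[OF T assms(1)] assms
  by (intro face_posdef3[OF T \<Theta> assms(1)] X_unit X_edge) auto

text \<open>
  A degenerate disk shrinks to a point and does not fill the sphere: otherwise it would be adjacent
  to all vertices of the nondegenerate face, and its null vector would be orthogonal to a positive
  definite triple.
\<close>

lemma degenerate_height: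
  assumes "\<not> \<bar>k v\<bar> < 1"
  shows "k v = 1"
proof (rule ccontr)
  assume "k v \<noteq> 1"
  then have kv: "k v = - 1" using assms k_le[of v] by auto
  then have rv: "\<rho> v = 0" by (simp add: \<rho>_def)
  obtain t where t: "t \<in> T" "\<And>w. w \<in> t \<Longrightarrow> \<bar>k w\<bar> < 1" using base by blast
  have "card t = 3" using T t by (auto simp: sphere_triangulation_def)
  then obtain a b d where abd: "t = {a, b, d}" by (auto simp: card_3_iff)
  have orth: "mink (X w) (c v, k v) = 0" if w: "w \<in> t" for w
  proof -
    have kw: "\<bar>k w\<bar> < 1" using t w by blast
    then have vw: "v \<noteq> w" using assms by blast
    have "{v, w} \<in> edges T"
    proof (rule ccontr)
      assume "{v, w} \<notin> edges T"
      from nonedge_time[OF vw this] have "\<rho> w \<le> 0" using rv by (simp add: kv \<rho>_def)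
      then show False using rho_pos[OF kw] by simp
    qed
    from edge[OF this] have "c w \<bullet> c v = k w * k v"
      using rv by (simp add: \<rho>_def inner_commute mult.commute)
    then show ?thesis by (simp add: X_def mink_linear) (simp add: mink_def)
  qed
  have "posdef3 (X a) (X b) (X d)" using t abd by (intro face_X_posdef3) auto
  moreover have "(c v, k v) \<noteq> 0" using kv by (simp add: prod_eq_iff)
  ultimately have "mink (c v, k v) (c v, k v) < 0"
    using orth abd by (intro posdef3_orthogonal_basis(1)[of "X a" "X b" "X d"]) auto
  then show False by (simp add: mink_def cc kv)
qed

text \<open>
  The nondegenerate disks whose circles pass through \<open>p\<close>. Their vectors lie in the orthogonal
  complement of the null vector \<open>(p, 1)\<close>, on which the form is positive semidefinite; modulo that
  null vector they are unit vectors of a Euclidean plane. The angle conditions on triangles then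
  exclude three mutually adjacent ones, and nonadjacent ones are opposite.
\<close>

definition null :: "real ^ 3 \<Rightarrow> 'v set" where
  "null p = {v. \<bar>k v\<bar> < 1 \<and> mink (X v) (p, 1) = 0}"

lemma null_triangle:
  assumes p: "norm p = 1" and z: "a \<in> null p" "b \<in> null p" "d \<in> null p"
    and e: "{a, b} \<in> edges T" "{b, d} \<in> edges T" "{d, a} \<in> edges T"
  shows False
proof -
  have k: "\<bar>k a\<bar> < 1" "\<bar>k b\<bar> < 1" "\<bar>k d\<bar> < 1"
    and n: "mink (X a) (p, 1) = 0" "mink (X b) (p, 1) = 0" "mink (X d) (p, 1) = 0"
    using z by (auto simp: null_def)
  show False
  proof (cases "{a, b, d} \<in> T")
    case True
    have "mink (p, 1) (p, 1) < 0"
      by (rule posdef3_orthogonal_basis(1)[OF face_X_posdef3[OF True k] n]) (simp add: prod_eq_iff)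
    then show False using lightlike_mink_self[OF p] by simp
  next
    case False
    have "\<Theta> {a,b} + \<Theta> {b,d} + \<Theta> {d,a} < pi" by (rule nonface_angle_sum[OF T \<Theta> False e])
    then have sum: "\<Theta> {a,b} + \<Theta> {d,a} + \<Theta> {b,d} < pi" by simp
    obtain s t where "mink (X d + s *\<^sub>R X a + t *\<^sub>R X b) (X d + s *\<^sub>R X a + t *\<^sub>R X b) < 0"
      using timelike_combination[OF X_unit[OF k(1)] X_unit[OF k(2)] X_unit[OF k(3)]
          X_edge(1)[OF e(1) k(1,2)] X_edge(1)[OF e(2) k(2,3)] X_edge(1)[OF e(3) k(3,1)] _ _ _ sum]
        angle_space_range[OF \<Theta> e(1)] angle_space_range[OF \<Theta> e(2)] angle_space_range[OF \<Theta> e(3)]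
      by blast
    from timelike_not_orthogonal_sphere(4)[OF this p] show False using n by (simp add: mink_linear)
  qed
qed

text \<open>Nonadjacent disks of \<open>null p\<close> touch at \<open>p\<close>, possibly being complementary (\<open>g = 0\<close>).\<close>

lemma null_nonadjacent_sum:
  assumes p: "norm p = 1" and z: "u \<in> null p" "w \<in> null p" and n: "u \<noteq> w" "{u, w} \<notin> edges T"
  obtains g where "g \<ge> 0" "X u + X w = g *\<^sub>R (p, 1)" "mink (X u) (X w) = - 1"
proof -
  have k: "\<bar>k u\<bar> < 1" "\<bar>k w\<bar> < 1" and nu: "mink (X u) (p, 1) = 0" "mink (X w) (p, 1) = 0"
    using z by (auto simp: null_def)
  note l = X_nonedge[OF n k]
  have m: "mink (X u + X w) (X u + X w) = 2 + 2 * mink (X u) (X w)"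
    by (simp add: mink_linear X_unit k mink_commute[of "X w" "X u"])
  have eq: "X u + X w = snd (X u + X w) *\<^sub>R (p, 1)"
    using null_orthogonal_to_lightlike[OF p, of "X u + X w"] nu l m by (simp add: mink_linear)
  have "mink (X u + X w) (X u + X w) = 0"
    by (subst (1 2) eq) (simp only: mink_linear lightlike_mink_self[OF p] mult_zero_right)
  then have "mink (X u) (X w) = - 1" using m by simp
  then show thesis using that[of "snd (X u + X w)"] eq l by simp
qed

lemma null_nonadjacent_unique:
  assumes p: "norm p = 1" and z: "u \<in> null p" "w \<in> null p" "w' \<in> null p"
    and n: "u \<noteq> w" "{u, w} \<notin> edges T" "u \<noteq> w'" "{u, w'} \<notin> edges T"
  shows "w = w'"
proof (rule ccontr)
  assume ww: "w \<noteq> w'"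
  obtain g where g: "X u + X w = g *\<^sub>R (p, 1)" using null_nonadjacent_sum[OF p z(1,2) n(1,2)] .
  obtain g' where g': "X u + X w' = g' *\<^sub>R (p, 1)" using null_nonadjacent_sum[OF p z(1,3) n(3,4)] .
  have k: "\<bar>k w\<bar> < 1" "\<bar>k w'\<bar> < 1" using z by (auto simp: null_def)
  have "X w - X w' = (X u + X w) - (X u + X w')" by simp
  also have "\<dots> = (g - g') *\<^sub>R (p, 1)" unfolding g g' by (simp only: scaleR_left_diff_distrib)
  finally have eq: "X w - X w' = (g - g') *\<^sub>R (p, 1)" .
  have "mink (X w - X w') (X w - X w') = 0"
    unfolding eq by (simp only: mink_linear lightlike_mink_self[OF p] mult_zero_right)
  then have "mink (X w) (X w') = 1"
    by (simp add: mink_linear X_unit k mink_commute[of "X w'" "X w"])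
  then show False
    using X_edge(2)[OF _ k] X_nonedge(1)[OF ww _ k] by (cases "{w, w'} \<in> edges T") auto
qed

text \<open>Two pairs of opposite vectors give a separating square of angle sum \<open>2 * pi\<close>.\<close>

lemma null_square:
  assumes p: "norm p = 1" and z: "a \<in> null p" "b \<in> null p" "a' \<in> null p" "b' \<in> null p"
    and n: "a \<noteq> a'" "{a, a'} \<notin> edges T" "b \<noteq> b'" "{b, b'} \<notin> edges T"
    and d: "a \<noteq> b" "a \<noteq> b'" "a' \<noteq> b" "a' \<noteq> b'"
  shows False
proof -
  have n': "{a', a} \<notin> edges T" "{b', b} \<notin> edges T" using n by (simp_all add: insert_commute)
  have k: "\<bar>k a\<bar> < 1" "\<bar>k b\<bar> < 1" "\<bar>k a'\<bar> < 1" "\<bar>k b'\<bar> < 1"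
    and nu: "mink (X b) (p, 1) = 0" "mink (X b') (p, 1) = 0" using z by (auto simp: null_def)
  have e: "{a, b} \<in> edges T" "{b, a'} \<in> edges T" "{a', b'} \<in> edges T" "{b', a} \<in> edges T"
    using null_nonadjacent_unique[OF p z(1,3,2) n(1,2)] null_nonadjacent_unique[OF p z(1,3,4) n(1,2)]
      null_nonadjacent_unique[OF p z(3,1,2) n(1)[symmetric] n'(1)]
      null_nonadjacent_unique[OF p z(3,1,4) n(1)[symmetric] n'(1)] d
    by (metis insert_commute)+
  obtain g where g: "X a + X a' = g *\<^sub>R (p, 1)" using null_nonadjacent_sum[OF p z(1,3) n(1,2)] .
  have sum: "A + B = pi" if "cos A + cos B = 0" "0 < A" "A < pi" "0 < B" "B < pi" for A B :: real
  proof -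
    have "cos A = cos (pi - B)" using that by simp
    then show ?thesis using that cos_inj_pi[of A "pi - B"] by simp
  qed
  have "mink (X a + X a') (X b) = 0" "mink (X b') (X a + X a') = 0"
    unfolding g mink_scaleR_left mink_scaleR_right using nu mink_commute[of "(p, 1)" "X b"] by simp_all
  then have "cos (\<Theta> {a, b}) + cos (\<Theta> {b, a'}) = 0" "cos (\<Theta> {a', b'}) + cos (\<Theta> {b', a}) = 0"
    using X_edge(1)[OF e(1) k(1,2)] X_edge(1)[OF e(2) k(2,3)] X_edge(1)[OF e(3) k(3,4)] X_edge(1)[OF e(4) k(4,1)]
      mink_commute[of "X a'" "X b"] mink_commute[of "X b'" "X a'"]
    by (simp_all add: mink_linear)
  then have "\<Theta> {a, b} + \<Theta> {b, a'} = pi" "\<Theta> {a', b'} + \<Theta> {b', a} = pi"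
    using angle_space_range[OF \<Theta> e(1)] angle_space_range[OF \<Theta> e(2)] angle_space_range[OF \<Theta> e(3)]
      angle_space_range[OF \<Theta> e(4)] by (auto intro!: sum)
  then show False using chordless_square_angle_sum[OF T \<Theta> e n] by simp
qed

lemma null_structure:
  assumes p: "norm p = 1" and Z: "Z \<subseteq> null p" "Z \<noteq> {}"
  obtains a b d where "a \<in> Z" "b \<in> Z" "d \<in> Z" "Z \<subseteq> {a, b, d}"
    "b = a \<or> {a, b} \<in> edges T" "d = a \<or> (d \<noteq> a \<and> {a, d} \<notin> edges T)"
proof (cases "\<exists>a\<in>Z. \<exists>d\<in>Z. a \<noteq> d \<and> {a, d} \<notin> edges T")
  case True
  then obtain a d where ad: "a \<in> Z" "d \<in> Z" "a \<noteq> d" "{a, d} \<notin> edges T" by blast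
  have adj: "{a, v} \<in> edges T" if "v \<in> Z" "v \<noteq> a" "v \<noteq> d" for v
    using null_nonadjacent_unique[OF p, of a d v] ad that Z by blast
  show thesis
  proof (cases "Z \<subseteq> {a, d}")
    case True
    then show thesis using that[of a a d] ad by blast
  next
    case False
    then obtain b where b: "b \<in> Z" "b \<noteq> a" "b \<noteq> d" by blast
    have "v = b" if v: "v \<in> Z" "v \<noteq> a" "v \<noteq> d" for v
    proof (rule ccontr)
      assume vb: "v \<noteq> b"
      show False
      proof (cases "{b, v} \<in> edges T")
        case True
        show False
          by (rule null_triangle[OF p, of a b v])
            (use True adj[OF b] adj[OF v] ad b v Z in \<open>auto simp: insert_commute\<close>)
      next
        case False
        show False
          by (rule null_square[OF p, of a b d v]) (use False vb ad b v Z in auto)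
      qed
    qed
    then have "Z \<subseteq> {a, b, d}" by blast
    then show thesis using that[of a b d] ad b adj[OF b] by blast
  qed
next
  case False
  obtain a where a: "a \<in> Z" using Z by blast
  show thesis
  proof (cases "Z \<subseteq> {a}")
    case True
    then show thesis using that[of a a a] a by blast
  next
    case nz: False
    then obtain b where b: "b \<in> Z" "b \<noteq> a" by blast
    have adj: "{v, w} \<in> edges T" if "v \<in> Z" "w \<in> Z" "v \<noteq> w" for v w using False that by metis
    have ab: "{a, b} \<in> edges T" using adj a b by metis
    have "v = b" if v: "v \<in> Z" "v \<noteq> a" for v
    proof (rule ccontr)
      assume vb: "v \<noteq> b"
      have "{b, v} \<in> edges T" "{v, a} \<in> edges T" using adj a b v vb by metis+
      then show False using null_triangle[OF p _ _ _ ab] a b v Z by (metis subsetD)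
    qed
    then have "Z \<subseteq> {a, b, a}" by blast
    then show thesis using that[of a b a] a b ab by blast
  qed
qed

text \<open>The circles of adjacent disks cross: otherwise \<open>(p, 1)\<close> would be orthogonal to a positive definite triple.\<close>

lemma null_edge_transversal:
  assumes p: "norm p = 1" and z: "a \<in> null p" "b \<in> null p" and e: "{a, b} \<in> edges T"
    and f: "norm f = 1" "f \<bullet> c a = 0" "f \<bullet> p = 0"
  shows "c b \<bullet> f \<noteq> 0"
proof
  assume bf: "c b \<bullet> f = 0"
  have k: "\<bar>k a\<bar> < 1" "\<bar>k b\<bar> < 1" and n: "mink (X a) (p, 1) = 0" "mink (X b) (p, 1) = 0"
    using z by (auto simp: null_def)
  define m where "m = mink (X a) (X b)"
  have m: "\<bar>m\<bar> < 1" using X_edge(2)[OF e k] by (simp add: m_def)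
  define u where "u = X b - m *\<^sub>R X a"
  have Xf: "mink (X a) (f, 0) = 0" "mink (X b) (f, 0) = 0"
    using f bf by (simp_all add: X_def mink_def inner_commute)
  have "mink (X b) (X a) = m" by (simp add: m_def mink_commute)
  then have u: "mink u u = 1 - m\<^sup>2" "mink (X a) u = 0" "mink u (X a) = 0" "mink u (f, 0) = 0" "mink u (p, 1) = 0"
    by (simp_all add: u_def mink_linear X_unit k n Xf power2_eq_square flip: m_def)
  have uf: "mink (f, 0) u = 0" "mink (f, 0) (X a) = 0"
    using u(4) Xf(1) mink_commute[of "(f, 0)"] by simp_all
  have ff: "mink (f, 0) (f, 0) = 1" using f by (simp add: mink_def norm_eq_1)
  have fp: "mink (f, 0) (p, 1) = 0" using f by (simp add: mink_def)
  have upos: "mink u u > 0" using m by (simp add: u abs_square_less_1)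
  have "posdef3 (X a) (f, 0) u"
    unfolding posdef3_def
  proof (intro allI impI)
    fix s t r :: real
    assume nz: "s \<noteq> 0 \<or> t \<noteq> 0 \<or> r \<noteq> 0"
    have "mink (s *\<^sub>R X a + t *\<^sub>R (f, 0) + r *\<^sub>R u) (s *\<^sub>R X a + t *\<^sub>R (f, 0) + r *\<^sub>R u)
      = s\<^sup>2 + t\<^sup>2 + r\<^sup>2 * mink u u"
      unfolding mink_linear by (simp add: X_unit k Xf u(2-5) uf ff power2_eq_square)
    also have "\<dots> > 0"
    proof (cases "r = 0")
      case True
      then show ?thesis using nz by (simp add: sum_power2_gt_zero_iff)
    next
      case False
      then show ?thesis using upos by (simp add: add_nonneg_pos)
    qed
    finally show "0 < mink (s *\<^sub>R X a + t *\<^sub>R (f, 0) + r *\<^sub>R u) (s *\<^sub>R X a + t *\<^sub>R (f, 0) + r *\<^sub>R u)" .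
  qed
  from posdef3_orthogonal_basis(1)[OF this n(1) fp u(5)]
  have "mink (p, 1) (p, 1) < 0" by (simp add: prod_eq_iff)
  then show False using lightlike_mink_self[OF p] by simp
qed

lemma strict_or_degenerate:
  assumes p: "norm p = 1" and le: "c v \<bullet> p \<le> k v" and v: "v \<notin> null p"
  shows "c v \<bullet> p < k v \<or> (c v = p \<and> k v = 1)"
proof (cases "\<bar>k v\<bar> < 1")
  case True
  then have "mink (X v) (p, 1) \<noteq> 0" using v by (simp add: null_def)
  then show ?thesis using le rho_pos[OF True] by (simp add: mink_X_point)
next
  case False
  then have kv: "k v = 1" by (rule degenerate_height)
  show ?thesis
  proof (cases "c v \<bullet> p < 1")
    case False
    then have "c v \<bullet> p = 1" using le kv by simp
    then have "c v = p" by (rule unit_inner_eq_1[OF norm_c p])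
    then show ?thesis using kv by simp
  qed (simp add: kv)
qed

text \<open>
  Every point of the sphere is interior to a limit disk. Otherwise at most three of the circles
  pass through the point. One moves along the circle of one of them, \<open>a\<close>, leaving an adjacent disk \<open>b\<close>
  and staying out of the interior of a nonadjacent one \<open>d\<close>; if there is no such circle, any direction
  will do. This contradicts the covering property.
\<close>

lemma interior_covered:
  assumes p: "norm p = 1" and le: "\<And>v. c v \<bullet> p \<le> k v"
  shows False
proof (cases "null p = {}")
  case nullempty: True
  obtain d :: "real ^ 3" where d: "norm d = 1" "d \<bullet> p = 0" using exists_unit_normal[of p p] .
  obtain f :: "real ^ 3" where f: "norm f = 1" "f \<bullet> d = 0" "f \<bullet> p = 0" using exists_unit_normal[of d p] .
  have deg: "c v \<bullet> p < k v \<or> (c v = p \<and> k v = 1)" for v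
    using strict_or_degenerate[OF p le] nullempty by blast
  have "\<exists>y. norm y = 1 \<and> d \<bullet> y = 0 \<and> (\<forall>v\<in>UNIV. c v \<bullet> y < k v)"
    by (rule leave_along_circle[of UNIV p d 0 f]) (use p d f deg in auto)
  then obtain y where y: "norm y = 1" "\<And>v. c v \<bullet> y < k v" by blast
  obtain t where t: "t \<in> T" "\<And>v. v \<in> t \<Longrightarrow> \<bar>k v\<bar> < 1" using base by blast
  have "card t = 3" using T t by (auto simp: sphere_triangulation_def)
  then obtain a where "a \<in> t" by fastforce
  then show False using covered[OF y(1), of a a] t y(2) by (simp add: less_imp_le)
next
  case False
  then obtain a b d where abd: "a \<in> null p" "b \<in> null p" "d \<in> null p" "null p \<subseteq> {a, b, d}"
    "b = a \<or> {a, b} \<in> edges T" "d = a \<or> (d \<noteq> a \<and> {a, d} \<notin> edges T)"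
    using null_structure[OF p order_refl] by metis
  have ka: "\<bar>k a\<bar> < 1" and kd: "\<bar>k d\<bar> < 1" using abd by (auto simp: null_def)
  have null: "c v \<bullet> p = k v" if "v \<in> null p" for v
    using that rho_pos[of v] by (simp add: null_def mink_X_point)
  obtain f0 :: "real ^ 3" where f0: "norm f0 = 1" "f0 \<bullet> c a = 0" "f0 \<bullet> p = 0"
    using exists_unit_normal[of "c a" p] .
  define f where "f = (if c b \<bullet> f0 < 0 then f0 else - f0)"
  have f: "norm f = 1" "f \<bullet> c a = 0" "f \<bullet> p = 0" using f0 by (auto simp: f_def)
  have fb: "c b \<bullet> f < 0" if "b \<noteq> a"
  proof -
    have "c b \<bullet> f0 \<noteq> 0" using null_edge_transversal[OF p abd(1,2) _ f0] abd(5) that by blast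
    then show ?thesis by (auto simp: f_def)
  qed
  have cases: "c v \<bullet> p < k v \<or> (c v = p \<and> k v = 1) \<or> (c v \<bullet> p = k v \<and> c v \<bullet> f < 0)"
    if v: "v \<noteq> a" "v \<noteq> d" for v
  proof (cases "v \<in> null p")
    case True
    then have "v = b" using abd(4) v by blast
    then show ?thesis using fb v null[OF True] by simp
  next
    case False
    then show ?thesis using strict_or_degenerate[OF p le] by blast
  qed
  have "\<exists>y. norm y = 1 \<and> c a \<bullet> y = k a \<and> (\<forall>v\<in>UNIV - {a, d}. c v \<bullet> y < k v)"
    by (rule leave_along_circle[of "UNIV - {a, d}" p "c a" "k a" f])
      (use p norm_c null[OF abd(1)] ka f cases in auto)
  then obtain y where y: "norm y = 1" "c a \<bullet> y = k a" "\<And>v. v \<noteq> a \<Longrightarrow> v \<noteq> d \<Longrightarrow> c v \<bullet> y < k v" by blast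
  have "c d \<bullet> y \<le> k d"
  proof (cases "d = a")
    case False
    then have nad: "a \<noteq> d" "{a, d} \<notin> edges T" using abd by auto
    obtain g where g: "g \<ge> 0" "X a + X d = g *\<^sub>R (p, 1)"
      using null_nonadjacent_sum[OF p abd(1,3) nad] .
    have "mink (X a) (y, 1) = 0" using y by (simp add: mink_X_point)
    then have "mink (X d) (y, 1) = mink (X a + X d) (y, 1)" by (simp add: mink_linear)
    also have "\<dots> = g * (p \<bullet> y - 1)" unfolding g mink_scaleR_left by (simp add: mink_def)
    also have "\<dots> \<le> 0"
      using g(1) Cauchy_Schwarz_ineq2[of p y] p y(1) by (intro mult_nonneg_nonpos) auto
    finally show ?thesis using rho_pos[OF kd] by (simp add: mink_X_point divide_le_0_iff)
  qed (simp add: y)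
  then show False using covered[OF y(1), of a d] abd(6) ka kd y by force
qed

text \<open>The point to which a degenerate disk shrinks would not be interior to any limit disk.\<close>

lemma no_degenerate: "\<bar>k v\<bar> < 1"
proof (rule ccontr)
  assume v: "\<not> \<bar>k v\<bar> < 1"
  then have kv: "k v = 1" by (rule degenerate_height)
  show False
  proof (rule interior_covered[of "c v"])
    fix w
    show "c w \<bullet> c v \<le> k w"
    proof (cases "w = v")
      case False
      show ?thesis
        using edge[of w v] nonedge[OF False] kv by (cases "{w, v} \<in> edges T") auto
    qed (simp add: cc kv)
  qed (rule norm_c)
qed

lemmas X_unit' = X_unit[OF no_degenerate]
  and X_edge' = X_edge[OF _ no_degenerate no_degenerate]
  and X_nonedge' = X_nonedge[OF _ _ no_degenerate no_degenerate]
  and rho_pos' = rho_pos[OF no_degenerate]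

text \<open>
  If two tangent nonadjacent disks were not complementary, then by the first angle condition no limit
  disk would contain their point of tangency in its interior.
\<close>

lemma tangent_nonadjacent_opposite:
  assumes n: "u \<noteq> w" "{u, w} \<notin> edges T" and m: "mink (X u) (X w) = - 1"
  shows "X u = - X w"
proof (rule ccontr)
  assume "X u \<noteq> - X w"
  then have nz: "X u + X w \<noteq> 0" by (simp add: eq_neg_iff_add_eq_0)
  let ?l = "X u + X w"
  have ll: "mink ?l ?l = 0"
    using m by (simp add: mink_linear X_unit' mink_commute[of "X w" "X u"])
  have s0: "snd ?l \<ge> 0" using X_nonedge'(2)[OF n] by simp
  have nl: "(norm (fst ?l))\<^sup>2 = (snd ?l)\<^sup>2"
    using ll unfolding mink_def power2_norm_eq_inner by (simp add: power2_eq_square)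
  then have nl': "norm (fst ?l) = snd ?l" using s0 by (simp add: power2_eq_iff_nonneg)
  have s: "snd ?l > 0"
  proof (rule ccontr)
    assume "\<not> snd ?l > 0"
    then have "snd ?l = 0" using s0 by simp
    then have "fst ?l = 0" using nl' by simp
    then show False using nz \<open>snd ?l = 0\<close> by (simp add: prod_eq_iff)
  qed
  define p where "p = fst ?l /\<^sub>R snd ?l"
  have p: "norm p = 1" using s nl' by (simp add: p_def)
  have lp: "?l = snd ?l *\<^sub>R (p, 1)" using s by (simp add: p_def prod_eq_iff)
  have both: "mink (X v) ?l \<le> 0" for v
  proof -
    have m': "mink (X w) (X u) = - 1" using m by (simp add: mink_commute)
    have le: "mink (X v) (X z) < 1" if "v \<noteq> z" for z
      using X_edge'(2)[of v z] X_nonedge'(1)[OF that] by (cases "{v, z} \<in> edges T") auto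
    consider "v = u" | "v = w" | "v \<noteq> u" "v \<noteq> w" "{v, u} \<notin> edges T"
      | "v \<noteq> u" "v \<noteq> w" "{v, w} \<notin> edges T" | "{v, u} \<in> edges T" "{v, w} \<in> edges T" by blast
    then show ?thesis
    proof cases
      case 1
      then show ?thesis by (simp add: mink_add_right X_unit' m)
    next
      case 2
      then show ?thesis by (simp add: mink_add_right X_unit' m')
    next
      case 3
      then show ?thesis using X_nonedge'(1)[OF 3(1,3)] le[OF 3(2)] by (simp add: mink_add_right)
    next
      case 4
      then show ?thesis using X_nonedge'(1)[OF 4(2,3)] le[OF 4(1)] by (simp add: mink_add_right)
    next
      case 5
      have "nonadjacent_arc T u v w" using 5 n by (simp add: nonadjacent_arc_def insert_commute)
      then have "\<Theta> {v, u} + \<Theta> {v, w} \<le> pi"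
        using \<Theta> unfolding angle_space_def cond1_def by (auto simp: insert_commute)
      then have "cos (pi - \<Theta> {v, w}) \<le> cos (\<Theta> {v, u})"
        using angle_space_range[OF \<Theta> 5(1)] angle_space_range[OF \<Theta> 5(2)]
        by (intro cos_monotone_0_pi_le) auto
      then show ?thesis using X_edge'(1)[OF 5(1)] X_edge'(1)[OF 5(2)] by (simp add: mink_add_right)
    qed
  qed
  show False
  proof (rule interior_covered[OF p])
    fix v
    have "mink (X v) (snd ?l *\<^sub>R (p, 1)) \<le> 0" using both[of v] by (subst (asm) lp)
    then have "mink (X v) (p, 1) \<le> 0" using s unfolding mink_scaleR_right by (simp add: mult_le_0_iff)
    then show "c v \<bullet> p \<le> k v" using rho_pos'[of v] by (simp add: mink_X_point divide_le_0_iff)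
  qed
qed

text \<open>Complementary disks of nonadjacent vertices meet the disks of all other vertices, at supplementary angles.\<close>

lemma opposite_adjacent:
  assumes op: "X u = - X w" and n: "{u, w} \<notin> edges T" and v: "v \<noteq> u" "v \<noteq> w"
  shows "{u, v} \<in> edges T" "{w, v} \<in> edges T" "\<Theta> {u, v} + \<Theta> {w, v} = pi"
proof -
  have m: "mink (X u) (X v) = - mink (X w) (X v)" by (simp add: op mink_minus_left)
  have lt: "mink (X z) (X v) < 1" if "v \<noteq> z" for z
    using X_edge'(2)[of z v] X_nonedge'(1)[of z v] that by (cases "{z, v} \<in> edges T") auto
  show e: "{u, v} \<in> edges T"
  proof (rule ccontr)
    assume "{u, v} \<notin> edges T"
    then have "mink (X u) (X v) \<le> - 1" using X_nonedge'(1)[of u v] v by simp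
    then show False using m lt[OF v(2)] by simp
  qed
  show e': "{w, v} \<in> edges T"
  proof (rule ccontr)
    assume "{w, v} \<notin> edges T"
    then have "mink (X w) (X v) \<le> - 1" using X_nonedge'(1)[of w v] v by simp
    then show False using m lt[OF v(1)] by simp
  qed
  have r: "0 < \<Theta> {u, v}" "\<Theta> {u, v} < pi" "0 < \<Theta> {w, v}" "\<Theta> {w, v} < pi"
    using angle_space_range[OF \<Theta> e] angle_space_range[OF \<Theta> e'] by auto
  have "cos (\<Theta> {u, v}) = - cos (\<Theta> {w, v})"
    using m X_edge'(1)[OF e] X_edge'(1)[OF e'] by linarith
  then have "cos (\<Theta> {u, v}) = cos (pi - \<Theta> {w, v})" by (simp add: cos_diff)
  then have "\<Theta> {u, v} = pi - \<Theta> {w, v}" by (rule cos_inj_pi[rotated 4]) (use r in auto)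
  then show "\<Theta> {u, v} + \<Theta> {w, v} = pi" by simp
qed

text \<open>
  If \<open>v\<close>, \<open>v'\<close> and an apex did not form a face, the angles at \<open>u\<close> and \<open>w\<close>, being supplementary, would
  violate one of the conditions on triangles and squares.
\<close>

lemma opposite_faces:
  assumes op: "X u = - X w" and n: "u \<noteq> w" "{u, w} \<notin> edges T"
    and v: "v \<noteq> u" "v \<noteq> w" "v' \<noteq> u" "v' \<noteq> w" "v \<noteq> v'"
  shows "{u, v, v'} \<in> T"
proof (rule ccontr)
  assume nf: "{u, v, v'} \<notin> T"
  note a = opposite_adjacent[OF op n(2) v(1,2)] and a' = opposite_adjacent[OF op n(2) v(3,4)]
  have c: "{v, w} = {w, v}" "{v', u} = {u, v'}" "{v', w} = {w, v'}" by auto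
  have vv: "{v, v'} \<in> edges T"
  proof (rule ccontr)
    assume "{v, v'} \<notin> edges T"
    then have "\<Theta> {u, v} + \<Theta> {v, w} + \<Theta> {w, v'} + \<Theta> {v', u} < 2 * pi"
      using a a' n v by (intro chordless_square_angle_sum[OF T \<Theta>]) (auto simp: c)
    then show False using a(3) a'(3) unfolding c by linarith
  qed
  have 1: "\<Theta> {u, v} + \<Theta> {v, v'} + \<Theta> {u, v'} < pi"
    using nonface_angle_sum[OF T \<Theta> nf] a a' vv by (simp add: c)
  show False
  proof (cases "{w, v, v'} \<in> T")
    case True
    have "cond2 T \<Theta>" using \<Theta> by (simp add: angle_space_def)
    then have "\<Theta> {v', w} + \<Theta> {w, v} < \<Theta> {v, v'} + pi" using True unfolding cond2_def by blast
    then show False using 1 a(3) a'(3) unfolding c by linarith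
  next
    case False
    have "\<Theta> {w, v} + \<Theta> {v, v'} + \<Theta> {w, v'} < pi"
      using nonface_angle_sum[OF T \<Theta> False] a a' vv by (simp add: c)
    then show False using 1 a(3) a'(3) angle_space_range[OF \<Theta> vv] by linarith
  qed
qed

text \<open>
  Vertices with complementary disks are the apexes of a suspension. The suspension of any three
  further vertices covers the sphere, so by irreducibility there are no other vertices, and \<open>T\<close> is a double
  tetrahedron with equality throughout the first angle condition, which that condition excludes.
\<close>

lemma not_opposite:
  assumes n: "u \<noteq> w" "{u, w} \<notin> edges T"
  shows "X u \<noteq> - X w"
proof
  assume op: "X u = - X w"
  then have op': "X w = - X u" by simp
  have n': "w \<noteq> u" "{w, u} \<notin> edges T" using n by (auto simp: insert_commute)
  have face: "{e, v, v'} \<in> T" if "e = u \<or> e = w" "v \<notin> {u, w}" "v' \<notin> {u, w}" "v \<noteq> v'" for e v v'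
    using opposite_faces[OF op n, of v v'] opposite_faces[OF op' n', of v v'] that by auto
  have "card (UNIV - {u, w}) = CARD('v) - 2" using n by (simp add: card_Diff_subset)
  then have "3 \<le> card (UNIV - {u, w})" using card by simp
  then obtain M where M: "M \<subseteq> UNIV - {u, w}" "card M = 3" by (rule obtain_subset_with_card_n)
  then obtain x y z where xyz: "M = {x, y, z}" "x \<noteq> y" "x \<noteq> z" "y \<noteq> z" by (auto simp: card_3_iff)
  have Muw: "v \<noteq> u" "v \<noteq> w" if "v \<in> M" for v using that M by auto
  define S where "S = {t. \<exists>e i j. (e = u \<or> e = w) \<and> i \<in> M \<and> j \<in> M \<and> i \<noteq> j \<and> t = {e, i, j}}"
  have ST: "S \<subseteq> T" unfolding S_def using face Muw by blast
  have "{u, x, y} \<in> S" unfolding S_def using xyz by blast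
  then have "S \<noteq> {}" by blast
  have third: "\<exists>l\<in>M. l \<noteq> i \<and> l \<noteq> j" for i j using xyz by auto
  have "\<Union>S = UNIV"
  proof (rule spanning[OF ST \<open>S \<noteq> {}\<close>])
    fix t p q assume t: "t \<in> S" and pq: "p \<in> t" "q \<in> t" "p \<noteq> q"
    then obtain e i j where eij: "e = u \<or> e = w" "i \<in> M" "j \<in> M" "i \<noteq> j" "t = {e, i, j}"
      unfolding S_def by blast
    obtain l where l: "l \<in> M" "l \<noteq> i" "l \<noteq> j" using third by blast
    define e' where "e' = (if e = u then w else u)"
    have e': "e' = u \<or> e' = w" "e' \<noteq> e" using eij(1) n by (auto simp: e'_def)
    have el: "l \<noteq> e" "e' \<noteq> i" "e' \<noteq> j" using Muw l(1) eij(1,2,3) e'(1) by metis+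
    have 1: "{e, i, l} \<in> S" "{e, j, l} \<in> S" "{e', i, j} \<in> S"
      unfolding S_def using eij l e' by blast+
    have 2: "{e, i, l} \<noteq> t" "{e, j, l} \<noteq> t" "{e', i, j} \<noteq> t"
      using eij(5) l el e'(2) by blast+
    have pq': "p = e \<or> p = i \<or> p = j" "q = e \<or> q = i \<or> q = j" using pq eij(5) by simp_all
    show "\<exists>t'\<in>S. t' \<noteq> t \<and> p \<in> t' \<and> q \<in> t'"
    proof (cases "p = j \<or> q = j")
      case False
      then show ?thesis using pq' by (intro bexI[OF _ 1(1)] conjI 2(1)) auto
    next
      case j: True
      show ?thesis
      proof (cases "p = i \<or> q = i")
        case True
        then show ?thesis using j pq' pq(3) eij(4) by (intro bexI[OF _ 1(3)] conjI 2(3)) auto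
      next
        case False
        then show ?thesis using j pq' by (intro bexI[OF _ 1(2)] conjI 2(2)) auto
      qed
    qed
  qed
  then have all: "v \<in> {u, w} \<union> M" for v
  proof -
    have "v \<in> \<Union>S" using \<open>\<Union>S = UNIV\<close> by simp
    then show ?thesis unfolding S_def by blast
  qed
  have xyzM: "x \<notin> {u, w}" "y \<notin> {u, w}" "z \<notin> {u, w}" using Muw xyz by auto
  have MT: "M \<notin> T"
  proof
    assume "M \<in> T"
    then have "{x, y, z} \<in> T" using xyz by simp
    moreover have "{u, x, y} \<in> T" "{u, x, z} \<in> T" "{u, y, z} \<in> T" using face xyzM xyz by simp_all
    ultimately show False
      using no_tetrahedron_in_triangulation[OF T card, of u x y z] xyz xyzM by auto
  qed
  have sub: "t \<in> S" if t: "t \<in> T" for t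
  proof -
    have t3: "card t = 3" using T t by (auto simp: sphere_triangulation_def)
    have nuw: "\<not> (u \<in> t \<and> w \<in> t)" using n t by (auto simp: edges_iff)
    have "\<not> t \<subseteq> M"
      using MT M(2) t t3 xyz(1) by (metis card_subset_eq finite.emptyI finite.insertI)
    then obtain e where e: "e \<in> t" "e \<notin> M" by blast
    then have e1: "e = u \<or> e = w" using all[of e] by simp
    have e2: "t - {e} \<subseteq> M"
    proof
      fix v assume v: "v \<in> t - {e}"
      then have "v \<noteq> u" "v \<noteq> w" using e(1) e1 nuw by auto
      then show "v \<in> M" using all[of v] by simp
    qed
    have "card (t - {e}) = 2" using e t3 by simp
    then obtain i j where ij: "t - {e} = {i, j}" "i \<noteq> j" by (auto simp: card_2_iff)
    have ijM: "i \<in> M" "j \<in> M" using ij(1) e2 by auto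
    have "t = {e, i, j}" using e(1) ij(1) by blast
    with e1 ijM ij(2) show ?thesis unfolding S_def mem_Collect_eq by metis
  qed
  have "T = {{u,x,y}, {u,y,z}, {u,z,x}, {w,x,y}, {w,y,z}, {w,z,x}}" (is "T = ?R")
  proof
    show "T \<subseteq> ?R"
    proof
      fix t assume "t \<in> T"
      then obtain e i j where t: "e = u \<or> e = w" "i \<in> M" "j \<in> M" "i \<noteq> j" "t = {e, i, j}"
        using sub unfolding S_def by blast
      have "i = x \<or> i = y \<or> i = z" "j = x \<or> j = y \<or> j = z" using t(2,3) xyz(1) by auto
      then have "{i, j} = {x, y} \<or> {i, j} = {y, z} \<or> {i, j} = {z, x}"
        using t(4) by (elim disjE) (simp_all add: insert_commute)
      then have "t = insert e {x, y} \<or> t = insert e {y, z} \<or> t = insert e {z, x}" using t(5) by (elim disjE) simp_all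
      then show "t \<in> ?R" using t(1) by (elim disjE) simp_all
    qed
    show "?R \<subseteq> T" using face xyzM xyz by simp
  qed
  moreover have "distinct [u, w, x, y, z]" using n xyz xyzM by auto
  ultimately have "double_tetrahedron T" unfolding double_tetrahedron_def by blast
  moreover have "cond1 T \<Theta>" using \<Theta> by (simp add: angle_space_def)
  ultimately obtain a b d where abd: "nonadjacent_arc T a b d" "\<Theta> {a, b} + \<Theta> {b, d} < pi"
    unfolding cond1_def by blast
  have e: "{v, v'} \<in> edges T" if "v \<notin> {u, w}" "v \<noteq> v'" for v v'
  proof (cases "v' \<in> {u, w}")
    case True
    then show ?thesis
      using opposite_adjacent(1,2)[OF op n(2), of v] that by (auto simp: insert_commute)
  next
    case False
    then show ?thesis
      using face[of u v v'] triangle_edges(3)[OF T, of u v v'] that by blast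
  qed
  have ad: "a \<noteq> d" "{a, d} \<notin> edges T" "{a, b} \<in> edges T" "{b, d} \<in> edges T"
    using abd(1) by (auto simp: nonadjacent_arc_def)
  have "a \<in> {u, w}" "d \<in> {u, w}" using e[of a d] e[of d a] ad by (auto simp: insert_commute)
  then have aduw: "(a = u \<and> d = w) \<or> (a = w \<and> d = u)" using ad by auto
  have "b \<noteq> a" "b \<noteq> d" using ad by (auto simp: edges_iff)
  then have "\<Theta> {u, b} + \<Theta> {w, b} = pi" using opposite_adjacent(3)[OF op n(2), of b] aduw by blast
  then show False using abd(2) aduw by (auto simp: insert_commute)
qed

lemma nonadjacent_strict:
  assumes "u \<noteq> w" "{u, w} \<notin> edges T"
  shows "mink (X u) (X w) < - 1" "snd (X u) + snd (X w) > 0"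
proof -
  show m: "mink (X u) (X w) < - 1"
    using X_nonedge'(1)[OF assms] tangent_nonadjacent_opposite[OF assms] not_opposite[OF assms] by force
  have "mink (X u + X w) (X u + X w) < 0"
    using m by (simp add: mink_linear X_unit' mink_commute[of "X w" "X u"])
  then have "snd (X u + X w) \<noteq> 0" using timelike_not_orthogonal_sphere(3)[OF _ norm_c] by blast
  then show "snd (X u) + snd (X w) > 0" using X_nonedge'(2)[OF assms] by simp
qed

lemma limit_caps_disjoint:
  assumes "u \<noteq> w" "{u, w} \<notin> edges T"
  shows "cap (X u) \<inter> cap (X w) = {}"
  using nonadjacent_strict[OF assms] by (intro disjoint_capsI X_unit') auto

text \<open>A point outside the interiors of all disks but one can be moved out of these disks.\<close>

lemma exterior_point:
  assumes p: "norm p = 1" and le: "\<And>w. w \<noteq> v \<Longrightarrow> c w \<bullet> p \<le> k w"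
  shows "\<exists>q. norm q = 1 \<and> (\<forall>w. w \<noteq> v \<longrightarrow> c w \<bullet> q < k w)"
proof (cases "null p - {v} = {}")
  case True
  have "c w \<bullet> p < k w" if "w \<noteq> v" for w
  proof -
    have "w \<notin> null p" using True that by blast
    then show ?thesis using strict_or_degenerate[OF p le[OF that]] no_degenerate[of w] by auto
  qed
  then show ?thesis using p by blast
next
  case False
  then obtain a b d where abd: "a \<in> null p - {v}" "b \<in> null p - {v}" "d \<in> null p - {v}"
    "null p - {v} \<subseteq> {a, b, d}" "b = a \<or> {a, b} \<in> edges T" "d = a \<or> (d \<noteq> a \<and> {a, d} \<notin> edges T)"
    using null_structure[OF p, of "null p - {v}"] by (metis Diff_subset)
  have "d = a"
  proof (rule ccontr)
    assume da: "d \<noteq> a"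
    then have ad: "a \<noteq> d" "{a, d} \<notin> edges T" using abd(6) by auto
    have "mink (X a) (X d) = - 1"
      using null_nonadjacent_sum[OF p, of a d] abd(1,3) ad by blast
    then show False using nonadjacent_strict(1)[OF ad] by simp
  qed
  then have sub: "null p - {v} \<subseteq> {a, b}" using abd(4) by blast
  have ab: "a \<in> null p" "b \<in> null p" "a \<noteq> v" using abd by auto
  have null: "c w \<bullet> p = k w" if "w \<in> null p" for w
    using that rho_pos[of w] by (simp add: null_def mink_X_point)
  obtain f0 :: "real ^ 3" where f0: "norm f0 = 1" "f0 \<bullet> c a = 0" "f0 \<bullet> p = 0"
    using exists_unit_normal[of "c a" p] .
  define f where "f = (if c b \<bullet> f0 < 0 then f0 else - f0)"
  have f: "norm f = 1" "f \<bullet> c a = 0" "f \<bullet> p = 0" using f0 by (auto simp: f_def)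
  have fb: "c b \<bullet> f < 0" if "b \<noteq> a"
  proof -
    have "c b \<bullet> f0 \<noteq> 0" using null_edge_transversal[OF p ab(1,2) _ f0] abd(5) that by blast
    then show ?thesis by (auto simp: f_def)
  qed
  have cases: "c w \<bullet> p < k w \<or> (c w = p \<and> k w = 1) \<or> (c w \<bullet> p = k w \<and> c w \<bullet> f < 0)"
    if w: "w \<noteq> a" "w \<noteq> v" for w
  proof (cases "w \<in> null p")
    case True
    then have "w = b" using sub w by blast
    then show ?thesis using fb w null[OF True] by simp
  next
    case False
    then show ?thesis using strict_or_degenerate[OF p le[OF w(2)]] by blast
  qed
  have "\<exists>y. norm y = 1 \<and> c a \<bullet> y = k a \<and> (\<forall>w\<in>UNIV - {a, v}. c w \<bullet> y < k w)"
    by (rule leave_along_circle[of "UNIV - {a, v}" p "c a" "k a" f])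
      (use p norm_c null[OF ab(1)] no_degenerate f cases in auto)
  then obtain y where y: "norm y = 1" "c a \<bullet> y = k a" "\<And>w. w \<noteq> a \<Longrightarrow> w \<noteq> v \<Longrightarrow> c w \<bullet> y < k w" by blast
  let ?O = "\<Inter>w\<in>UNIV - {a, v}. {q. c w \<bullet> q < k w * norm q}"
  have "open ?O" by (intro open_INT ballI open_Collect_less continuous_intros) simp
  moreover have "y \<in> ?O" using y by simp
  ultimately obtain \<delta> where \<delta>: "\<delta> > 0" "ball y \<delta> \<subseteq> ?O" by (meson open_contains_ball)
  obtain q where q: "dist y q < \<delta>" "c a \<bullet> q < k a * norm q"
    using exterior_point_near[OF norm_c y(1) _ no_degenerate \<delta>(1), of a a] y(2) by auto
  have all: "c w \<bullet> q < k w * norm q" if "w \<noteq> v" for w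
    using \<delta>(2) q that by (cases "w = a") auto
  have "q \<noteq> 0" using q(2) by auto
  then have nq: "norm q > 0" by simp
  have "c w \<bullet> (q /\<^sub>R norm q) < k w" if "w \<noteq> v" for w
    using all[OF that] nq by (simp add: field_simps)
  moreover have "norm (q /\<^sub>R norm q) = 1" using nq by simp
  ultimately show ?thesis by blast
qed

end

section \<open>Normalization by affine maps\<close>

text \<open>
  The Lorentz transformation induced by the affine map \<open>z \<mapsto> m z + b\<close> with \<open>m > 0\<close>. In terms of the
  null coordinates \<open>N = snd x - fst x $ 3\<close> and \<open>P = snd x + fst x $ 3\<close>, the point \<open>z\<close> has the null vector
  with first components \<open>2 z\<close>, \<open>N = 2\<close> and \<open>P = 2 |z|^2\<close>, up to a positive factor.
\<close>

definition boost :: "real \<Rightarrow> complex \<Rightarrow> (real ^ 3) \<times> real \<Rightarrow> (real ^ 3) \<times> real" where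
  "boost m b x =
     (let u = fst x $ 1; v = fst x $ 2; N = snd x - fst x $ 3; P = snd x + fst x $ 3;
          N' = N / m; P' = m * P + 2 * (Re b * u + Im b * v) + (cmod b)\<^sup>2 * N / m
      in (vector [u + Re b * N / m, v + Im b * N / m, (P' - N') / 2], (P' + N') / 2))"

lemma mink_null_coordinates:
  "mink x y = fst x $ 1 * fst y $ 1 + fst x $ 2 * fst y $ 2
     - ((snd x - fst x $ 3) * (snd y + fst y $ 3) + (snd x + fst x $ 3) * (snd y - fst y $ 3)) / 2"
  by (simp add: mink_def inner_real3 field_simps)

lemma boost_coordinates:
  "fst (boost m b x) $ 1 = fst x $ 1 + Re b * (snd x - fst x $ 3) / m"
  "fst (boost m b x) $ 2 = fst x $ 2 + Im b * (snd x - fst x $ 3) / m"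
  "snd (boost m b x) - fst (boost m b x) $ 3 = (snd x - fst x $ 3) / m"
  "snd (boost m b x) + fst (boost m b x) $ 3 = m * (snd x + fst x $ 3)
     + 2 * (Re b * fst x $ 1 + Im b * fst x $ 2) + (cmod b)\<^sup>2 * (snd x - fst x $ 3) / m"
proof -
  have "(P + N) / 2 - (P - N) / 2 = N" "(P + N) / 2 + (P - N) / 2 = P" for P N :: real
    by (simp_all add: field_simps)
  note half = this
  show "fst (boost m b x) $ 1 = fst x $ 1 + Re b * (snd x - fst x $ 3) / m"
    "fst (boost m b x) $ 2 = fst x $ 2 + Im b * (snd x - fst x $ 3) / m"
    "snd (boost m b x) - fst (boost m b x) $ 3 = (snd x - fst x $ 3) / m"
    "snd (boost m b x) + fst (boost m b x) $ 3 = m * (snd x + fst x $ 3)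
     + 2 * (Re b * fst x $ 1 + Im b * fst x $ 2) + (cmod b)\<^sup>2 * (snd x - fst x $ 3) / m"
    by (simp_all only: boost_def Let_def fst_conv snd_conv half vector_3)
qed

lemma null_coordinates_eqI:
  fixes x y :: "(real ^ 3) \<times> real"
  assumes "fst x $ 1 = fst y $ 1" "fst x $ 2 = fst y $ 2"
    "snd x - fst x $ 3 = snd y - fst y $ 3" "snd x + fst x $ 3 = snd y + fst y $ 3"
  shows "x = y"
  using assms by (simp add: prod_eq_iff vec_eq_iff forall_3)

lemma mink_boost:
  assumes "m > 0"
  shows "mink (boost m b x) (boost m b y) = mink x y"
  unfolding mink_null_coordinates boost_coordinates cmod_power2 using assms
  by (simp add: field_simps power2_eq_square)

lemma boost_scaleR: "boost m b (a *\<^sub>R x) = a *\<^sub>R boost m b x"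
proof (rule null_coordinates_eqI)
  note scale = fst_scaleR snd_scaleR vector_scaleR_component real_scaleR_def
  note dist = right_diff_distrib[symmetric] distrib_left[symmetric]
  show "fst (boost m b (a *\<^sub>R x)) $ 1 = fst (a *\<^sub>R boost m b x) $ 1"
    "fst (boost m b (a *\<^sub>R x)) $ 2 = fst (a *\<^sub>R boost m b x) $ 2"
    unfolding scale boost_coordinates dist by (simp_all add: distrib_left mult.left_commute)
  show "snd (boost m b (a *\<^sub>R x)) - fst (boost m b (a *\<^sub>R x)) $ 3
      = snd (a *\<^sub>R boost m b x) - fst (a *\<^sub>R boost m b x) $ 3"
    unfolding boost_coordinates scale dist by simp
  show "snd (boost m b (a *\<^sub>R x)) + fst (boost m b (a *\<^sub>R x)) $ 3
      = snd (a *\<^sub>R boost m b x) + fst (a *\<^sub>R boost m b x) $ 3"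
    unfolding boost_coordinates scale dist by (simp add: distrib_left mult.left_commute)
qed

text \<open>The boost is the action on the light cone of the affine map \<open>z \<mapsto> m z + b\<close>.\<close>

lemma boost_stereo:
  assumes m: "m > 0"
  shows "\<exists>a>0. boost m b (stereo q, 1) = a *\<^sub>R (stereo (linear_fractional (of_real m) b 0 1 q), 1)"
proof (cases q)
  case Infinity
  have "boost m b (axis 3 1, 1) = m *\<^sub>R (axis 3 1, 1)"
  proof (rule null_coordinates_eqI)
    show "fst (boost m b (axis 3 1, 1)) $ 1 = fst (m *\<^sub>R (axis 3 1 :: real ^ 3, 1 :: real)) $ 1"
      "fst (boost m b (axis 3 1, 1)) $ 2 = fst (m *\<^sub>R (axis 3 1 :: real ^ 3, 1 :: real)) $ 2"
      "snd (boost m b (axis 3 1, 1)) - fst (boost m b (axis 3 1, 1)) $ 3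
        = snd (m *\<^sub>R (axis 3 1 :: real ^ 3, 1 :: real)) - fst (m *\<^sub>R (axis 3 1 :: real ^ 3, 1 :: real)) $ 3"
      "snd (boost m b (axis 3 1, 1)) + fst (boost m b (axis 3 1, 1)) $ 3
        = snd (m *\<^sub>R (axis 3 1 :: real ^ 3, 1 :: real)) + fst (m *\<^sub>R (axis 3 1 :: real ^ 3, 1 :: real)) $ 3"
      unfolding boost_coordinates by (simp_all add: axis_def)
  qed
  then show ?thesis using m Infinity by (auto simp: stereo_Infinity_eq)
next
  case (Finite z)
  let ?w = "of_real m * z + b"
  let ?L = "\<lambda>z. (1 + (cmod z)\<^sup>2) *\<^sub>R (stereo (Finite z), 1 :: real)"
  have L: "fst (?L z) $ 1 = 2 * Re z" "fst (?L z) $ 2 = 2 * Im z" "snd (?L z) - fst (?L z) $ 3 = 2"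
    "snd (?L z) + fst (?L z) $ 3 = 2 * (cmod z)\<^sup>2" for z
    using one_plus_cmod_pos[of z] by (simp_all add: stereo_Finite_nth)
  have eq: "boost m b (?L z) = (1 / m) *\<^sub>R ?L ?w"
  proof (rule null_coordinates_eqI)
    note scale = fst_scaleR[of "1 / m"] snd_scaleR[of "1 / m"] vector_scaleR_component[of "1 / m"]
      real_scaleR_def[of "1 / m"]
    note dist = right_diff_distrib[symmetric] distrib_left[symmetric]
    show "fst (boost m b (?L z)) $ 1 = fst ((1 / m) *\<^sub>R ?L ?w) $ 1"
      "fst (boost m b (?L z)) $ 2 = fst ((1 / m) *\<^sub>R ?L ?w) $ 2"
      unfolding scale boost_coordinates L using m by (simp_all add: field_simps)
    show "snd (boost m b (?L z)) - fst (boost m b (?L z)) $ 3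
      = snd ((1 / m) *\<^sub>R ?L ?w) - fst ((1 / m) *\<^sub>R ?L ?w) $ 3"
      unfolding boost_coordinates scale dist L by simp
    show "snd (boost m b (?L z)) + fst (boost m b (?L z)) $ 3
      = snd ((1 / m) *\<^sub>R ?L ?w) + fst ((1 / m) *\<^sub>R ?L ?w) $ 3"
      unfolding boost_coordinates scale dist L unfolding cmod_power2 using m
      by (simp add: field_simps power2_eq_square)
  qed
  let ?a = "1 + (cmod z)\<^sup>2" and ?b = "1 + (cmod ?w)\<^sup>2"
  have pos: "?a > 0" "?b > 0" by (rule one_plus_cmod_pos)+
  have "?a *\<^sub>R boost m b (stereo (Finite z), 1) = ((1 / m) * ?b) *\<^sub>R (stereo (Finite ?w), 1)"
    using eq unfolding boost_scaleR by (simp only: scaleR_scaleR)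
  then have "(1 / ?a) *\<^sub>R (?a *\<^sub>R boost m b (stereo (Finite z), 1))
     = (1 / ?a * ((1 / m) * ?b)) *\<^sub>R (stereo (Finite ?w), 1)" by (simp only: scaleR_scaleR)
  then have "boost m b (stereo (Finite z), 1) = (1 / ?a * ((1 / m) * ?b)) *\<^sub>R (stereo (Finite ?w), 1)"
    unfolding scaleR_scaleR using pos by simp
  moreover have "1 / ?a * ((1 / m) * ?b) > 0" using pos m by simp
  ultimately show ?thesis using Finite by auto
qed

lemma boost_cap:
  assumes m: "m > 0"
  shows "stereo (linear_fractional (of_real m) b 0 1 q) \<in> cap (boost m b x) \<longleftrightarrow> stereo q \<in> cap x"
proof -
  obtain a where a: "a > 0"
    "boost m b (stereo q, 1) = a *\<^sub>R (stereo (linear_fractional (of_real m) b 0 1 q), 1)"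
    using boost_stereo[OF m] by blast
  have "mink x (stereo q, 1) = mink (boost m b x) (boost m b (stereo q, 1))" by (simp only: mink_boost[OF m])
  also have "\<dots> = a * mink (boost m b x) (stereo (linear_fractional (of_real m) b 0 1 q), 1)"
    unfolding a by (simp only: mink_scaleR_right)
  finally show ?thesis using a(1) by (simp add: mem_cap zero_le_mult_iff)
qed

lemma affine_surj:
  assumes m: "m > 0"
  shows "\<exists>p. linear_fractional (of_real m) b 0 1 p = q"
proof (cases q)
  case (Finite w)
  have "linear_fractional (of_real m) b 0 1 (Finite ((w - b) / of_real m)) = Finite w"
    using m by simp
  then show ?thesis using Finite by blast
next
  case Infinity
  then show ?thesis by (intro exI[of _ Infinity]) simp
qed

lemma boost_image:
  assumes m: "m > 0"
  shows "linear_fractional (of_real m) b 0 1 ` (stereo -` cap x) = stereo -` cap (boost m b x)"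
proof (intro equalityI subsetI)
  fix q assume "q \<in> linear_fractional (of_real m) b 0 1 ` (stereo -` cap x)"
  then obtain p where p: "q = linear_fractional (of_real m) b 0 1 p" "stereo p \<in> cap x" by auto
  then show "q \<in> stereo -` cap (boost m b x)" using boost_cap[OF m, of b p x] by simp
next
  fix q assume q: "q \<in> stereo -` cap (boost m b x)"
  obtain p where p: "linear_fractional (of_real m) b 0 1 p = q" using affine_surj[OF m] by blast
  then have "p \<in> stereo -` cap x" using q boost_cap[OF m, of b p x] by simp
  then show "q \<in> linear_fractional (of_real m) b 0 1 ` (stereo -` cap x)" using p by blast
qed

lemma realizes_boost:
  assumes m: "m > 0" and x: "realizes T \<Theta> x"
  shows "realizes T \<Theta> (\<lambda>v. boost m b (x v))"
proof -
  have "(\<exists>q. q \<in> cap (boost m b u) \<and> q \<in> cap (boost m b w)) \<longleftrightarrow> (\<exists>q. q \<in> cap u \<and> q \<in> cap w)" for u w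
  proof
    assume "\<exists>q. q \<in> cap (boost m b u) \<and> q \<in> cap (boost m b w)"
    then obtain q where q: "q \<in> cap (boost m b u)" "q \<in> cap (boost m b w)" by blast
    then obtain q' where q': "q = stereo q'" using stereo_surj[of q] by (auto simp: mem_cap)
    obtain p where "linear_fractional (of_real m) b 0 1 p = q'" using affine_surj[OF m] by blast
    then have "stereo p \<in> cap u" "stereo p \<in> cap w"
      using q boost_cap[OF m, of b p u] boost_cap[OF m, of b p w] by (simp_all add: q')
    then show "\<exists>q. q \<in> cap u \<and> q \<in> cap w" by blast
  next
    assume "\<exists>q. q \<in> cap u \<and> q \<in> cap w"
    then obtain q where q: "q \<in> cap u" "q \<in> cap w" by blast
    then obtain q' where "q = stereo q'" using stereo_surj[of q] by (auto simp: mem_cap)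
    then show "\<exists>q. q \<in> cap (boost m b u) \<and> q \<in> cap (boost m b w)"
      using q boost_cap[OF m, of b q' u] boost_cap[OF m, of b q' w] by blast
  qed
  then have "cap (boost m b u) \<inter> cap (boost m b w) = {} \<longleftrightarrow> cap u \<inter> cap w = {}" for u w by blast
  then show ?thesis using x unfolding realizes_def mink_boost[OF m] by simp
qed

text \<open>
  The timelike vector orthogonal to the three caps of a face is moved to \<open>(0, 1)\<close>, so that the
  three circles become great circles.
\<close>

lemma normalizing_boost:
  assumes pd: "posdef3 x y z"
  obtains m b where "m > 0" "snd (boost m b x) = 0" "snd (boost m b y) = 0" "snd (boost m b z) = 0"
proof -
  obtain e where e: "e \<noteq> 0" "mink x e = 0" "mink y e = 0" "mink z e = 0"
    by (rule exists_mink_orthogonal)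
  have neg: "mink e e < 0" by (rule posdef3_orthogonal_basis(1)[OF pd e(2-4) e(1)])
  let ?N = "\<lambda>e :: (real ^ 3) \<times> real. snd e - fst e $ 3"
  have N0: "?N e \<noteq> 0"
    using timelike_not_orthogonal_sphere(4)[OF neg, of "axis 3 1"] by (simp add: mink_def inner_axis)
  define s where "s = (if ?N e > 0 then 1 else - 1) / sqrt (- mink e e)"
  define e' where "e' = s *\<^sub>R e"
  have s0: "s \<noteq> 0" using neg by (simp add: s_def)
  have "s * s = 1 / - mink e e" using neg by (simp add: s_def)
  then have e'e': "mink e' e' = - 1" using neg by (simp add: e'_def mink_linear field_simps)
  have "?N e' = s * ?N e" by (simp add: e'_def algebra_simps)
  moreover have "s * ?N e > 0" using N0 neg by (auto simp: s_def zero_less_mult_iff)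
  ultimately have N: "?N e' > 0" by simp
  define m where "m = ?N e'"
  define b where "b = - Complex (fst e' $ 1) (fst e' $ 2)"
  have m: "m > 0" using N by (simp add: m_def)
  have be: "boost m b e' = (0, 1)"
  proof (rule null_coordinates_eqI)
    have nm: "?N e' / m = 1" using m by (simp add: m_def)
    show "fst (boost m b e') $ 1 = fst (0 :: real ^ 3, 1 :: real) $ 1"
      "fst (boost m b e') $ 2 = fst (0 :: real ^ 3, 1 :: real) $ 2"
      "?N (boost m b e') = ?N (0, 1)"
      unfolding boost_coordinates using nm m by (simp_all add: b_def m_def)
    have "m * (snd e' + fst e' $ 3) = 1 + (fst e' $ 1)\<^sup>2 + (fst e' $ 2)\<^sup>2"
      using e'e' by (simp add: mink_null_coordinates m_def power2_eq_square algebra_simps)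
    moreover have "Re b = - (fst e' $ 1)" "Im b = - (fst e' $ 2)" by (simp_all add: b_def)
    moreover have "(cmod b)\<^sup>2 = (fst e' $ 1)\<^sup>2 + (fst e' $ 2)\<^sup>2" by (simp add: b_def cmod_power2)
    ultimately show "snd (boost m b e') + fst (boost m b e') $ 3 = snd (0 :: real ^ 3, 1 :: real) + fst (0 :: real ^ 3, 1 :: real) $ 3"
      unfolding boost_coordinates times_divide_eq_right[symmetric] nm
      by (simp flip: power2_eq_square)
  qed
  have "snd (boost m b v) = 0" if "mink v e = 0" for v
  proof -
    have "mink v e' = 0" using that by (simp add: e'_def mink_linear)
    then have "mink (boost m b v) (boost m b e') = 0" by (simp add: mink_boost[OF m])
    then show ?thesis unfolding be by (simp add: mink_def)
  qed
  then show thesis using that m e by blast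
qed

section \<open>Convergent sequences of patterns\<close>

lemma finite_family_convergent_subsequence:
  fixes f :: "'i \<Rightarrow> nat \<Rightarrow> 'a::heine_borel"
  assumes "finite I" "\<And>i. i \<in> I \<Longrightarrow> bounded (range (f i))"
  shows "\<exists>r l. strict_mono (r :: nat \<Rightarrow> nat) \<and> (\<forall>i\<in>I. (\<lambda>n. f i (r n)) \<longlonglongrightarrow> l i)"
  using assms
proof (induction I rule: finite_induct)
  case empty
  show ?case by (rule exI[of _ id]) (simp add: strict_mono_def)
next
  case (insert j I)
  then obtain r l where r: "strict_mono (r :: nat \<Rightarrow> nat)" "\<And>i. i \<in> I \<Longrightarrow> (\<lambda>n. f i (r n)) \<longlonglongrightarrow> l i"
    by auto
  have "bounded (range (f j \<circ> r))" by (rule bounded_subset[OF insert.prems[of j]]) auto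
  then obtain m s where s: "strict_mono (s :: nat \<Rightarrow> nat)" "((f j \<circ> r) \<circ> s) \<longlonglongrightarrow> m"
    using bounded_imp_convergent_subsequence by blast
  have "(\<lambda>n. f i ((r \<circ> s) n)) \<longlonglongrightarrow> (l(j := m)) i" if "i \<in> insert j I" for i
  proof (cases "i = j")
    case True
    then show ?thesis using s(2) by (simp add: o_def)
  next
    case False
    then have "(\<lambda>n. f i (r n)) \<longlonglongrightarrow> l i" using that r(2) by blast
    from LIMSEQ_subseq_LIMSEQ[OF this s(1)] show ?thesis using False by (simp add: o_def)
  qed
  then show ?case using strict_mono_o[OF r(1) s(1)] by blast
qed

lemma center_diff_height:
  assumes x: "mink x x = 1" and y: "mink y y = 1"
  shows "center x \<bullet> center y - height x * height y
    = mink x y * (sqrt (1 - (height x)\<^sup>2) * sqrt (1 - (height y)\<^sup>2))"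
proof -
  note ux = unit_center_height[OF x] and uy = unit_center_height[OF y]
  define a where "a = sqrt (1 - (height x)\<^sup>2)"
  define b where "b = sqrt (1 - (height y)\<^sup>2)"
  have pos: "a > 0" "b > 0" using ux(2) uy(2) by (simp_all add: a_def b_def abs_square_less_1)
  have "mink x y = mink ((1 / a) *\<^sub>R (center x, height x)) ((1 / b) *\<^sub>R (center y, height y))"
    using ux(4) uy(4) by (simp only: a_def b_def)
  also have "\<dots> = (1 / a) * ((1 / b) * (center x \<bullet> center y - height x * height y))"
    unfolding mink_scaleR_left mink_scaleR_right by (simp add: mink_def)
  finally show ?thesis using pos unfolding a_def[symmetric] b_def[symmetric] by simp
qed

text \<open>
  The covering property of the limit: near a point exterior to all limit disks but two, and outside the
  interiors of these, only the disks of \<open>u\<close> and \<open>w\<close> are left to cover a small ball. They are equal or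
  disjoint, so one of them contains the ball, but each of the two limit disks misses a point of it.
\<close>

lemma limit_caps_of_sequence:
  fixes T :: "'v::finite set set" and x :: "nat \<Rightarrow> 'v \<Rightarrow> (real ^ 3) \<times> real"
  assumes T: "sphere_triangulation T" and card: "CARD('v) > 4"
    and \<Theta>n: "\<And>n. \<Theta> n \<in> angle_space T" and \<Theta>': "\<Theta>' \<in> angle_space T"
    and lim_\<Theta>: "\<And>e. e \<in> edges T \<Longrightarrow> (\<lambda>n. \<Theta> n e) \<longlonglongrightarrow> \<Theta>' e"
    and x: "\<And>n. realizes T (\<Theta> n) (x n)"
    and irr: "\<And>n v. \<exists>q. norm q = 1 \<and> (\<forall>w. w \<noteq> v \<longrightarrow> q \<notin> cap (x n w))"
    and t0: "t0 \<in> T" "\<And>n v. v \<in> t0 \<Longrightarrow> snd (x n v) = 0"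
    and lim_c: "\<And>v. (\<lambda>n. center (x n v)) \<longlonglongrightarrow> c v"
    and lim_k: "\<And>v. (\<lambda>n. height (x n v)) \<longlonglongrightarrow> k v"
  shows "limit_caps T \<Theta>' c k"
proof
  have unit: "mink (x n v) (x n v) = 1" for n v using x by (simp add: realizes_def)
  note u = unit_center_height[OF unit]
  have disj: "cap (x n u) \<inter> cap (x n w) = {}" if "u \<noteq> w" "{u, w} \<notin> edges T" for n u w
    using x[of n] that unfolding realizes_def by metis
  show "sphere_triangulation T" "4 < CARD('v)" "\<Theta>' \<in> angle_space T" by fact+
  show norm_c: "norm (c v) = 1" for v
  proof -
    have "(\<lambda>n. norm (center (x n v))) \<longlonglongrightarrow> norm (c v)" using lim_c by (rule tendsto_norm)
    then show ?thesis using u(1) by (simp add: LIMSEQ_const_iff)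
  qed
  show "\<bar>k v\<bar> \<le> 1" for v
  proof (rule tendsto_upperbound)
    show "(\<lambda>n. \<bar>height (x n v)\<bar>) \<longlonglongrightarrow> \<bar>k v\<bar>" using lim_k by (rule tendsto_rabs)
  qed (simp_all add: less_imp_le[OF u(2)])
  have lim_root: "(\<lambda>n. sqrt (1 - (height (x n v))\<^sup>2)) \<longlonglongrightarrow> sqrt (1 - (k v)\<^sup>2)" for v
    by (intro tendsto_intros lim_k)
  have lim_ck: "(\<lambda>n. center (x n u) \<bullet> center (x n w) - height (x n u) * height (x n w))
      \<longlonglongrightarrow> c u \<bullet> c w - k u * k w" for u w
    by (intro tendsto_intros lim_k lim_c)
  show "c u \<bullet> c w - k u * k w = - cos (\<Theta>' {u, w}) * (sqrt (1 - (k u)\<^sup>2) * sqrt (1 - (k w)\<^sup>2))"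
    if e: "{u, w} \<in> edges T" for u w
  proof (rule LIMSEQ_unique[OF lim_ck])
    have "center (x n u) \<bullet> center (x n w) - height (x n u) * height (x n w) = - cos (\<Theta> n {u, w}) *
      (sqrt (1 - (height (x n u))\<^sup>2) * sqrt (1 - (height (x n w))\<^sup>2))" for n
      using x[of n] e center_diff_height[OF unit unit] by (simp add: realizes_def)
    moreover have "(\<lambda>n. - cos (\<Theta> n {u, w}) * (sqrt (1 - (height (x n u))\<^sup>2) * sqrt (1 - (height (x n w))\<^sup>2)))
      \<longlonglongrightarrow> - cos (\<Theta>' {u, w}) * (sqrt (1 - (k u)\<^sup>2) * sqrt (1 - (k w)\<^sup>2))"
      by (intro tendsto_intros lim_root lim_\<Theta> e)
    ultimately show "(\<lambda>n. center (x n u) \<bullet> center (x n w) - height (x n u) * height (x n w))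
      \<longlonglongrightarrow> - cos (\<Theta>' {u, w}) * (sqrt (1 - (k u)\<^sup>2) * sqrt (1 - (k w)\<^sup>2))" by simp
  qed
  have disj': "center (x n u) \<bullet> center (x n w) - height (x n u) * height (x n w)
      \<le> - (sqrt (1 - (height (x n u))\<^sup>2) * sqrt (1 - (height (x n w))\<^sup>2))"
    "0 \<le> height (x n u) * sqrt (1 - (height (x n w))\<^sup>2) + height (x n w) * sqrt (1 - (height (x n u))\<^sup>2)"
    if n: "u \<noteq> w" "{u, w} \<notin> edges T" for n u w
  proof -
    have f: False if "norm q = 1" "height (x n u) \<le> center (x n u) \<bullet> q" "height (x n w) \<le> center (x n w) \<bullet> q" for q
      using disj[OF n, of n] mem_cap_center[OF unit, of q n u] mem_cap_center[OF unit, of q n w] that by auto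
    have "center (x n u) \<bullet> center (x n w) < height (x n u) * height (x n w)
        - sqrt (1 - (height (x n u))\<^sup>2) * sqrt (1 - (height (x n w))\<^sup>2)"
      by (rule round_caps_disjoint(1)[OF u(1) u(1) u(2) u(2)]) (rule f)
    moreover have "height (x n u) * sqrt (1 - (height (x n w))\<^sup>2) + height (x n w) * sqrt (1 - (height (x n u))\<^sup>2) > 0"
      by (rule round_caps_disjoint(2)[OF u(1) u(1) u(2) u(2)]) (rule f)
    ultimately show "center (x n u) \<bullet> center (x n w) - height (x n u) * height (x n w)
      \<le> - (sqrt (1 - (height (x n u))\<^sup>2) * sqrt (1 - (height (x n w))\<^sup>2))"
    "0 \<le> height (x n u) * sqrt (1 - (height (x n w))\<^sup>2) + height (x n w) * sqrt (1 - (height (x n u))\<^sup>2)"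
      by simp_all
  qed
  show "c u \<bullet> c w - k u * k w \<le> - (sqrt (1 - (k u)\<^sup>2) * sqrt (1 - (k w)\<^sup>2))"
    if n: "u \<noteq> w" "{u, w} \<notin> edges T" for u w
  proof (rule tendsto_le[OF _ _ lim_ck])
    show "(\<lambda>n. - (sqrt (1 - (height (x n u))\<^sup>2) * sqrt (1 - (height (x n w))\<^sup>2)))
      \<longlonglongrightarrow> - (sqrt (1 - (k u)\<^sup>2) * sqrt (1 - (k w)\<^sup>2))"
      by (intro tendsto_intros lim_root)
  qed (use disj'(1)[OF n] in auto)
  show "0 \<le> k u * sqrt (1 - (k w)\<^sup>2) + k w * sqrt (1 - (k u)\<^sup>2)"
    if n: "u \<noteq> w" "{u, w} \<notin> edges T" for u w
  proof (rule tendsto_lowerbound)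
    show "(\<lambda>n. height (x n u) * sqrt (1 - (height (x n w))\<^sup>2) + height (x n w) * sqrt (1 - (height (x n u))\<^sup>2))
      \<longlonglongrightarrow> k u * sqrt (1 - (k w)\<^sup>2) + k w * sqrt (1 - (k u)\<^sup>2)"
      by (intro tendsto_intros lim_root lim_k)
  qed (use disj'(2)[OF n] in auto)
  show "\<exists>t\<in>T. \<forall>v\<in>t. \<bar>k v\<bar> < 1"
  proof (intro bexI[OF _ t0(1)] ballI)
    fix v assume "v \<in> t0"
    then have "height (x n v) = 0" for n using t0(2) by (simp add: height_def)
    then have "k v = 0" using lim_k[of v] by (simp add: LIMSEQ_const_iff)
    then show "\<bar>k v\<bar> < 1" by simp
  qed
  show "\<Union>S = UNIV" if S: "S \<subseteq> T" "S \<noteq> {}"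
    and closed: "\<And>t u w. t \<in> S \<Longrightarrow> u \<in> t \<Longrightarrow> w \<in> t \<Longrightarrow> u \<noteq> w \<Longrightarrow> \<exists>t'\<in>S. t' \<noteq> t \<and> u \<in> t' \<and> w \<in> t'" for S
  proof (rule ccontr)
    assume "\<Union>S \<noteq> UNIV"
    then obtain v where v: "v \<notin> \<Union>S" by blast
    obtain q where q: "norm q = 1" "\<And>w. w \<noteq> v \<Longrightarrow> q \<notin> cap (x 0 w)" using irr[of v 0] by blast
    have "\<exists>w\<in>\<Union>S. q \<in> cap (x 0 w)"
      by (rule caps_cover_sphere[OF T card \<Theta>n x S closed q(1)])
    then show False using q(2) v by metis
  qed
  have cover: "\<exists>v. p \<in> cap (x n v)" if "norm p = 1" for p n
  proof -
    have "\<exists>v\<in>\<Union>T. p \<in> cap (x n v)"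
      by (rule caps_cover_sphere[OF T card \<Theta>n x order_refl _ _ that])
        (use t0(1) edge_in_two_faces[OF T] in blast)+
    then show ?thesis by blast
  qed
  show False
    if y: "norm y = 1" and uw: "u = w \<or> {u, w} \<notin> edges T" and ku: "\<bar>k u\<bar> < 1" "\<bar>k w\<bar> < 1"
      and le: "c u \<bullet> y \<le> k u" "c w \<bullet> y \<le> k w"
      and strict: "\<And>v. v \<noteq> u \<Longrightarrow> v \<noteq> w \<Longrightarrow> c v \<bullet> y < k v" for y u w
  proof -
    \<comment> \<open>homogeneous of degree one, and nonnegative exactly on the cone over the cap\<close>
    define g where "g = (\<lambda>n v q. center (x n v) \<bullet> q - height (x n v) * norm q)"
    have g_cap: "g n v q \<ge> 0 \<longleftrightarrow> q /\<^sub>R norm q \<in> cap (x n v)" if "q \<noteq> 0" for n v q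
      using that by (simp add: g_def mem_cap_center[OF unit] field_simps)
    have g_lim: "((\<lambda>z. g (fst z) v (snd z)) \<longlongrightarrow> c v \<bullet> y - k v * norm y) (sequentially \<times>\<^sub>F nhds y)" for v
      unfolding g_def
      by (intro tendsto_intros filterlim_compose[OF lim_c filterlim_fst] filterlim_compose[OF lim_k filterlim_fst]
          filterlim_snd)
    have "\<forall>\<^sub>F z in sequentially \<times>\<^sub>F nhds y. g (fst z) v (snd z) < 0" if "v \<in> UNIV - {u, w}" for v
      using order_tendstoD(2)[OF g_lim, of v 0] strict[of v] that y by auto
    then have "\<forall>\<^sub>F z in sequentially \<times>\<^sub>F nhds y. \<forall>v\<in>UNIV - {u, w}. g (fst z) v (snd z) < 0"
      by (intro eventually_ball_finite) auto
    then obtain Pf Pg where P: "eventually Pf sequentially" "eventually Pg (nhds y)"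
      "\<And>n q. Pf n \<Longrightarrow> Pg q \<Longrightarrow> \<forall>v\<in>UNIV - {u, w}. g n v q < 0"
      unfolding eventually_prod_filter by auto
    obtain d where d: "d > 0" "\<And>q. dist q y < d \<Longrightarrow> Pg q"
      using P(2) unfolding eventually_nhds_metric by blast
    define \<delta> where "\<delta> = min d 1"
    have \<delta>: "\<delta> > 0" using d by (simp add: \<delta>_def)
    have ball: "q \<noteq> 0" "Pg q" if "q \<in> ball y \<delta>" for q
      using that d(2) y by (auto simp: \<delta>_def dist_commute)
    obtain q1 where q1: "dist y q1 < \<delta>" "c u \<bullet> q1 < k u * norm q1"
      using exterior_point_near[OF norm_c y le(1) ku(1) \<delta>] .
    obtain q2 where q2: "dist y q2 < \<delta>" "c w \<bullet> q2 < k w * norm q2"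
      using exterior_point_near[OF norm_c y le(2) ku(2) \<delta>] .
    have ev: "\<forall>\<^sub>F n in sequentially. g n v q < 0" if "c v \<bullet> q < k v * norm q" for v q
    proof (rule order_tendstoD(2))
      show "(\<lambda>n. g n v q) \<longlonglongrightarrow> c v \<bullet> q - k v * norm q"
        unfolding g_def by (intro tendsto_intros lim_c lim_k)
    qed (use that in simp)
    obtain n where n: "Pf n" "g n u q1 < 0" "g n w q2 < 0"
      using eventually_conj[OF P(1) eventually_conj[OF ev[OF q1(2)] ev[OF q2(2)]]]
        eventually_happens' sequentially_bot by blast
    have cov: "g n u q \<ge> 0 \<or> g n w q \<ge> 0" if q: "q \<in> ball y \<delta>" for q
    proof -
      have "norm (q /\<^sub>R norm q) = 1" using ball(1)[OF q] by simp
      then obtain v where "q /\<^sub>R norm q \<in> cap (x n v)" using cover by blast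
      then have "g n v q \<ge> 0" using g_cap ball(1)[OF q] by blast
      then show ?thesis using P(3)[OF n(1) ball(2)[OF q]] by force
    qed
    let ?A = "{q. 0 \<le> g n u q}" and ?B = "{q. 0 \<le> g n w q}"
    have "u \<noteq> w" using cov[of q1] q1(1) n(2) by auto
    then have dis: "cap (x n u) \<inter> cap (x n w) = {}" using disj uw by blast
    have "?A \<inter> ball y \<delta> = {} \<or> ?B \<inter> ball y \<delta> = {}"
    proof (rule connected_closedD)
      show "connected (ball y \<delta>)" by simp
      show "closed ?A" "closed ?B"
        unfolding g_def by (intro closed_Collect_le continuous_intros)+
      show "ball y \<delta> \<subseteq> ?A \<union> ?B" using cov by blast
      show "?A \<inter> ?B \<inter> ball y \<delta> = {}" using g_cap ball(1) dis by blast
    qed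
    moreover have "q2 \<in> ?A" "q1 \<in> ?B" using cov[of q1] cov[of q2] n q1(1) q2(1) by auto
    ultimately show False using q1(1) q2(1) by auto
  qed
qed

section \<open>Circle patterns on the Riemann sphere\<close>

text \<open>The unit vector of the disk with spherical center \<open>z\<close> and spherical radius \<open>r\<close>.\<close>

definition disk_vector :: "riemann_sphere \<Rightarrow> real \<Rightarrow> (real ^ 3) \<times> real" where
  "disk_vector z r = (1 / sin r) *\<^sub>R (stereo z, cos r)"

lemma stereo_inner_bound: "\<bar>stereo z \<bullet> stereo w\<bar> \<le> 1"
  using Cauchy_Schwarz_ineq2[of "stereo z" "stereo w"] by simp

lemma sph_dist_le_iff:
  assumes "0 \<le> r" "r \<le> pi"
  shows "sph_dist z w \<le> r \<longleftrightarrow> cos r \<le> stereo z \<bullet> stereo w"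
proof -
  let ?a = "sph_dist z w"
  have a: "0 \<le> ?a" "?a \<le> pi" and ca: "cos ?a = stereo z \<bullet> stereo w"
    using stereo_inner_bound[of z w] by (auto simp: sph_dist_def arccos_bounded abs_le_iff cos_arccos_abs)
  show ?thesis
    using cos_mono_le_eq[of r ?a] a assms by (simp add: ca)
qed

lemma round_disk_vector:
  assumes "round_disk D z r"
  shows "mink (disk_vector z r) (disk_vector z r) = 1" "D = stereo -` cap (disk_vector z r)"
proof -
  have r: "0 < r" "r < pi" and D: "D = {x. sph_dist z x \<le> r}" using assms by (auto simp: round_disk_def)
  have s: "sin r > 0" using r by (rule sin_gt_zero)
  have "mink (disk_vector z r) (disk_vector z r) = (1 / sin r) * ((1 / sin r) * (stereo z \<bullet> stereo z - cos r * cos r))"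
    unfolding disk_vector_def mink_scaleR_left mink_scaleR_right by (simp add: mink_def)
  also have "stereo z \<bullet> stereo z = 1" by (simp add: norm_eq_1[symmetric])
  also have "1 - cos r * cos r = sin r * sin r"
    using sin_cos_squared_add[of r] by (simp add: power2_eq_square algebra_simps)
  finally show "mink (disk_vector z r) (disk_vector z r) = 1" using s by simp
  have "mink (disk_vector z r) (q, 1) = (1 / sin r) * (stereo z \<bullet> q - cos r)" for q
    unfolding disk_vector_def mink_scaleR_left by (simp add: mink_def)
  then show "D = stereo -` cap (disk_vector z r)"
    unfolding D using r s by (auto simp: mem_cap sph_dist_le_iff zero_le_divide_iff)
qed

lemma mink_disk_vector:
  "mink (disk_vector z r) (disk_vector z' r') = (stereo z \<bullet> stereo z' - cos r * cos r') / (sin r * sin r')"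
  unfolding disk_vector_def mink_scaleR_left mink_scaleR_right by (simp add: mink_def)

text \<open>
  Points of the circle bounding one disk are limits of exterior points, so they lie on the circle
  bounding the other disk; the circles have the same axis, on which the disks lie on the same side.
\<close>

lemma cap_injective:
  assumes x: "mink x x = 1" and y: "mink y y = 1" and eq: "cap x = cap y"
  shows "x = y"
proof -
  define c where "c = center x"
  define d where "d = center y"
  define k where "k = height x"
  define l where "l = height y"
  note ux = unit_center_height[OF x, folded c_def k_def] and uy = unit_center_height[OF y, folded d_def l_def]
  have mem: "k \<le> c \<bullet> q \<longleftrightarrow> l \<le> d \<bullet> q" if "norm q = 1" for q
    using mem_cap_center[OF x, of q] mem_cap_center[OF y, of q] that eq
    by (simp add: c_def d_def k_def l_def)
  have circle: "d \<bullet> q = l" if q: "norm q = 1" "c \<bullet> q = k" for q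
  proof (rule ccontr)
    assume "d \<bullet> q \<noteq> l"
    then have lt: "l * norm q < d \<bullet> q" using mem[OF q(1)] q by simp
    have "open {z. l * norm z < d \<bullet> z}" by (intro open_Collect_less continuous_intros)
    then obtain \<delta> where \<delta>: "\<delta> > 0" "ball q \<delta> \<subseteq> {z. l * norm z < d \<bullet> z}"
      by (rule openE[where x = q]) (use lt in simp_all)
    obtain z where z: "dist q z < \<delta>" "c \<bullet> z < k * norm z"
      by (rule exterior_point_near[of c q k \<delta>]) (use ux q \<delta> in auto)
    have lz: "l * norm z < d \<bullet> z" using z(1) \<delta>(2) by auto
    have "z \<noteq> 0" using z(2) by auto
    then have nz: "norm z > 0" by simp
    have "c \<bullet> (z /\<^sub>R norm z) < k" "l < d \<bullet> (z /\<^sub>R norm z)" using z(2) lz nz by (simp_all add: field_simps)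
    moreover have "norm (z /\<^sub>R norm z) = 1" using nz by simp
    ultimately show False using mem[of "z /\<^sub>R norm z"] by simp
  qed
  obtain e where e: "norm e = 1" "c \<bullet> e = 0" and de: "d = cos (arccos (c \<bullet> d)) *\<^sub>R c + sin (arccos (c \<bullet> d)) *\<^sub>R e"
    using orthonormal_companion[OF ux(1) uy(1)] .
  define a where "a = arccos (c \<bullet> d)"
  have cc: "c \<bullet> c = 1" "e \<bullet> e = 1" "e \<bullet> c = 0" using ux(1) e by (simp_all add: norm_eq_1 inner_commute)
  have k2: "k\<^sup>2 < 1" using ux(2) by (simp add: abs_square_less_1)
  define r where "r = sqrt (1 - k\<^sup>2)"
  have r: "r > 0" "r\<^sup>2 = 1 - k\<^sup>2" using k2 by (simp_all add: r_def)
  have dd: "d \<bullet> c = cos a" "d \<bullet> e = sin a"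
    by (subst de, simp add: a_def inner_add_left cc e)+
  have l: "k * cos a + s * sin a = l" if "s = r \<or> s = - r" for s
  proof -
    let ?q = "k *\<^sub>R c + s *\<^sub>R e"
    have s2: "s * s = 1 - k * k" using that r(2) by (auto simp: power2_eq_square)
    have "?q \<bullet> ?q = 1" by (simp add: inner_add_left inner_add_right cc e s2)
    then have "norm ?q = 1" by (simp add: norm_eq_1)
    moreover have "c \<bullet> ?q = k" by (simp add: inner_add_right cc e)
    ultimately have "d \<bullet> ?q = l" by (rule circle)
    then show ?thesis by (simp add: inner_add_right dd)
  qed
  have "r * sin a = 0" using l[of r] l[of "- r"] by linarith
  then have sa: "sin a = 0" using r by simp
  then have dc: "d = cos a *\<^sub>R c" using de by (simp add: a_def)
  have lk: "l = k * cos a" using l[of r] sa by simp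
  have "(cos a)\<^sup>2 = 1" using sin_cos_squared_add[of a] sa by simp
  then have "cos a = 1 \<or> cos a = - 1" by (simp add: power2_eq_1_iff)
  moreover have "cos a \<noteq> - 1"
  proof
    assume "cos a = - 1"
    then have "d \<bullet> c = - 1" "l = - k" using dd lk by simp_all
    moreover have "k \<le> c \<bullet> c" using ux(2) unfolding cc by linarith
    then have "l \<le> d \<bullet> c" using mem[OF ux(1)] by simp
    ultimately show False using ux(2) by simp
  qed
  ultimately have "d = c" "l = k" using dc lk by simp_all
  then show ?thesis using ux(4) uy(4) by simp
qed

lemma vimage_cap_injective:
  assumes "mink x x = 1" "mink y y = 1" "stereo -` cap x = stereo -` cap y"
  shows "x = y"
proof (rule cap_injective[OF assms(1,2)])
  have "q \<in> cap x \<longleftrightarrow> q \<in> cap y" for q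
  proof (cases "norm q = 1")
    case True
    then obtain p where "q = stereo p" using stereo_surj by blast
    then show ?thesis using assms(3) by blast
  qed (simp add: mem_cap)
  then show "cap x = cap y" by blast
qed

lemma overlap_angle_mink:
  assumes "overlap_angle (stereo -` cap x) (stereo -` cap y) a" "mink x x = 1" "mink y y = 1"
  shows "mink x y = - cos a"
proof -
  obtain z r z' r' where d: "round_disk (stereo -` cap x) z r" "round_disk (stereo -` cap y) z' r'"
    and a: "cos a = (cos r * cos r' - cos (sph_dist z z')) / (sin r * sin r')"
    using assms(1) unfolding overlap_angle_def by blast
  have "x = disk_vector z r" "y = disk_vector z' r'"
    using round_disk_vector[OF d(1)] round_disk_vector[OF d(2)] assms(2,3)
    by (auto intro!: vimage_cap_injective)
  moreover have "cos (sph_dist z z') = stereo z \<bullet> stereo z'"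
    using stereo_inner_bound by (simp add: sph_dist_def cos_arccos_abs)
  ultimately show ?thesis by (simp add: mink_disk_vector a diff_divide_distrib)
qed

lemma round_disk_of_vector:
  assumes x: "mink x x = 1" and z: "stereo z = center x"
  shows "round_disk (stereo -` cap x) z (arccos (height x))"
proof -
  have h: "- 1 < height x" "height x < 1" using unit_center_height(2)[OF x] by auto
  then have a: "0 < arccos (height x)" "arccos (height x) < pi" using arccos_lt_bounded by blast+
  have "stereo q \<in> cap x \<longleftrightarrow> sph_dist z q \<le> arccos (height x)" for q
    using a h by (simp add: sph_dist_le_iff mem_cap_center[OF x] z)
  then show ?thesis using a unfolding round_disk_def by auto
qed

lemma limit_in_caps:
  assumes unit: "\<And>n. mink (x n) (x n) = 1" and q: "\<And>n. norm (q n) = 1" "q \<longlonglongrightarrow> p"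
    and lim: "(\<lambda>n. center (x n)) \<longlonglongrightarrow> c" "(\<lambda>n. height (x n)) \<longlonglongrightarrow> k"
  shows "norm p = 1" and "(\<And>n. q n \<in> cap (x n)) \<Longrightarrow> k \<le> c \<bullet> p" and "(\<And>n. q n \<notin> cap (x n)) \<Longrightarrow> c \<bullet> p \<le> k"
proof -
  have "(\<lambda>n. norm (q n)) \<longlonglongrightarrow> norm p" using q(2) by (rule tendsto_norm)
  then show "norm p = 1" using q(1) by (simp add: LIMSEQ_const_iff)
  have l: "(\<lambda>n. center (x n) \<bullet> q n) \<longlonglongrightarrow> c \<bullet> p" by (intro tendsto_intros lim q)
  show "k \<le> c \<bullet> p" if "\<And>n. q n \<in> cap (x n)"
    by (rule tendsto_le[OF _ l lim(2)]) (use that in \<open>auto simp: mem_cap_center[OF unit]\<close>)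
  show "c \<bullet> p \<le> k" if "\<And>n. q n \<notin> cap (x n)"
  proof (rule tendsto_le[OF _ lim(2) l])
    have "center (x n) \<bullet> q n \<le> height (x n)" for n
      using that[of n] q(1)[of n] by (simp add: mem_cap_center[OF unit])
    then show "\<forall>\<^sub>F n in sequentially. center (x n) \<bullet> q n \<le> height (x n)" by simp
  qed simp
qed

lemma compact_angles_subsequence:
  fixes T :: "'v::finite set set"
  assumes K: "compactin (angle_topology T) K" and \<Theta>: "\<And>n. \<Theta> n \<in> K"
  shows "K \<subseteq> angle_space T"
    and "\<exists>r \<Theta>'. strict_mono (r :: nat \<Rightarrow> nat) \<and> \<Theta>' \<in> angle_space T \<and>
      (\<forall>e\<in>edges T. (\<lambda>n. \<Theta> (r n) e) \<longlonglongrightarrow> \<Theta>' e)"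
proof -
  have K': "compactin (powertop_real (edges T)) K" and sub: "K \<subseteq> angle_space T"
    using K unfolding angle_topology_def by (auto simp: compactin_subtopology)
  show "K \<subseteq> angle_space T" by fact
  have ran: "\<Theta> n \<in> edges T \<rightarrow>\<^sub>E {0<..<pi}" for n using \<Theta> sub unfolding angle_space_def by blast
  have "bounded (range (\<lambda>n. \<Theta> n e))" if "e \<in> edges T" for e
  proof (rule boundedI)
    fix y assume "y \<in> range (\<lambda>n. \<Theta> n e)"
    then obtain n where "y = \<Theta> n e" by blast
    then show "norm y \<le> pi" using PiE_mem[OF ran[of n] that] by simp
  qed
  then obtain r l where r: "strict_mono (r :: nat \<Rightarrow> nat)" "\<And>e. e \<in> edges T \<Longrightarrow> (\<lambda>n. \<Theta> (r n) e) \<longlonglongrightarrow> l e"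
    using finite_family_convergent_subsequence[of "edges T" "\<lambda>e n. \<Theta> n e"] by auto
  let ?l = "restrict l (edges T)"
  have "limitin (powertop_real (edges T)) (\<lambda>n. \<Theta> (r n)) ?l sequentially"
    unfolding limitin_componentwise
  proof (intro conjI ballI)
    have "\<Theta> (r n) \<in> topspace (powertop_real (edges T))" for n
      using ran[of "r n"] by (auto simp: PiE_iff)
    then show "\<forall>\<^sub>F n in sequentially. \<Theta> (r n) \<in> topspace (powertop_real (edges T))" by simp
  qed (use r in auto)
  moreover have "closedin (powertop_real (edges T)) K"
    by (intro compactin_imp_closedin K') (simp add: Hausdorff_space_product_topology)
  ultimately have "?l \<in> K" by (rule limitin_closedin) (use \<Theta> in auto)
  then have "?l \<in> angle_space T" using sub by blast
  moreover have "\<forall>e\<in>edges T. (\<lambda>n. \<Theta> (r n) e) \<longlonglongrightarrow> ?l e" using r(2) by simp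
  ultimately show "\<exists>r \<Theta>'. strict_mono (r :: nat \<Rightarrow> nat) \<and> \<Theta>' \<in> angle_space T \<and>
      (\<forall>e\<in>edges T. (\<lambda>n. \<Theta> (r n) e) \<longlonglongrightarrow> \<Theta>' e)" using r(1) by blast
qed

lemma pattern_vectors:
  assumes cp: "circle_pattern P" and cg: "has_contact_graph P T" and oa: "overlap_angle_function T P \<Theta>"
  obtains x where "realizes T \<Theta> x" "\<And>v. P v = stereo -` cap (x v)"
proof -
  obtain z r where zr: "\<And>v. round_disk (P v) (z v) (r v)"
    using cp unfolding circle_pattern_def by metis
  define x where "x = (\<lambda>v. disk_vector (z v) (r v))"
  note d = round_disk_vector[OF zr, folded x_def]
  have x1: "mink (x v) (x v) = 1" and Px: "P v = stereo -` cap (x v)" for v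
    using d(1)[of v] d(2)[of v] by (simp_all add: x_def)
  have "mink (x u) (x w) = - cos (\<Theta> {u, w})" if "{u, w} \<in> edges T" for u w
    using oa that unfolding overlap_angle_function_def
    by (intro overlap_angle_mink x1) (simp flip: Px)
  moreover have "cap (x u) \<inter> cap (x w) \<noteq> {} \<longleftrightarrow> {u, w} \<in> edges T" if "u \<noteq> w" for u w
  proof -
    have "cap (x u) \<inter> cap (x w) \<noteq> {} \<longleftrightarrow> P u \<inter> P w \<noteq> {}"
    proof
      assume "cap (x u) \<inter> cap (x w) \<noteq> {}"
      then obtain q where q: "q \<in> cap (x u)" "q \<in> cap (x w)" by blast
      then obtain p where "q = stereo p" using stereo_surj[of q] by (auto simp: mem_cap)
      then show "P u \<inter> P w \<noteq> {}" using q unfolding Px by blast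
    next
      assume "P u \<inter> P w \<noteq> {}"
      then show "cap (x u) \<inter> cap (x w) \<noteq> {}" unfolding Px by blast
    qed
    then show ?thesis using cg that unfolding has_contact_graph_def by blast
  qed
  ultimately have "realizes T \<Theta> x" using x1 by (simp add: realizes_def)
  then show thesis using that Px by blast
qed

lemma pattern_exterior_point:
  assumes irr: "irreducible_pattern P" and P: "\<And>v. P v = stereo -` cap (x v)"
  shows "\<exists>q. \<forall>w. w \<noteq> v \<longrightarrow> stereo q \<notin> cap (x w)"
proof -
  have "(\<Union>w\<in>UNIV - {v}. P w) \<subset> UNIV"
    using irr unfolding irreducible_pattern_def by (metis Diff_subset UNIV_I insert_Diff insert_not_empty psubsetI
        Diff_insert_absorb insertI1 DiffD2)
  then obtain q where "q \<notin> (\<Union>w\<in>UNIV - {v}. P w)" by blast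
  then show ?thesis unfolding P by blast
qed

theorem theorem1p5:
  fixes T :: "'v::finite set set"
    and P :: "nat \<Rightarrow> 'v \<Rightarrow> riemann_sphere set"
    and \<Theta> :: "nat \<Rightarrow> 'v set \<Rightarrow> real"
    and K :: "('v set \<Rightarrow> real) set"
  assumes "sphere_triangulation T"
    and "CARD('v) > 4"
    and "\<And>n. circle_pattern (P n)"
    and "\<And>n. irreducible_pattern (P n)"
    and "\<And>n. has_contact_graph (P n) T"
    and "\<And>n. overlap_angle_function T (P n) (\<Theta> n)"
    and "compactin (angle_topology T) K"
    and "\<And>n. \<Theta> n \<in> K"
  shows "\<exists>(\<sigma> :: nat \<Rightarrow> nat) (\<phi> :: nat \<Rightarrow> riemann_sphere \<Rightarrow> riemann_sphere)
           (Q :: 'v \<Rightarrow> riemann_sphere set).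
           strict_mono \<sigma> \<and> (\<forall>n. fractional_map (\<phi> n)) \<and>
           circle_pattern Q \<and> irreducible_pattern Q \<and> has_contact_graph Q T \<and>
           patterns_converge (\<lambda>k v. \<phi> (\<sigma> k) ` P (\<sigma> k) v) Q"
proof -
  note T = assms(1) and card = assms(2)
  have \<Theta>W: "\<Theta> n \<in> angle_space T" for n using compact_angles_subsequence(1)[where \<Theta> = \<Theta>, OF assms(7,8)] assms(8) by blast
  have "\<exists>x. realizes T (\<Theta> n) x \<and> (\<forall>v. P n v = stereo -` cap (x v))" for n
    using pattern_vectors[OF assms(3,5,6), of n] by metis
  then obtain x0 where x0: "\<And>n. realizes T (\<Theta> n) (x0 n)" "\<And>n v. P n v = stereo -` cap (x0 n v)"
    by metis
  have "T \<noteq> {}" using T by (auto simp: sphere_triangulation_def)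
  then obtain t0 where t0: "t0 \<in> T" by blast
  then have "card t0 = 3" using T by (auto simp: sphere_triangulation_def)
  then obtain a b d where abd: "t0 = {a, b, d}" by (auto simp: card_3_iff)
  have "\<exists>m e. m > 0 \<and> (\<forall>v\<in>t0. snd (boost m e (x0 n v)) = 0)" for n
  proof -
    have f: "{a, b, d} \<in> T" using t0 abd by simp
    note e = triangle_edges[OF T f]
    have "posdef3 (x0 n a) (x0 n b) (x0 n d)"
      using x0(1)[of n] e by (intro face_posdef3[OF T \<Theta>W[of n] f]) (auto simp: realizes_def)
    from normalizing_boost[OF this] show ?thesis unfolding abd by (metis empty_iff insertE)
  qed
  then obtain m e where m: "\<And>n. m n > 0" and snd0: "\<And>n v. v \<in> t0 \<Longrightarrow> snd (boost (m n) (e n) (x0 n v)) = 0"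
    by metis
  define x where "x = (\<lambda>n v. boost (m n) (e n) (x0 n v))"
  define \<phi> where "\<phi> = (\<lambda>n. linear_fractional (of_real (m n)) (e n) 0 1)"
  have x: "realizes T (\<Theta> n) (x n)" for n unfolding x_def by (rule realizes_boost[OF m x0(1)])
  have unit: "mink (x n v) (x n v) = 1" for n v using x by (simp add: realizes_def)
  have \<phi>P: "\<phi> n ` P n v = stereo -` cap (x n v)" for n v
    unfolding \<phi>_def x0(2) x_def by (rule boost_image[OF m])
  have frac: "fractional_map (\<phi> n)" for n
    unfolding fractional_map_def \<phi>_def
    by (intro exI[of _ "of_real (m n)"] exI[of _ "e n"] exI[of _ 0] exI[of _ 1] conjI disjI1)
      (use m[of n] in auto)
  have irr: "\<exists>q. norm q = 1 \<and> (\<forall>w. w \<noteq> v \<longrightarrow> q \<notin> cap (x n w))" for n v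
  proof -
    obtain q where q: "\<And>w. w \<noteq> v \<Longrightarrow> stereo q \<notin> cap (x0 n w)"
      using pattern_exterior_point[OF assms(4)[of n] x0(2)[of n], of v] by blast
    have "stereo (\<phi> n q) \<notin> cap (x n w)" if "w \<noteq> v" for w
      using q[OF that] boost_cap[OF m] unfolding x_def \<phi>_def by metis
    then show ?thesis using norm_stereo by blast
  qed
  obtain r1 \<Theta>' where r1: "strict_mono r1" and \<Theta>': "\<Theta>' \<in> angle_space T"
    and lim_\<Theta>1: "\<And>e. e \<in> edges T \<Longrightarrow> (\<lambda>n. \<Theta> (r1 n) e) \<longlonglongrightarrow> \<Theta>' e"
    using compact_angles_subsequence(2)[where \<Theta> = \<Theta>, OF assms(7,8)] by blast
  have "bounded (range (\<lambda>n. (center (x (r1 n) v), height (x (r1 n) v))))" for v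
  proof (rule bounded_subset)
    show "bounded (cball (0 :: real ^ 3) 1 \<times> cball (0 :: real) 1)" by (intro bounded_Times bounded_cball)
    show "range (\<lambda>n. (center (x (r1 n) v), height (x (r1 n) v))) \<subseteq> cball 0 1 \<times> cball 0 1"
      using unit_center_height(1,2)[OF unit] by (auto simp: less_imp_le)
  qed
  then obtain r2 l where r2: "strict_mono r2"
    and l: "\<And>v. (\<lambda>n. (center (x (r1 (r2 n)) v), height (x (r1 (r2 n)) v))) \<longlonglongrightarrow> l v"
    using finite_family_convergent_subsequence[of UNIV "\<lambda>v n. (center (x (r1 n) v), height (x (r1 n) v))"] by auto
  define \<sigma> where "\<sigma> = r1 \<circ> r2"
  have \<sigma>: "strict_mono \<sigma>" unfolding \<sigma>_def using r1 r2 by (rule strict_mono_o)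
  define c where "c = (\<lambda>v. fst (l v))"
  define k where "k = (\<lambda>v. snd (l v))"
  have lim_c: "(\<lambda>n. center (x (\<sigma> n) v)) \<longlonglongrightarrow> c v" for v
    using tendsto_fst[OF l[of v]] by (simp add: c_def \<sigma>_def)
  have lim_k: "(\<lambda>n. height (x (\<sigma> n) v)) \<longlonglongrightarrow> k v" for v
    using tendsto_snd[OF l[of v]] by (simp add: k_def \<sigma>_def)
  have lim_\<Theta>: "(\<lambda>n. \<Theta> (\<sigma> n) e) \<longlonglongrightarrow> \<Theta>' e" if "e \<in> edges T" for e
    using LIMSEQ_subseq_LIMSEQ[OF lim_\<Theta>1[OF that] r2] by (simp add: \<sigma>_def o_def)
  interpret L: limit_caps T \<Theta>' c k
    by (rule limit_caps_of_sequence[where \<Theta> = "\<lambda>n. \<Theta> (\<sigma> n)" and x = "\<lambda>n. x (\<sigma> n)" and ?t0.0 = t0,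
          OF T card \<Theta>W \<Theta>' lim_\<Theta> x irr t0 _ lim_c lim_k])
      (simp_all add: x_def snd0)
  have X: "mink (L.X v) (L.X v) = 1" "center (L.X v) = c v" "height (L.X v) = k v" for v
  proof -
    show "mink (L.X v) (L.X v) = 1" by (rule L.X_unit')
    have "L.\<rho> v > 0" by (rule L.rho_pos')
    then show "center (L.X v) = c v" "height (L.X v) = k v"
      using L.norm_c[of v] by (simp_all add: center_def height_def L.X_def)
  qed
  have mem_X: "q \<in> cap (L.X v) \<longleftrightarrow> norm q = 1 \<and> k v \<le> c v \<bullet> q" for q v
    using mem_cap_center[OF X(1)] by (simp add: X)
  define Q where "Q = (\<lambda>v. stereo -` cap (L.X v))"
  have "\<exists>z. stereo z = c v" for v using stereo_surj[OF L.norm_c] by metis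
  then obtain z' where z': "\<And>v. stereo (z' v) = c v" by metis
  have Qr: "round_disk (Q v) (z' v) (arccos (k v))" for v
    unfolding Q_def using round_disk_of_vector[OF X(1), of "z' v" v] by (simp add: X z')
  have "circle_pattern Q" unfolding circle_pattern_def using Qr by blast
  moreover have "irreducible_pattern Q"
    unfolding irreducible_pattern_def
  proof (intro allI impI)
    fix A :: "'v set" assume "A \<subset> UNIV"
    then obtain v where v: "v \<notin> A" by blast
    have "\<exists>q. norm q = 1 \<and> (\<forall>w. w \<noteq> v \<longrightarrow> q \<notin> cap (x (\<sigma> n) w))" for n by (rule irr)
    then obtain q where q: "\<And>n. norm (q n) = 1" "\<And>n w. w \<noteq> v \<Longrightarrow> q n \<notin> cap (x (\<sigma> n) w)"
      by metis
    have "bounded (range q)" by (rule boundedI[of _ 1]) (use q in auto)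
    then obtain p r where r: "strict_mono (r :: nat \<Rightarrow> nat)" "(q \<circ> r) \<longlonglongrightarrow> p"
      using bounded_imp_convergent_subsequence by blast
    have sub: "(\<lambda>n. center (x (\<sigma> (r n)) w)) \<longlonglongrightarrow> c w" "(\<lambda>n. height (x (\<sigma> (r n)) w)) \<longlonglongrightarrow> k w" for w
      using LIMSEQ_subseq_LIMSEQ[OF lim_c r(1)] LIMSEQ_subseq_LIMSEQ[OF lim_k r(1)] by (simp_all add: o_def)
    have np: "norm p = 1"
      by (rule limit_in_caps(1)[OF unit _ r(2) sub(1,2)[of v]]) (simp add: q)
    have "c w \<bullet> p \<le> k w" if "w \<noteq> v" for w
      by (rule limit_in_caps(3)[OF unit _ r(2) sub(1,2)[of w]]) (simp_all add: q that)
    then obtain y where y: "norm y = 1" "\<And>w. w \<noteq> v \<Longrightarrow> c w \<bullet> y < k w"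
      using L.exterior_point[OF np, of v] by blast
    obtain s where s: "y = stereo s" using stereo_surj[OF y(1)] by blast
    have "s \<notin> Q w" if "w \<in> A" for w
      using y(2)[of w] that v s by (auto simp: Q_def mem_X not_le)
    then show "(\<Union>v\<in>A. Q v) \<subset> UNIV" by blast
  qed
  moreover have "has_contact_graph Q T"
    unfolding has_contact_graph_def
  proof (intro allI impI iffI)
    fix u w :: 'v assume uw: "u \<noteq> w"
    show "{u, w} \<in> edges T" if "Q u \<inter> Q w \<noteq> {}"
    proof (rule ccontr)
      assume "{u, w} \<notin> edges T"
      from L.limit_caps_disjoint[OF uw this] show False using that unfolding Q_def by blast
    qed
    show "Q u \<inter> Q w \<noteq> {}" if e: "{u, w} \<in> edges T"
    proof -
      have "\<exists>q. q \<in> cap (x (\<sigma> n) u) \<and> q \<in> cap (x (\<sigma> n) w)" for n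
        using x[of "\<sigma> n"] e uw unfolding realizes_def by blast
      then obtain q where q: "\<And>n. q n \<in> cap (x (\<sigma> n) u)" "\<And>n. q n \<in> cap (x (\<sigma> n) w)" by metis
      have q1: "norm (q n) = 1" for n using q(1) by (auto simp: mem_cap)
      have "bounded (range q)" by (rule boundedI[of _ 1]) (use q1 in auto)
      then obtain p r where r: "strict_mono (r :: nat \<Rightarrow> nat)" "(q \<circ> r) \<longlonglongrightarrow> p"
        using bounded_imp_convergent_subsequence by blast
      have sub: "(\<lambda>n. center (x (\<sigma> (r n)) w)) \<longlonglongrightarrow> c w" "(\<lambda>n. height (x (\<sigma> (r n)) w)) \<longlonglongrightarrow> k w" for w
        using LIMSEQ_subseq_LIMSEQ[OF lim_c r(1)] LIMSEQ_subseq_LIMSEQ[OF lim_k r(1)] by (simp_all add: o_def)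
      have np: "norm p = 1"
        by (rule limit_in_caps(1)[OF unit _ r(2) sub(1,2)[of u]]) (simp add: q1)
      have "k u \<le> c u \<bullet> p"
        by (rule limit_in_caps(2)[OF unit _ r(2) sub(1,2)[of u]]) (simp_all add: q1 q)
      moreover have "k w \<le> c w \<bullet> p"
        by (rule limit_in_caps(2)[OF unit _ r(2) sub(1,2)[of w]]) (simp_all add: q1 q)
      moreover obtain s where "p = stereo s" using stereo_surj[OF np] by blast
      ultimately have "s \<in> Q u \<inter> Q w" using np by (simp add: Q_def mem_X)
      then show ?thesis by blast
    qed
  qed
  moreover have "patterns_converge (\<lambda>k v. \<phi> (\<sigma> k) ` P (\<sigma> k) v) Q"
    unfolding patterns_converge_def
  proof
    fix v
    have "\<exists>z. stereo z = center (x (\<sigma> n) v)" for n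
      using stereo_surj[OF unit_center_height(1)[OF unit]] by metis
    then obtain z where z: "\<And>n. stereo (z n) = center (x (\<sigma> n) v)" by metis
    have rd: "round_disk (\<phi> (\<sigma> n) ` P (\<sigma> n) v) (z n) (arccos (height (x (\<sigma> n) v)))" for n
      unfolding \<phi>P by (rule round_disk_of_vector[OF unit z])
    have "(\<lambda>n. stereo (z n) \<bullet> stereo (z' v)) \<longlonglongrightarrow> c v \<bullet> c v"
      unfolding z z' by (intro tendsto_intros lim_c)
    then have "(\<lambda>n. arccos (stereo (z n) \<bullet> stereo (z' v))) \<longlonglongrightarrow> arccos 1"
      using stereo_inner_bound
      by (intro continuous_on_tendsto_compose[OF continuous_on_arccos']) (auto simp: L.cc abs_le_iff)
    then have d0: "(\<lambda>n. sph_dist (z n) (z' v)) \<longlonglongrightarrow> 0" by (simp add: sph_dist_def)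
    have "isCont arccos (k v)" using L.no_degenerate[of v] by (intro isCont_arccos) auto
    then have r0: "(\<lambda>n. arccos (height (x (\<sigma> n) v))) \<longlonglongrightarrow> arccos (k v)"
      using lim_k by (rule isCont_tendsto_compose)
    show "\<exists>z r z' r'. (\<forall>k. round_disk (\<phi> (\<sigma> k) ` P (\<sigma> k) v) (z k) (r k)) \<and> round_disk (Q v) z' r' \<and>
        (\<lambda>k. sph_dist (z k) z') \<longlonglongrightarrow> 0 \<and> r \<longlonglongrightarrow> r'"
      using rd Qr[of v] d0 r0
      by (intro exI[of _ z] exI[of _ "\<lambda>n. arccos (height (x (\<sigma> n) v))"] exI[of _ "z' v"] exI[of _ "arccos (k v)"]) simp
  qed
  ultimately show ?thesis using \<sigma> frac by blast
qed

end
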